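(* Let $T>0$, let $\rho_B:V_0\to\mathbb R$ be arbitrary, let $\rho_\circ\in L^2(K,m)$, and let $\Phi:\mathbb R\to\mathbb R$ be Lipschitz continuous. Then there is at most one weak solution of the reaction--diffusion equation with Dirichlet boundary condition \[ \partial_t\rho=\tfrac23\Delta\rho+\Phi(\rho)\ \text{on } (0,T]\times(K\setminus V_0),\qquad \rho(t,a)=\rho_B(a)\ (a\in V_0),\qquad \rho(0,\cdot)=\rho_\circ, \] in the sense of weak solutions defined below.
   Context: Sierpiński gasket: let $a_0=(\tfrac12,\tfrac{\sqrt3}2)$, $a_1=(0,0)$, $a_2=(1,0)$ in $\mathbb R^2$, $V_0=\{a_0,a_1,a_2\}$, $\varphi_i(x)=(x+a_i)/2$ for $i=0,1,2$, and let $K$ be the unique nonempty compact set with $K=\bigcup_{i=0}^2\varphi_i(K)$. For a word $w=w_1\cdots w_j$ with letters in $\{0,1,2\}$ set $\varphi_w=\varphi_{w_1}\circ\cdots\circ\varphi_{w_j}$. Let $V_N=\bigcup_{|w|=N}\varphi_w(V_0)$, and for $x\neq y$ in $V_N$ write $x\sim y$ if $x,y\in\varphi_w(V_0)$ for some word $w$ with $|w|=N$. Let $m$ be the self-similar probability measure on $K$ (so $m(\varphi_w(K))=3^{-|w|}$). Energy: for $f:K\to\mathbb R$, $\mathcal E_N(f)=\frac12(\frac53)^N\sum_{x\in V_N}\sum_{y\in V_N,y\sim x}(f(y)-f(x))^2$; this is nondecreasing in $N$, and $\mathcal E(f)=\lim_N\mathcal E_N(f)\in[0,\infty]$. Let $\mathcal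 F=\{f:\mathcal E(f)<\infty\}$ (which is contained in $C(K)$), $\mathcal E(f,g)=\frac14(\mathcal E(f+g)-\mathcal E(f-g))$, and equip $\mathcal F$ with the inner product $\mathcal E_1(f,g)=\mathcal E(f,g)+\int_K fg\,dm$. $L^2(\mathcal F)$ denotes $L^2(0,T;\mathcal F)$ with inner product $\int_0^T\mathcal E_1(F_t,G_t)dt$. Laplacian: $u\in\mathcal F$ belongs to $\mathcal D(\Delta)$ if there is $f\in C(K)$ with $\mathcal E(u,\varphi)=\int_K f\varphi\,dm$ for all $\varphi\in\mathcal F$ with $\varphi|_{V_0}=0$; then $\Delta u:=-f$. $\mathcal D_0(\Delta)=\{u\in\mathcal D(\Delta):u|_{V_0}=0\}$. For $u\in\mathcal D(\Delta)$ and $a\in V_0$, the normal derivative $\partial^\perp u(a)=\lim_{N\to\infty}(\frac53)^N\sum_{y\in V_N,y\sim a}(u(a)-u(y))$ exists. Weak solution: a measurable $\rho:[0,T]\times K\to\mathbb R$ (write $\rho_t=\rho(t,\cdot)$) is a weak solution if (i) $\rho\in L^2(\mathcal F)$; (ii) $\rho_t|_{V_0}=\rho_B$ for a.e. $t\in(0,T)$; (iii) for all $t\in(0,T)$ and all $F\in C^1((0,T);\mathcal D_0(\Delta))\cap C([0,T];\mathcal D_0(\Delta))$, \[ 0=\int_K\rho_tF_t\,dm-\int_K\rho_\circ F_0\,dm-\int_0^t\!\!\int_K\rho_s\Big(\tfrac23\Delta+\partial_s\Big)F_s\,dm\,ds-\int_0^t\!\!\int_K\Phi(\rho_s)F_s\,dm\,ds+\tfrac23\int_0^t\sum_{a\in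 V_0}\rho_B(a)\partial^\perp F_s(a)\,ds. \] *)

theory Defs
  imports "HOL-Analysis.Analysis" "HOL-Probability.Probability"
begin

type_synonym pt = "real \<times> real"

definition sg_a :: "nat \<Rightarrow> pt" where
  "sg_a i = (if i = 0 then (1/2, sqrt 3 / 2) else if i = 1 then (0, 0) else (1, 0))"

definition sg_V0 :: "pt set" where
  "sg_V0 = sg_a ` {0, 1, 2}"

definition sg_phi :: "nat \<Rightarrow> pt \<Rightarrow> pt" where
  "sg_phi i x = (1/2) *\<^sub>R (x + sg_a i)"

definition sg_phiw :: "nat list \<Rightarrow> pt \<Rightarrow> pt" where
  "sg_phiw w = foldr (\<lambda>i f. sg_phi i \<circ> f) w id"

definition sg_words :: "nat \<Rightarrow> nat list set" where
  "sg_words N = {w. length w = N \<and> set w \<subseteq> {0, 1, 2}}"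

definition sg_K :: "pt set" where
  "sg_K = (THE K. compact K \<and> K \<noteq> {} \<and> K = (\<Union>i\<in>{0, 1, 2}. sg_phi i ` K))"

definition sg_V :: "nat \<Rightarrow> pt set" where
  "sg_V N = (\<Union>w\<in>sg_words N. sg_phiw w ` sg_V0)"

definition sg_adj :: "nat \<Rightarrow> pt \<Rightarrow> pt \<Rightarrow> bool" where
  "sg_adj N x y \<longleftrightarrow> x \<in> sg_V N \<and> y \<in> sg_V N \<and> x \<noteq> y \<and>
     (\<exists>w\<in>sg_words N. x \<in> sg_phiw w ` sg_V0 \<and> y \<in> sg_phiw w ` sg_V0)"

definition sg_m :: "pt measure" where
  "sg_m = (THE M. sets M = sets borel \<and> emeasure M (UNIV - sg_K) = 0 \<and>
     (\<forall>w\<in>(\<Union>N. sg_words N). emeasure M (sg_phiw w ` sg_K) = ennreal (1 / 3 ^ length w)))"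

definition sg_EN :: "nat \<Rightarrow> (pt \<Rightarrow> real) \<Rightarrow> real" where
  "sg_EN N f = 1/2 * (5/3) ^ N *
     (\<Sum>x\<in>sg_V N. \<Sum>y\<in>{y\<in>sg_V N. sg_adj N x y}. (f y - f x)^2)"

definition sg_energy :: "(pt \<Rightarrow> real) \<Rightarrow> ereal" where
  "sg_energy f = lim (\<lambda>N. ereal (sg_EN N f))"

definition sg_F :: "(pt \<Rightarrow> real) set" where
  "sg_F = {f. continuous_on sg_K f \<and> sg_energy f < \<infinity>}"

definition sg_form :: "(pt \<Rightarrow> real) \<Rightarrow> (pt \<Rightarrow> real) \<Rightarrow> real" where
  "sg_form f g = (real_of_ereal (sg_energy (\<lambda>x. f x + g x))
                  - real_of_ereal (sg_energy (\<lambda>x. f x - g x))) / 4"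

definition sg_E1sq :: "(pt \<Rightarrow> real) \<Rightarrow> ennreal" where
  "sg_E1sq f = e2ennreal (sg_energy f) + (\<integral>\<^sup>+x. indicator sg_K x * ennreal ((f x)^2) \<partial>sg_m)"

definition sg_lap_witness :: "(pt \<Rightarrow> real) \<Rightarrow> (pt \<Rightarrow> real) \<Rightarrow> bool" where
  "sg_lap_witness u f \<longleftrightarrow> continuous_on sg_K f \<and>
     (\<forall>v\<in>sg_F. (\<forall>a\<in>sg_V0. v a = 0) \<longrightarrow> sg_form u v = (\<integral>x\<in>sg_K. f x * v x \<partial>sg_m))"

definition sg_domLap :: "(pt \<Rightarrow> real) set" where
  "sg_domLap = {u\<in>sg_F. \<exists>f. sg_lap_witness u f}"

definition sg_domLap0 :: "(pt \<Rightarrow> real) set" where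
  "sg_domLap0 = {u\<in>sg_domLap. \<forall>a\<in>sg_V0. u a = 0}"

definition sg_lap :: "(pt \<Rightarrow> real) \<Rightarrow> pt \<Rightarrow> real" where
  "sg_lap u = (\<lambda>x. - (SOME f. sg_lap_witness u f) x)"

definition sg_normal :: "(pt \<Rightarrow> real) \<Rightarrow> pt \<Rightarrow> real" where
  "sg_normal u a = lim (\<lambda>N. (5/3) ^ N * (\<Sum>y\<in>{y\<in>sg_V N. sg_adj N a y}. u a - u y))"

definition sg_supK :: "(pt \<Rightarrow> real) \<Rightarrow> real" where
  "sg_supK g = (SUP x\<in>sg_K. \<bar>g x\<bar>)"

definition sg_distD :: "(pt \<Rightarrow> real) \<Rightarrow> (pt \<Rightarrow> real) \<Rightarrow> real" where
  "sg_distD u v = sg_supK (\<lambda>x. u x - v x) + sg_supK (\<lambda>x. sg_lap u x - sg_lap v x)"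

text \<open>G is the time derivative of F in D(Laplacian), and the pair is an admissible
  test function: F in C^1((0,T); D_0) and C([0,T]; D_0), with derivative G.\<close>
definition sg_test :: "real \<Rightarrow> (real \<Rightarrow> pt \<Rightarrow> real) \<Rightarrow> (real \<Rightarrow> pt \<Rightarrow> real) \<Rightarrow> bool" where
  "sg_test T F G \<longleftrightarrow>
     (\<forall>t\<in>{0..T}. F t \<in> sg_domLap0) \<and>
     (\<forall>t\<in>{0<..<T}. G t \<in> sg_domLap0) \<and>
     (\<forall>t\<in>{0..T}. ((\<lambda>s. sg_distD (F s) (F t)) \<longlongrightarrow> 0) (at t within {0..T})) \<and>
     (\<forall>t\<in>{0<..<T}. ((\<lambda>s. sg_supK (\<lambda>x. (F s x - F t x) / (s - t) - G t x)
                        + sg_supK (\<lambda>x. (sg_lap (F s) x - sg_lap (F t) x) / (s - t) - sg_lap (G t) x))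
                     \<longlongrightarrow> 0) (at t)) \<and>
     (\<forall>t\<in>{0<..<T}. ((\<lambda>s. sg_distD (G s) (G t)) \<longlongrightarrow> 0) (at t))"

definition sg_weak_solution ::
  "real \<Rightarrow> (pt \<Rightarrow> real) \<Rightarrow> (pt \<Rightarrow> real) \<Rightarrow> (real \<Rightarrow> real) \<Rightarrow> (real \<Rightarrow> pt \<Rightarrow> real) \<Rightarrow> bool" where
  "sg_weak_solution T \<rho>B \<rho>0 \<Phi> \<rho> \<longleftrightarrow>
     (\<lambda>(t, x). \<rho> t x) \<in> borel_measurable (restrict_space borel ({0..T} \<times> sg_K)) \<and>
     \<comment> \<open>(i) rho in L^2(0,T;F)\<close>
     (AE t in lborel. t \<in> {0<..<T} \<longrightarrow> \<rho> t \<in> sg_F) \<and>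
     (\<integral>\<^sup>+t. indicator {0<..<T} t * sg_E1sq (\<rho> t) \<partial>lborel) < \<infinity> \<and>
     \<comment> \<open>(ii) boundary values\<close>
     (AE t in lborel. t \<in> {0<..<T} \<longrightarrow> (\<forall>a\<in>sg_V0. \<rho> t a = \<rho>B a)) \<and>
     \<comment> \<open>(iii) weak formulation\<close>
     (\<forall>t\<in>{0<..<T}. \<forall>F G. sg_test T F G \<longrightarrow>
        set_integrable lborel {0..t}
          (\<lambda>s. \<integral>x\<in>sg_K. \<rho> s x * (2/3 * sg_lap (F s) x + G s x) \<partial>sg_m) \<longrightarrow>
        set_integrable lborel {0..t} (\<lambda>s. \<integral>x\<in>sg_K. \<Phi> (\<rho> s x) * F s x \<partial>sg_m) \<longrightarrow>
        set_integrable lborel {0..t} (\<lambda>s. \<Sum>a\<in>sg_V0. \<rho>B a * sg_normal (F s) a) \<longrightarrow>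
        0 = (\<integral>x\<in>sg_K. \<rho> t x * F t x \<partial>sg_m) - (\<integral>x\<in>sg_K. \<rho>0 x * F 0 x \<partial>sg_m)
            - (\<integral>s\<in>{0..t}. (\<integral>x\<in>sg_K. \<rho> s x * (2/3 * sg_lap (F s) x + G s x) \<partial>sg_m) \<partial>lborel)
            - (\<integral>s\<in>{0..t}. (\<integral>x\<in>sg_K. \<Phi> (\<rho> s x) * F s x \<partial>sg_m) \<partial>lborel)
            + 2/3 * (\<integral>s\<in>{0..t}. (\<Sum>a\<in>sg_V0. \<rho>B a * sg_normal (F s) a) \<partial>lborel))"

end

theory Submission
  imports Defs
begin

text \<open>Let \<open>d\<close> be the difference of two solutions, \<open>p\<close> the difference of their reaction terms and \<open>G\<close> the Green
  operator of the Dirichlet Laplacian, obtained from the Riesz representation theorem in the space of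
  finite-energy functions vanishing on the boundary. Testing with the time-independent functions \<open>G f\<close>
  removes the initial and boundary data and shows that \<open>Y = G d\<close> is the time integral of
  \<open>Z = G p - (2/3) d\<close>. Hence the energy of \<open>Y\<close> has derivative
  \<open>2 E(Z, Y) = 2 \<integral> p Y dm - (4/3) \<integral> d^2 dm\<close>, where the first term is absorbed by the second
  up to a multiple of \<open>\<integral> Y^2 dm\<close>, because \<open>p\<close> is bounded by \<open>L\<close> times \<open>d\<close>. The energy dominates
  the square of the supremum norm, so Gronwall's inequality gives \<open>Y = 0\<close> and then \<open>d = 0\<close>. The derivative
  of the energy is computed on the finite graphs, where it is the scalar
  identity \<open>(\<integral> f)^2 = 2 \<integral> f(s) (\<integral>\<^bsub>r \<le> s\<^esub> f(r) dr) ds\<close>, and passes to the limit by dominated convergence.\<close>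

section \<open>Geometry of the gasket\<close>

text \<open>A weak solution has no time derivative and its test functions must lie in the domain of
  the Laplacian, so \<open>d\<close> itself cannot be inserted as a test. This is why the estimate
  is made one order lower, for E(G d, G d) = \<integral> d G d dm, the square of a dual norm of
  \<open>d\<close>. Evaluation at a point is a bounded functional on the energy space. Hence
  \<open>G\<close> is an integral operator whose kernel consists of representing functions,
  measurability in time is visible from the formula, and identities can be checked point by point on
  the vertices. The weak equation holds at every interior time for all tests, so one null set of
  times serves all test functions and all points. Before any of this, everything defined by
  description or choice has to be pinned down: \<open>sg_K\<close> and \<open>sg_m\<close> need
  existence and uniqueness, and \<open>sg_lap\<close> needs enough finite-energy functions that
  vanish on the boundary; these are built from products of harmonic functions.\<close>

definition sg_I :: "nat set" where
  "sg_I = {0, 1, 2}"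

lemma sg_I_simps [simp]: "0 \<in> sg_I" "Suc 0 \<in> sg_I" "2 \<in> sg_I" "finite sg_I" "card sg_I = 3" "sg_I \<noteq> {}"
  by (auto simp: sg_I_def)

lemma sg_IE:
  assumes "i \<in> sg_I"
  obtains "i = 0" | "i = 1" | "i = 2"
  using assms by (auto simp: sg_I_def)

lemma sum_sg_I: "sum f sg_I = f 0 + f 1 + f 2"
  by (simp add: sg_I_def add.assoc)

lemma sg_V0_eq: "sg_V0 = sg_a ` sg_I"
  by (simp add: sg_V0_def sg_I_def)

lemma sg_words_eq: "sg_words N = {w. length w = N \<and> set w \<subseteq> sg_I}"
  by (simp add: sg_words_def sg_I_def)

lemma sg_phi_fixpoint [simp]: "sg_phi i (sg_a i) = sg_a i"
  by (simp add: sg_phi_def flip: scaleR_2)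

lemma sg_phi_eq_iff [simp]: "sg_phi i x = sg_phi i y \<longleftrightarrow> x = y"
  by (simp add: sg_phi_def)

lemma inj_sg_phi: "inj_on (sg_phi i) S"
  by (auto simp: inj_on_def)

lemma sg_phi_commute_corner: "sg_phi i (sg_a j) = sg_phi j (sg_a i)"
  by (simp add: sg_phi_def add.commute)

lemma continuous_on_sg_phi [continuous_intros]: "continuous_on S (sg_phi i)"
  unfolding sg_phi_def by (intro continuous_intros)

lemma dist_sg_phi: "dist (sg_phi i x) (sg_phi i y) = dist x y / 2"
proof -
  have "sg_phi i x - sg_phi i y = (1/2) *\<^sub>R (x - y)"
    by (simp add: sg_phi_def algebra_simps)
  then show ?thesis
    by (simp add: dist_norm)
qed

definition sg_unphi :: "nat \<Rightarrow> pt \<Rightarrow> pt" where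
  "sg_unphi i x = 2 *\<^sub>R x - sg_a i"

lemma sg_unphi_phi [simp]: "sg_unphi i (sg_phi i x) = x"
  by (simp add: sg_unphi_def sg_phi_def)

lemma sg_phi_unphi [simp]: "sg_phi i (sg_unphi i x) = x"
  by (simp add: sg_unphi_def sg_phi_def)

lemma continuous_on_sg_unphi [continuous_intros]: "continuous_on S (sg_unphi i)"
  unfolding sg_unphi_def by (intro continuous_intros)

lemma sg_phiw_Nil [simp]: "sg_phiw [] x = x"
  by (simp add: sg_phiw_def)

lemma sg_phiw_Cons [simp]: "sg_phiw (i # w) x = sg_phi i (sg_phiw w x)"
  by (simp add: sg_phiw_def)

lemma sg_phiw_append: "sg_phiw (u @ v) x = sg_phiw u (sg_phiw v x)"
  by (induction u) auto

lemma image_sg_phiw_Cons: "sg_phiw (i # w) ` S = sg_phi i ` sg_phiw w ` S"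
  by (auto simp: image_iff)

lemma dist_sg_phiw: "dist (sg_phiw w x) (sg_phiw w y) = dist x y / 2 ^ length w"
  by (induction w) (auto simp: dist_sg_phi)

lemma continuous_on_sg_phiw [continuous_intros]: "continuous_on S (sg_phiw w)"
proof (induction w)
  case (Cons i w)
  have "sg_phiw (i # w) = sg_phi i \<circ> sg_phiw w"
    by auto
  then show ?case
    using continuous_on_compose[OF Cons continuous_on_sg_phi] by simp
qed (simp add: sg_phiw_def continuous_on_id)

lemma sg_words_0 [simp]: "sg_words 0 = {[]}"
  by (auto simp: sg_words_eq)

lemma sg_words_Suc: "sg_words (Suc N) = (\<Union>i\<in>sg_I. (#) i ` sg_words N)"
  by (auto simp: sg_words_eq length_Suc_conv image_iff)

lemma Cons_in_sg_words [simp]: "i # w \<in> sg_words (Suc N) \<longleftrightarrow> i \<in> sg_I \<and> w \<in> sg_words N"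
  by (auto simp: sg_words_eq)

lemma finite_card_sg_words: "finite (sg_words N) \<and> card (sg_words N) = 3 ^ N"
proof -
  have eq: "sg_words N = {w. set w \<subseteq> sg_I \<and> length w = N}"
    by (auto simp: sg_words_eq)
  show ?thesis
    unfolding eq using finite_lists_length_eq[of sg_I N] card_lists_length_eq[of sg_I N] by simp
qed

lemmas finite_sg_words = finite_card_sg_words[THEN conjunct1]
lemmas card_sg_words = finite_card_sg_words[THEN conjunct2]

lemma sg_V_0 [simp]: "sg_V 0 = sg_V0"
  by (auto simp: sg_V_def)

lemma sg_V_Suc: "sg_V (Suc N) = (\<Union>i\<in>sg_I. sg_phi i ` sg_V N)"
  unfolding sg_V_def sg_words_Suc by (simp add: image_UN image_image) blast

lemma finite_sg_V0: "finite sg_V0"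
  by (simp add: sg_V0_eq)

lemma finite_sg_V: "finite (sg_V N)"
  by (auto simp: sg_V_def finite_sg_words finite_sg_V0)

lemma sg_a_in_V0 [simp, intro]: "i \<in> sg_I \<Longrightarrow> sg_a i \<in> sg_V0"
  unfolding sg_V0_eq by blast

lemma sg_V_subset_Suc: "sg_V N \<subseteq> sg_V (Suc N)"
proof (induction N)
  case 0
  have "sg_a i \<in> sg_phi i ` sg_V0" if "i \<in> sg_I" for i
    using that by (metis imageI sg_a_in_V0 sg_phi_fixpoint)
  then show ?case
    unfolding sg_V_Suc sg_V_0 by (auto simp: sg_V0_eq)
next
  case (Suc N)
  show ?case
    unfolding sg_V_Suc[of "Suc N"] by (subst sg_V_Suc, intro UN_mono image_mono Suc order_refl)
qed

section \<open>Barycentric coordinates and overlaps of cells\<close>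

definition sg_bary :: "nat \<Rightarrow> pt \<Rightarrow> real" where
  "sg_bary i x = (if i = 0 then 2 * snd x / sqrt 3
     else if i = 1 then 1 - fst x - snd x / sqrt 3 else fst x - snd x / sqrt 3)"

text \<open>Each similarity halves all coordinates and adds 1/2 to its own, because
  \<open>sg_a j\<close> is a unit vector in these coordinates. Overlaps of cells can then be read
  off from a single coordinate.\<close>

lemma sg_bary_phi:
  assumes "i \<in> sg_I" "j \<in> sg_I"
  shows "sg_bary i (sg_phi j x) = (sg_bary i x + (if i = j then 1 else 0)) / 2"
  using assms by (elim sg_IE) (auto simp: sg_bary_def sg_phi_def sg_a_def diff_divide_distrib add_divide_distrib)

lemma sg_bary_corner:
  assumes "i \<in> sg_I" "j \<in> sg_I"
  shows "sg_bary i (sg_a j) = (if i = j then 1 else 0)"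
  using assms by (elim sg_IE) (auto simp: sg_bary_def sg_a_def field_simps)

lemma sg_bary_sum: "sg_bary 0 x + sg_bary 1 x + sg_bary 2 x = 1"
  by (simp add: sg_bary_def)

lemma sg_bary_eqI:
  assumes "\<And>i. i \<in> sg_I \<Longrightarrow> sg_bary i x = sg_bary i y"
  shows "x = y"
  using assms[of 0] assms[of 2] by (simp add: sg_bary_def prod_eq_iff)

lemma continuous_on_sg_bary [continuous_intros]: "continuous_on S (sg_bary i)"
  unfolding sg_bary_def by (cases "i = 0"; cases "i = 1") (auto intro!: continuous_intros)

lemma sg_a_eq_iff: "i \<in> sg_I \<Longrightarrow> j \<in> sg_I \<Longrightarrow> sg_a i = sg_a j \<longleftrightarrow> i = j"
  by (elim sg_IE) (auto simp: sg_a_def)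

definition sg_triangle :: "pt set" where
  "sg_triangle = {x. \<forall>i\<in>sg_I. 0 \<le> sg_bary i x}"

lemma closed_sg_triangle: "closed sg_triangle"
proof -
  have eq: "sg_triangle = (\<Inter>i\<in>sg_I. {x. 0 \<le> sg_bary i x})"
    by (auto simp: sg_triangle_def)
  show ?thesis
    unfolding eq by (intro closed_INT ballI closed_Collect_le continuous_intros)
qed

lemma bounded_sg_triangle: "bounded sg_triangle"
proof -
  have "sg_triangle \<subseteq> {0..1} \<times> {0..1}"
  proof
    fix x :: pt assume x: "x \<in> sg_triangle"
    define q where "q = snd x / sqrt 3"
    have snd: "snd x = sqrt 3 * q"
      by (simp add: q_def)
    have b: "0 \<le> 2 * q" "0 \<le> 1 - fst x - q" "0 \<le> fst x - q"
      using x by (auto simp: sg_triangle_def sg_bary_def q_def sg_I_def)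
    \<comment> \<open>Adding the last two inequalities of \<open>b\<close> gives 2 q \<le> 1, so the
      crude bound sqrt 3 \<le> 2 keeps the height at most 1.\<close>
    have "sqrt 3 * q \<le> 2 * q"
      using b by (intro mult_right_mono real_le_lsqrt) auto
    then have "0 \<le> snd x" "snd x \<le> 1" "0 \<le> fst x" "fst x \<le> 1"
      using b snd by (simp_all, linarith?)
    then show "x \<in> {0..1} \<times> {0..1}"
      by (auto simp: mem_Times_iff)
  qed
  then show ?thesis
    by (rule bounded_subset[rotated]) (intro bounded_Times bounded_closed_interval)
qed

lemma sg_phi_triangle: "i \<in> sg_I \<Longrightarrow> x \<in> sg_triangle \<Longrightarrow> sg_phi i x \<in> sg_triangle"
  by (auto simp: sg_triangle_def sg_bary_phi)

lemma sg_corner_triangle: "i \<in> sg_I \<Longrightarrow> sg_a i \<in> sg_triangle"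
  by (auto simp: sg_triangle_def sg_bary_corner)

lemma sg_bary_one_imp_corner:
  assumes "x \<in> sg_triangle" "j \<in> sg_I" "sg_bary j x \<ge> 1"
  shows "x = sg_a j"
proof (rule sg_bary_eqI)
  fix i assume i: "i \<in> sg_I"
  have "0 \<le> sg_bary 0 x" "0 \<le> sg_bary 1 x" "0 \<le> sg_bary 2 x"
    using assms(1) by (auto simp: sg_triangle_def sg_I_def)
  then show "sg_bary i x = sg_bary i (sg_a j)"
    using i assms(2,3) sg_bary_sum[of x] by (elim sg_IE) (auto simp: sg_bary_corner)
qed

text \<open>Compare the \<open>j\<close>-th coordinates of the common image: one side is half that
  of \<open>x\<close>, the other is at least 1/2. So the coordinate of \<open>x\<close> is at least
  1, which inside the triangle happens only at the corner.\<close>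

lemma sg_phi_overlap:
  assumes "x \<in> sg_triangle" "y \<in> sg_triangle" "i \<in> sg_I" "j \<in> sg_I" "i \<noteq> j"
    and "sg_phi i x = sg_phi j y"
  shows "x = sg_a j"
proof (rule sg_bary_one_imp_corner)
  have "sg_bary j (sg_phi i x) = sg_bary j (sg_phi j y)"
    using assms(6) by simp
  moreover have "0 \<le> sg_bary j y"
    using assms by (auto simp: sg_triangle_def)
  ultimately show "sg_bary j x \<ge> 1"
    using assms(3-5) by (auto simp: sg_bary_phi)
qed (use assms in auto)

lemma sg_V_subset_triangle: "sg_V N \<subseteq> sg_triangle"
proof (induction N)
  case 0
  then show ?case
    by (auto simp: sg_V0_eq intro: sg_corner_triangle)
next
  case (Suc N)
  then show ?case
    unfolding sg_V_Suc using sg_phi_triangle by blast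
qed

text \<open>A point \<open>p\<close> of \<open>A\<close> farthest from \<open>B\<close> is some
  \<open>sg_phi i a\<close> with \<open>a\<close> in \<open>A\<close>. The point of \<open>B\<close>
  nearest to \<open>a\<close> is mapped into \<open>B\<close> at half the distance, so the maximal
  distance is at most half of itself. Applied in both directions this is uniqueness of the
  attractor.\<close>

lemma sg_attractor_subset:
  assumes A: "compact A" "A \<noteq> {}" "A = (\<Union>i\<in>sg_I. sg_phi i ` A)"
    and B: "compact B" "B \<noteq> {}" "B = (\<Union>i\<in>sg_I. sg_phi i ` B)"
  shows "A \<subseteq> B"
proof -
  obtain p where p: "p \<in> A" "\<And>x. x \<in> A \<Longrightarrow> infdist x B \<le> infdist p B"
    using continuous_attains_sup[of A "\<lambda>x. infdist x B"] A(1,2) continuous_on_infdist[OF continuous_on_id]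
    by metis
  obtain i a where ia: "i \<in> sg_I" "a \<in> A" "p = sg_phi i a"
    using subsetD[OF equalityD1[OF A(3)] p(1)] by blast
  obtain b where b: "b \<in> B" "infdist a B = dist a b"
    using infdist_attains_inf[of B a] B(1,2) compact_imp_closed by metis
  have "infdist p B \<le> dist p (sg_phi i b)"
    using b(1) ia(1) by (intro infdist_le subsetD[OF equalityD2[OF B(3)]]) blast
  also have "\<dots> = infdist a B / 2"
    using b ia by (simp add: dist_sg_phi)
  also have "\<dots> \<le> infdist p B / 2"
    using p(2) ia by simp
  finally have "infdist p B = 0"
    using infdist_nonneg[of p B] by simp
  then show "A \<subseteq> B"
    using p(2) infdist_nonneg in_closed_iff_infdist_zero[of B] B(1,2) compact_imp_closed
    by (metis order_antisym subsetI)
qed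

text \<open>The vertex sets increase, so their union is already invariant; compactness lets the
  closure pass through the three images. With this attractor, density of the vertices in
  \<open>sg_K\<close> comes for free.\<close>

lemma sg_closure_V_attractor:
  defines "C \<equiv> closure (\<Union>N. sg_V N)"
  shows "compact C \<and> C \<noteq> {} \<and> C = (\<Union>i\<in>sg_I. sg_phi i ` C)"
proof (intro conjI)
  let ?V = "\<Union>N. sg_V N"
  show comp: "compact C"
    unfolding C_def compact_closure
    by (rule bounded_subset[OF bounded_sg_triangle]) (use sg_V_subset_triangle in blast)
  show "C \<noteq> {}"
    unfolding C_def closure_eq_empty using sg_a_in_V0[of 0] sg_V_0 by fastforce
  have V: "?V = (\<Union>i\<in>sg_I. sg_phi i ` ?V)"
  proof -
    have "?V = (\<Union>N. sg_V (Suc N))"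
      by (intro antisym UN_least) (use sg_V_subset_Suc in \<open>auto intro!: UN_upper\<close>)
    also have "\<dots> = (\<Union>i\<in>sg_I. sg_phi i ` ?V)"
      unfolding sg_V_Suc by auto
    finally show ?thesis .
  qed
  have cl: "closure (sg_phi i ` ?V) = sg_phi i ` C" for i
  proof
    have "closed (sg_phi i ` C)"
      using comp compact_continuous_image[OF continuous_on_sg_phi] compact_imp_closed by blast
    then show "closure (sg_phi i ` ?V) \<subseteq> sg_phi i ` C"
      by (rule closure_minimal[rotated]) (unfold C_def, intro image_mono closure_subset)
    show "sg_phi i ` C \<subseteq> closure (sg_phi i ` ?V)"
      unfolding C_def by (rule image_closure_subset[OF continuous_on_sg_phi]) (auto simp: closure_subset)
  qed
  have "C = closure (\<Union>i\<in>sg_I. sg_phi i ` ?V)"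
    unfolding C_def using V by simp
  also have "\<dots> = (\<Union>i\<in>sg_I. closure (sg_phi i ` ?V))"
    by (simp add: sg_I_def closure_Un)
  finally show "C = (\<Union>i\<in>sg_I. sg_phi i ` C)"
    using cl by simp
qed

lemma sg_K_eq_closure: "sg_K = closure (\<Union>N. sg_V N)"
  unfolding sg_K_def sg_I_def[symmetric]
proof (rule the_equality)
  show "compact (closure (\<Union>N. sg_V N)) \<and> closure (\<Union>N. sg_V N) \<noteq> {} \<and>
      closure (\<Union>N. sg_V N) = (\<Union>i\<in>sg_I. sg_phi i ` closure (\<Union>N. sg_V N))"
    by (rule sg_closure_V_attractor)
next
  fix A assume "compact A \<and> A \<noteq> {} \<and> A = (\<Union>i\<in>sg_I. sg_phi i ` A)"
  then show "A = closure (\<Union>N. sg_V N)"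
    using sg_closure_V_attractor by (intro antisym; intro sg_attractor_subset) (elim conjE, assumption)+
qed

lemma compact_sg_K: "compact sg_K"
  and sg_K_nonempty: "sg_K \<noteq> {}"
  and sg_K_self_similar: "sg_K = (\<Union>i\<in>sg_I. sg_phi i ` sg_K)"
  unfolding sg_K_eq_closure
  using sg_closure_V_attractor[THEN conjunct1] sg_closure_V_attractor[THEN conjunct2, THEN conjunct1]
    sg_closure_V_attractor[THEN conjunct2, THEN conjunct2] .

lemma closed_sg_K: "closed sg_K"
  by (rule compact_imp_closed[OF compact_sg_K])

lemma sg_V_subset_K: "sg_V N \<subseteq> sg_K"
  unfolding sg_K_eq_closure by (rule order_trans[OF UN_upper closure_subset]) simp

lemma sg_V0_subset_K: "sg_V0 \<subseteq> sg_K"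
  using sg_V_subset_K[of 0] by simp

lemma sg_corner_in_K [simp]: "i \<in> sg_I \<Longrightarrow> sg_a i \<in> sg_K"
  using sg_V0_subset_K sg_a_in_V0 by blast

lemma sg_K_subset_triangle: "sg_K \<subseteq> sg_triangle"
  unfolding sg_K_eq_closure
  by (rule closure_minimal[OF _ closed_sg_triangle]) (use sg_V_subset_triangle in blast)

lemma sg_phi_in_K: "i \<in> sg_I \<Longrightarrow> x \<in> sg_K \<Longrightarrow> sg_phi i x \<in> sg_K"
  by (rule subsetD[OF equalityD2[OF sg_K_self_similar]]) blast

lemma sg_K_cases:
  assumes "x \<in> sg_K"
  obtains i y where "i \<in> sg_I" "y \<in> sg_K" "x = sg_phi i y"
  using subsetD[OF equalityD1[OF sg_K_self_similar] assms] that by blast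

lemma sg_phi_overlap_K:
  assumes "x \<in> sg_K" "y \<in> sg_K" "i \<in> sg_I" "j \<in> sg_I" "i \<noteq> j" "sg_phi i x = sg_phi j y"
  shows "x = sg_a j" "y = sg_a i"
  using sg_phi_overlap[of x y i j] sg_phi_overlap[of y x j i] assms sg_K_subset_triangle by auto

section \<open>Cells of a given level\<close>

lemma sg_cells_cover: "sg_K = (\<Union>w\<in>sg_words N. sg_phiw w ` sg_K)"
proof (induction N)
  case (Suc N)
  have "(\<Union>w\<in>sg_words (Suc N). sg_phiw w ` sg_K) = (\<Union>i\<in>sg_I. sg_phi i ` (\<Union>w\<in>sg_words N. sg_phiw w ` sg_K))"
    unfolding sg_words_Suc by (simp add: image_UN image_image) blast
  then show ?case
    unfolding Suc[symmetric] sg_K_self_similar[symmetric] by simp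
qed simp

lemma sg_cell_subset_K: "w \<in> sg_words N \<Longrightarrow> sg_phiw w ` sg_K \<subseteq> sg_K"
  by (rule order_trans[OF UN_upper equalityD2[OF sg_cells_cover]])

lemma compact_sg_cell: "compact (sg_phiw w ` sg_K)"
  by (rule compact_continuous_image[OF continuous_on_sg_phiw compact_sg_K])

lemma sg_small_cells:
  assumes "e > 0"
  obtains N where "\<And>w x y. length w \<ge> N \<Longrightarrow> x \<in> sg_phiw w ` sg_K \<Longrightarrow> y \<in> sg_phiw w ` sg_K \<Longrightarrow> dist x y < e"
proof -
  obtain D0 where D0: "\<And>x y. x \<in> sg_K \<Longrightarrow> y \<in> sg_K \<Longrightarrow> dist x y \<le> D0"
    using compact_imp_bounded[OF compact_sg_K] unfolding bounded_two_points by metis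
  define D where "D = max 1 D0"
  have D: "D > 0" "\<And>x y. x \<in> sg_K \<Longrightarrow> y \<in> sg_K \<Longrightarrow> dist x y \<le> D"
    using D0 by (auto simp: D_def max.coboundedI2)
  obtain N where N: "D / e < 2 ^ N"
    using real_arch_pow[of 2 "D / e"] by auto
  show ?thesis
  proof (rule that[of N])
    fix w x y assume w: "length w \<ge> N" and "x \<in> sg_phiw w ` sg_K" "y \<in> sg_phiw w ` sg_K"
    then obtain x' y' where xy: "x' \<in> sg_K" "y' \<in> sg_K" "x = sg_phiw w x'" "y = sg_phiw w y'"
      by blast
    have "D / e < 2 ^ length w"
      using N power_increasing[OF w, of "2::real"] by linarith
    then have "D / 2 ^ length w < e"
      using assms by (simp add: field_simps)
    moreover have "dist x y \<le> D / 2 ^ length w"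
      using D(2)[OF xy(1,2)] by (simp add: xy dist_sg_phiw divide_right_mono)
    ultimately show "dist x y < e"
      by simp
  qed
qed

lemma sg_cell_in_ball:
  assumes "x \<in> sg_K" "e > 0"
  obtains N w where "w \<in> sg_words N" "sg_phiw w ` sg_K \<subseteq> ball x e" "x \<in> sg_phiw w ` sg_K"
proof -
  obtain N where N: "\<And>w x y. length w \<ge> N \<Longrightarrow> x \<in> sg_phiw w ` sg_K \<Longrightarrow> y \<in> sg_phiw w ` sg_K \<Longrightarrow> dist x y < e"
    using sg_small_cells[OF assms(2)] by blast
  obtain w where w: "w \<in> sg_words N" "x \<in> sg_phiw w ` sg_K"
    using subsetD[OF equalityD1[OF sg_cells_cover[of N]] assms(1)] by blast
  moreover have "length w \<ge> N"
    using w by (simp add: sg_words_eq)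
  ultimately show ?thesis
    using that[of w N] N[of w x] by (auto simp: subset_iff)
qed

section \<open>The self-similar measure\<close>

text \<open>This is the property under the definite description in \<open>sg_m\<close>; naming it
  allows existence and uniqueness to be proved before anything is claimed of
  \<open>sg_m\<close>.\<close>

definition sg_selfsimilar_measure :: "pt measure \<Rightarrow> bool" where
  "sg_selfsimilar_measure M \<longleftrightarrow> sets M = sets borel \<and> emeasure M (UNIV - sg_K) = 0 \<and>
     (\<forall>w\<in>(\<Union>N. sg_words N). emeasure M (sg_phiw w ` sg_K) = ennreal (1 / 3 ^ length w))"

lemma borel_sg_K [measurable]: "sg_K \<in> sets borel"
  using closed_sg_K by (rule borel_closed)

lemma borel_sg_cell [measurable]: "sg_phiw w ` sg_K \<in> sets borel"
  by (rule borel_compact[OF compact_sg_cell])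

lemma sg_selfsimilar_measureD:
  assumes "sg_selfsimilar_measure M"
  shows "sets M = sets borel" "prob_space M" "measure M sg_K = 1"
    "\<And>A. A \<in> sets borel \<Longrightarrow> measure M (A \<inter> sg_K) = measure M A"
    "\<And>w N. w \<in> sg_words N \<Longrightarrow> measure M (sg_phiw w ` sg_K) = 1 / 3 ^ N"
proof -
  show sets: "sets M = sets borel"
    using assms by (simp add: sg_selfsimilar_measure_def)
  have space: "space M = UNIV"
    using sets_eq_imp_space_eq[OF sets] by simp
  have cell: "emeasure M (sg_phiw w ` sg_K) = ennreal (1 / 3 ^ N)" if "w \<in> sg_words N" for w N
    using assms that by (auto simp: sg_selfsimilar_measure_def sg_words_eq)
  have K: "emeasure M sg_K = 1"
    using cell[of "[]" 0] by simp
  have N: "emeasure M (UNIV - sg_K) = 0"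
    using assms by (simp add: sg_selfsimilar_measure_def)
  have "emeasure M UNIV = emeasure M sg_K + emeasure M (UNIV - sg_K)"
    by (subst plus_emeasure) (auto simp: sets)
  then show prob: "prob_space M"
    using K N by (intro prob_spaceI) (simp add: space)
  show "measure M sg_K = 1"
    using K by (simp add: measure_def)
  show "measure M (sg_phiw w ` sg_K) = 1 / 3 ^ N" if "w \<in> sg_words N" for w N
    using cell[OF that] by (simp add: measure_def)
  show "measure M (A \<inter> sg_K) = measure M A" if "A \<in> sets borel" for A
  proof (rule measure_eq_AE)
    have "AE x in M. x \<in> sg_K"
      by (rule AE_I[OF _ N]) (auto simp: sets)
    then show "AE x in M. x \<in> A \<inter> sg_K \<longleftrightarrow> x \<in> A"
      by eventually_elim auto
  qed (use that in \<open>auto simp: sets\<close>)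
qed

text \<open>The \<open>3^N\<close> cells of level \<open>N\<close> cover a set of measure one, so their overlaps are null.\<close>

lemma sg_measure_union_cells:
  assumes M: "sg_selfsimilar_measure M" and S: "S \<subseteq> sg_words N"
  shows "measure M (\<Union>w\<in>S. sg_phiw w ` sg_K) = card S / 3 ^ N"
proof -
  interpret prob_space M
    by (rule sg_selfsimilar_measureD[OF M])
  note sets = sg_selfsimilar_measureD(1)[OF M]
  have le: "measure M (\<Union>w\<in>S'. sg_phiw w ` sg_K) \<le> card S' / 3 ^ N" if "S' \<subseteq> sg_words N" for S'
  proof -
    have fin: "finite S'"
      using that finite_sg_words finite_subset by blast
    then have "measure M (\<Union>w\<in>S'. sg_phiw w ` sg_K) \<le> (\<Sum>w\<in>S'. measure M (sg_phiw w ` sg_K))"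
      by (intro finite_measure_subadditive_finite) (auto simp: sets)
    also have "\<dots> = (\<Sum>w\<in>S'. 1 / 3 ^ N)"
      using that by (intro sum.cong sg_selfsimilar_measureD[OF M]) auto
    finally show ?thesis
      by simp
  qed
  have fin: "finite S"
    using S finite_sg_words finite_subset by blast
  have "1 = measure M ((\<Union>w\<in>S. sg_phiw w ` sg_K) \<union> (\<Union>w\<in>sg_words N - S. sg_phiw w ` sg_K))"
    unfolding UN_Un[symmetric] Un_Diff_cancel Un_absorb1[OF S] sg_cells_cover[of N, symmetric]
    by (rule sg_selfsimilar_measureD(3)[OF M, symmetric])
  also have "\<dots> \<le> measure M (\<Union>w\<in>S. sg_phiw w ` sg_K) + measure M (\<Union>w\<in>sg_words N - S. sg_phiw w ` sg_K)"
    using fin finite_sg_words by (intro measure_Un_le) (auto simp: sets)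
  also have "\<dots> \<le> measure M (\<Union>w\<in>S. sg_phiw w ` sg_K) + card (sg_words N - S) / 3 ^ N"
    by (intro add_left_mono le) auto
  also have "card (sg_words N - S) = 3 ^ N - card S"
    using fin S by (simp add: card_Diff_subset card_sg_words)
  also have "real (3 ^ N - card S) = 3 ^ N - real (card S)"
    using card_mono[OF finite_sg_words S] by (simp add: of_nat_diff card_sg_words)
  finally show ?thesis
    using le[OF S] by (simp add: diff_divide_distrib)
qed

section \<open>Uniqueness of the measure by counting cells\<close>

lemma sg_touching_cells_antimono:
  "(\<Union>w\<in>{w\<in>sg_words (Suc N). sg_phiw w ` sg_K \<inter> C \<noteq> {}}. sg_phiw w ` sg_K)
    \<subseteq> (\<Union>w\<in>{w\<in>sg_words N. sg_phiw w ` sg_K \<inter> C \<noteq> {}}. sg_phiw w ` sg_K)"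
proof (rule UN_least)
  fix w assume w: "w \<in> {w\<in>sg_words (Suc N). sg_phiw w ` sg_K \<inter> C \<noteq> {}}"
  then obtain u i where u: "w = u @ [i]" "length u = N" "set u \<subseteq> sg_I" "i \<in> sg_I"
    by (cases w rule: rev_cases) (auto simp: sg_words_eq)
  have "sg_phiw w ` sg_K \<subseteq> sg_phiw u ` sg_K"
    using u by (auto simp: sg_phiw_append sg_phi_in_K)
  then show "sg_phiw w ` sg_K \<subseteq> (\<Union>w\<in>{w\<in>sg_words N. sg_phiw w ` sg_K \<inter> C \<noteq> {}}. sg_phiw w ` sg_K)"
    using u w by (intro order_trans[OF _ UN_upper[of u]]) (auto simp: sg_words_eq)
qed

text \<open>A point that lies in touching cells of every level is within the vanishing cell diameter
  of \<open>C\<close>, and \<open>C\<close> is closed. Continuity from above then expresses the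
  measure of \<open>C\<close> through cell counts.\<close>

lemma sg_touching_cells_INT:
  assumes "closed C"
  shows "(\<Inter>N. \<Union>w\<in>{w\<in>sg_words N. sg_phiw w ` sg_K \<inter> C \<noteq> {}}. sg_phiw w ` sg_K) = C \<inter> sg_K"
    (is "?L = _")
proof (intro antisym subsetI IntI)
  fix x assume x: "x \<in> ?L"
  then have "x \<in> (\<Union>w\<in>{w\<in>sg_words 0. sg_phiw w ` sg_K \<inter> C \<noteq> {}}. sg_phiw w ` sg_K)"
    by (rule INT_D) simp
  then show "x \<in> sg_K"
    by (simp split: if_splits)
  have "\<exists>y\<in>C. dist y x < e" if e: "e > 0" for e
  proof -
    obtain N where N: "\<And>w x y. length w \<ge> N \<Longrightarrow> x \<in> sg_phiw w ` sg_K \<Longrightarrow> y \<in> sg_phiw w ` sg_K \<Longrightarrow> dist x y < e"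
      using sg_small_cells[OF e] by blast
    have "x \<in> (\<Union>w\<in>{w\<in>sg_words N. sg_phiw w ` sg_K \<inter> C \<noteq> {}}. sg_phiw w ` sg_K)"
      using x by (rule INT_D) simp
    then obtain w y where "w \<in> sg_words N" "x \<in> sg_phiw w ` sg_K" "y \<in> sg_phiw w ` sg_K" "y \<in> C"
      by blast
    then show ?thesis
      using N[of w y x] by (auto simp: sg_words_eq)
  qed
  then show "x \<in> C"
    using closure_approachable[of x C] closure_closed[OF assms] by simp
next
  fix x assume x: "x \<in> C \<inter> sg_K"
  show "x \<in> ?L"
  proof (rule INT_I)
    fix N
    obtain w where "w \<in> sg_words N" "x \<in> sg_phiw w ` sg_K"
      using subsetD[OF equalityD1[OF sg_cells_cover[of N]]] x by blast
    then show "x \<in> (\<Union>w\<in>{w\<in>sg_words N. sg_phiw w ` sg_K \<inter> C \<noteq> {}}. sg_phiw w ` sg_K)"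
      using x by blast
  qed
qed

text \<open>Every admissible measure gives a closed set the limit of the number of level
  \<open>N\<close> cells meeting it, divided by \<open>3 ^ N\<close>. This number does not involve
  the measure, and closed sets are an intersection-stable generator of the Borel sets.\<close>

lemma sg_selfsimilar_measure_unique:
  assumes M: "sg_selfsimilar_measure M" and M': "sg_selfsimilar_measure M'"
  shows "M = M'"
proof -
  define U where "U C N = (\<Union>w\<in>{w\<in>sg_words N. sg_phiw w ` sg_K \<inter> C \<noteq> {}}. sg_phiw w ` sg_K)" for C N
  have lim: "(\<lambda>N. card {w\<in>sg_words N. sg_phiw w ` sg_K \<inter> C \<noteq> {}} / 3 ^ N) \<longlonglongrightarrow> measure L C"
    if L: "sg_selfsimilar_measure L" and C: "closed C" for L C
  proof -
    interpret prob_space L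
      by (rule sg_selfsimilar_measureD[OF L])
    have "U C N \<in> sets borel" for N
      unfolding U_def by (intro sets.finite_UN borel_sg_cell) (use finite_sg_words in auto)
    moreover have "decseq (U C)"
      unfolding U_def by (rule decseq_SucI) (rule sg_touching_cells_antimono)
    ultimately have "(\<lambda>N. measure L (U C N)) \<longlonglongrightarrow> measure L (\<Inter>N. U C N)"
      by (intro finite_Lim_measure_decseq) (auto simp: sg_selfsimilar_measureD[OF L])
    moreover have "measure L (\<Inter>N. U C N) = measure L C"
      unfolding U_def sg_touching_cells_INT[OF C]
      using C by (intro sg_selfsimilar_measureD[OF L]) auto
    moreover have "measure L (U C N) = card {w\<in>sg_words N. sg_phiw w ` sg_K \<inter> C \<noteq> {}} / 3 ^ N" for N
      unfolding U_def by (rule sg_measure_union_cells[OF L]) auto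
    ultimately show ?thesis
      by simp
  qed
  interpret M: prob_space M
    by (rule sg_selfsimilar_measureD[OF M])
  interpret M': prob_space M'
    by (rule sg_selfsimilar_measureD[OF M'])
  show ?thesis
  proof (rule measure_eqI_generator_eq[where E = "Collect closed" and \<Omega> = UNIV and A = "\<lambda>_. UNIV"])
    show "emeasure M X = emeasure M' X" if "X \<in> Collect closed" for X
      using LIMSEQ_unique[OF lim[OF M] lim[OF M']] that
      by (simp add: M.emeasure_eq_measure M'.emeasure_eq_measure)
    show "Int_stable (Collect closed)"
      by (auto simp: Int_stable_def)
    show "sets M = sigma_sets UNIV (Collect closed)" "sets M' = sigma_sets UNIV (Collect closed)"
      using sg_selfsimilar_measureD(1)[OF M] sg_selfsimilar_measureD(1)[OF M']
      by (simp_all add: borel_eq_closed)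
  qed auto
qed

section \<open>Existence of the measure by coding with random digits\<close>

definition sg_code :: "nat stream \<Rightarrow> pt" where
  "sg_code s = (\<Sum>n. (1/2) ^ Suc n *\<^sub>R sg_a (s !! n))"

lemma norm_sg_a_le: "norm (sg_a i) \<le> 1"
  by (simp add: sg_a_def norm_Pair power2_eq_square)

lemma summable_sg_code: "summable (\<lambda>n. (1/2) ^ Suc n *\<^sub>R sg_a (s !! n))"
  and norm_sg_code: "norm (sg_code s) \<le> 1"
proof -
  have bound: "norm ((1/2) ^ Suc n *\<^sub>R sg_a (s !! n)) \<le> (1/2) ^ Suc n" for n
    using norm_sg_a_le[of "s !! n"] by (simp add: divide_right_mono)
  have geo: "(\<lambda>n. (1/2::real) ^ Suc n) sums 1"
    by (rule power_half_series)
  show "summable (\<lambda>n. (1/2) ^ Suc n *\<^sub>R sg_a (s !! n))"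
    using bound sums_summable[OF geo] by (rule summable_comparison_test'[rotated])
  show "norm (sg_code s) \<le> 1"
    unfolding sg_code_def using norm_suminf_le[OF bound sums_summable[OF geo]] sums_unique[OF geo] by simp
qed

text \<open>This intertwining of prepending a digit with a similarity turns the first step of a
  random digit sequence into self-similarity of its image law.\<close>

lemma sg_code_Cons: "sg_code (i ## s) = sg_phi i (sg_code s)"
proof -
  have "sg_code (i ## s) = (\<Sum>n. (1/2) ^ Suc (Suc n) *\<^sub>R sg_a (s !! n)) + (1/2) *\<^sub>R sg_a i"
    unfolding sg_code_def using suminf_split_head[OF summable_sg_code[of "i ## s"]] by simp
  also have "(\<Sum>n. (1/2) ^ Suc (Suc n) *\<^sub>R sg_a (s !! n)) = (\<Sum>n. (1/2) *\<^sub>R ((1/2) ^ Suc n *\<^sub>R sg_a (s !! n)))"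
    by simp
  also have "\<dots> = (1/2) *\<^sub>R sg_code s"
    unfolding sg_code_def by (rule suminf_scaleR_right[OF summable_sg_code, symmetric])
  finally show ?thesis
    by (simp add: sg_phi_def scaleR_add_right)
qed

text \<open>\<open>sg_a\<close> sends every index besides 0 and 1 to the same corner, so an
  arbitrary stream of naturals still codes a point of the gasket and no restriction to admissible
  streams has to be carried along.\<close>

lemma sg_phi_in_K': "x \<in> sg_K \<Longrightarrow> sg_phi i x \<in> sg_K"
proof (cases "i \<in> sg_I")
  case False
  then have "sg_phi i = sg_phi 2"
    by (auto simp: sg_phi_def sg_a_def sg_I_def fun_eq_iff)
  then show "x \<in> sg_K \<Longrightarrow> ?thesis"
    by (simp add: sg_phi_in_K)
qed (rule sg_phi_in_K)

text \<open>After \<open>n\<close> digits are stripped, the remaining code and the corner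
  \<open>sg_a 0\<close> lie in the unit ball, at distance at most 2. Restoring the digits divides
  the distance by \<open>2 ^ n\<close>, so the code is a limit of points of the closed set.\<close>

lemma sg_code_in_K: "sg_code s \<in> sg_K"
proof -
  have approx: "\<exists>y\<in>sg_K. dist y (sg_code s) \<le> 2 / 2 ^ n" for n s
  proof (induction n arbitrary: s)
    case 0
    have "dist (sg_a 0) (sg_code s) \<le> 2"
      using norm_triangle_ineq4[of "sg_a 0" "sg_code s"] norm_sg_a_le[of 0] norm_sg_code[of s]
      by (simp add: dist_norm)
    then show ?case
      using sg_corner_in_K[of 0] by auto
  next
    case (Suc n)
    obtain y where y: "y \<in> sg_K" "dist y (sg_code (stl s)) \<le> 2 / 2 ^ n"
      using Suc by blast
    have "dist (sg_phi (shd s) y) (sg_code s) \<le> 2 / 2 ^ Suc n"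
      using y(2) sg_code_Cons[of "shd s" "stl s"] by (simp add: dist_sg_phi)
    then show ?case
      using sg_phi_in_K'[OF y(1)] by blast
  qed
  have "\<exists>y\<in>sg_K. dist y (sg_code s) < e" if "e > 0" for e
  proof -
    obtain n where "2 / e < 2 ^ n"
      using real_arch_pow[of 2 "2 / e"] by auto
    then have "2 / 2 ^ n < e"
      using that by (simp add: field_simps)
    then show ?thesis
      using approx[of s n] by force
  qed
  then show ?thesis
    using closure_approachable[of "sg_code s" sg_K] closure_closed[OF closed_sg_K] by simp
qed

text \<open>The candidate is the image under \<open>sg_code\<close> of independent uniform digits.
  Conditioning on the first digit reduces each cell to a shorter word, provided that the corners
  shared by cells carry no mass.\<close>

lemma sg_selfsimilar_measure_exists: "\<exists>M. sg_selfsimilar_measure M"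
proof -
  define p where "p = measure_pmf (pmf_of_set sg_I)"
  define P where "P = stream_space p"
  define M where "M = distr P borel sg_code"
  interpret p: prob_space p
    unfolding p_def by (rule prob_space_measure_pmf)
  interpret P: prob_space P
    unfolding P_def by (rule p.prob_space_stream_space)
  have [measurable]: "sg_code \<in> borel_measurable P"
    unfolding sg_code_def P_def p_def by measurable
  interpret M: prob_space M
    unfolding M_def by (rule P.prob_space_distr) simp
  have sets: "sets M = sets borel"
    by (simp add: M_def)
  have spP: "space P = UNIV"
    by (simp add: P_def p_def space_stream_space)
  have K: "emeasure M (UNIV - sg_K) = 0"
  proof -
    have "sg_code -` (UNIV - sg_K) = {}"
      using sg_code_in_K by (simp add: vimage_def)
    then show ?thesis
      unfolding M_def by (subst emeasure_distr) auto
  qed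
  have null: "measure M A = 0" if "A \<in> sets borel" "A \<inter> sg_K = {}" for A
  proof -
    have "measure M A \<le> measure M (UNIV - sg_K)"
      using that by (intro M.finite_measure_mono) (auto simp: sets)
    also have "\<dots> = 0"
      using K by (simp add: measure_def)
    finally show ?thesis
      by (simp add: measure_le_0_iff)
  qed
  have self: "measure M A = (\<Sum>i\<in>sg_I. measure M (sg_phi i -` A)) / 3" if A: "A \<in> sets borel" for A
  proof -
    have Ai: "sg_phi i -` A \<in> sets borel" for i
      using measurable_sets[OF borel_measurable_continuous_onI[OF continuous_on_sg_phi] A] by simp
    have "emeasure M A = emeasure P (sg_code -` A)"
      unfolding M_def using A by (subst emeasure_distr) (auto simp: spP)
    also have "\<dots> = (\<integral>\<^sup>+i. emeasure P {s \<in> space P. i ## s \<in> sg_code -` A} \<partial>p)"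
      unfolding P_def by (rule p.emeasure_stream_space)
        (use measurable_sets[OF \<open>sg_code \<in> borel_measurable P\<close> A] in \<open>simp add: spP flip: P_def\<close>)
    also have "\<dots> = (\<integral>\<^sup>+i. emeasure M (sg_phi i -` A) \<partial>p)"
      unfolding M_def using Ai
      by (intro nn_integral_cong, subst emeasure_distr) (auto simp: sg_code_Cons spP intro!: arg_cong[where f = "emeasure P"])
    also have "\<dots> = (\<Sum>i\<in>sg_I. emeasure M (sg_phi i -` A)) / 3"
      unfolding p_def by (subst nn_integral_pmf_of_set) auto
    also have "\<dots> = ennreal ((\<Sum>i\<in>sg_I. measure M (sg_phi i -` A)) / 3)"
      by (simp add: M.emeasure_eq_measure divide_ennreal[symmetric] sum_nonneg flip: sum_ennreal)
    finally show ?thesis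
      by (simp add: M.emeasure_eq_measure sum_nonneg)
  qed
  \<comment> \<open>Of the three preimages of the corner only the one under \<open>sg_phi j\<close>
    meets the gasket, and it is the corner itself. So its mass is a third of itself.\<close>
  have corner: "measure M {sg_a j} = 0" if j: "j \<in> sg_I" for j
  proof -
    have "measure M (sg_phi i -` {sg_a j}) = (if i = j then measure M {sg_a j} else 0)" if i: "i \<in> sg_I" for i
    proof (cases "i = j")
      case True
      have "sg_phi j -` {sg_a j} = {sg_a j}"
        by (metis sg_phi_eq_iff sg_phi_fixpoint vimage_singleton_eq set_eqI singleton_iff)
      then show ?thesis
        using True by simp
    next
      case False
      have "x \<notin> sg_K" if "sg_phi i x = sg_a j" for x
      proof
        assume "x \<in> sg_K"
        then have "sg_a j = sg_a i"
          using sg_phi_overlap_K(2)[of x "sg_a j" i j] that False i j by simp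
        then show False
          using False i j sg_a_eq_iff by auto
      qed
      then show ?thesis
        using False by (auto intro!: null measurable_sets_borel[OF borel_measurable_continuous_onI[OF continuous_on_sg_phi]])
    qed
    then have "measure M {sg_a j} = (\<Sum>i\<in>sg_I. if i = j then measure M {sg_a j} else 0) / 3"
      using self[of "{sg_a j}"] by simp
    then show ?thesis
      using j by simp
  qed
  have cell: "measure M (sg_phiw w ` sg_K) = 1 / 3 ^ length w" if "set w \<subseteq> sg_I" for w
    using that
  proof (induction w)
    case Nil
    have "measure M (UNIV - sg_K) = 0"
      using K by (simp add: measure_def)
    then show ?case
      using M.prob_compl[of sg_K] by (simp add: sets M_def)
  next
    case (Cons i w)
    let ?A = "sg_phiw w ` sg_K"
    have i: "i \<in> sg_I" and sub: "?A \<subseteq> sg_K"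
      using Cons.prems sg_cell_subset_K[of w "length w"] by (auto simp: sg_words_eq)
    have "measure M (sg_phi j -` (sg_phi i ` ?A)) = (if j = i then measure M ?A else 0)" if j: "j \<in> sg_I" for j
    proof (cases "j = i")
      case True
      then show ?thesis
        by (simp add: inj_vimage_image_eq inj_sg_phi)
    next
      case False
      let ?B = "sg_phi j -` (sg_phi i ` ?A)"
      have B: "?B \<in> sets borel"
        using measurable_sets[OF borel_measurable_continuous_onI[OF continuous_on_sg_phi], of _ j] borel_sg_cell[of "i # w"]
        by (simp only: image_sg_phiw_Cons) simp
      \<comment> \<open>A preimage under a foreign similarity meets the gasket in at most one
        corner, which has just been shown to be null.\<close>
      have "?B \<inter> sg_K \<subseteq> {sg_a i}"
      proof
        fix x assume "x \<in> ?B \<inter> sg_K"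
        then obtain y where "x \<in> sg_K" "y \<in> ?A" "sg_phi j x = sg_phi i y"
          by blast
        then show "x \<in> {sg_a i}"
          using sg_phi_overlap_K(1)[of x y j i] False i j sub by blast
      qed
      then have "measure M (?B - {sg_a i}) = 0"
        using B by (intro null) auto
      moreover have "measure M ?B \<le> measure M (?B - {sg_a i}) + measure M {sg_a i}"
        using B by (intro order_trans[OF M.finite_measure_mono measure_Un_le]) (auto simp: sets)
      ultimately show ?thesis
        using corner[OF i] False by (simp add: measure_le_0_iff)
    qed
    then have "measure M (sg_phiw (i # w) ` sg_K) = measure M ?A / 3"
      unfolding image_sg_phiw_Cons using i borel_sg_cell[of "i # w"]
      by (subst self) (simp_all only: image_sg_phiw_Cons, simp_all)
    then show ?case
      using Cons by simp
  qed
  have "sg_selfsimilar_measure M"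
    unfolding sg_selfsimilar_measure_def using sets K cell
    by (auto simp: sg_words_eq M.emeasure_eq_measure)
  then show ?thesis ..
qed

lemma sg_selfsimilar_measure_sg_m: "sg_selfsimilar_measure sg_m"
proof -
  have "\<exists>!M. sg_selfsimilar_measure M"
    using sg_selfsimilar_measure_exists sg_selfsimilar_measure_unique by blast
  then show ?thesis
    unfolding sg_m_def sg_selfsimilar_measure_def[symmetric] by (rule theI')
qed

section \<open>Integration against the self-similar measure\<close>

lemmas sets_sg_m [measurable_cong, simp] = sg_selfsimilar_measureD(1)[OF sg_selfsimilar_measure_sg_m]
lemmas prob_space_sg_m = sg_selfsimilar_measureD(2)[OF sg_selfsimilar_measure_sg_m]
lemmas measure_sg_K = sg_selfsimilar_measureD(3)[OF sg_selfsimilar_measure_sg_m]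
lemmas measure_sg_cell = sg_selfsimilar_measureD(5)[OF sg_selfsimilar_measure_sg_m]

lemma space_sg_m [simp]: "space sg_m = UNIV"
  using sets_eq_imp_space_eq[OF sets_sg_m] by simp

interpretation sg_m: prob_space sg_m
  by (rule prob_space_sg_m)

lemma AE_sg_m_in_K: "AE x in sg_m. x \<in> sg_K"
  using sg_m.AE_prob_1[OF measure_sg_K] .

text \<open>Every ball around a point of the gasket contains a whole cell, whose mass is known. This
  is what turns vanishing integrals into vanishing continuous functions.\<close>

lemma sg_m_full_support:
  assumes "x \<in> sg_K" "e > 0"
  shows "measure sg_m (ball x e) > 0"
proof -
  obtain N w where w: "w \<in> sg_words N" "sg_phiw w ` sg_K \<subseteq> ball x e" "x \<in> sg_phiw w ` sg_K"
    by (rule sg_cell_in_ball[OF assms])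
  have "0 < measure sg_m (sg_phiw w ` sg_K)"
    using measure_sg_cell[OF w(1)] by simp
  also have "\<dots> \<le> measure sg_m (ball x e)"
    by (rule sg_m.finite_measure_mono[OF w(2)]) simp
  finally show ?thesis .
qed

lemma set_borel_measurable_continuous_sg_K:
  fixes f :: "pt \<Rightarrow> real"
  shows "continuous_on sg_K f \<Longrightarrow> set_borel_measurable sg_m sg_K f"
  unfolding set_borel_measurable_def
  using borel_measurable_continuous_on_indicator[OF borel_sg_K, of f]
  by (simp add: measurable_cong_sets[OF sets_sg_m refl])

lemma bounded_continuous_sg_K:
  fixes f :: "pt \<Rightarrow> real"
  assumes "continuous_on sg_K f"
  obtains B where "B > 0" "\<And>x. x \<in> sg_K \<Longrightarrow> \<bar>f x\<bar> \<le> B"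
proof -
  obtain B where "\<And>x. x \<in> sg_K \<Longrightarrow> \<bar>f x\<bar> \<le> B"
    using compact_imp_bounded[OF compact_continuous_image[OF assms compact_sg_K]]
    by (auto simp: bounded_iff)
  then show ?thesis
    using that[of "max 1 B"] by (auto simp: max.coboundedI2)
qed

lemma set_integrable_bounded_sg_K:
  fixes f :: "pt \<Rightarrow> real"
  assumes "set_borel_measurable sg_m sg_K f" "\<And>x. x \<in> sg_K \<Longrightarrow> \<bar>f x\<bar> \<le> B"
  shows "set_integrable sg_m sg_K f"
  unfolding set_integrable_def
  by (rule sg_m.integrable_const_bound[where B = B])
    (use assms AE_sg_m_in_K in \<open>auto simp: set_borel_measurable_def\<close>)

lemma set_integrable_continuous_sg_K:
  fixes f :: "pt \<Rightarrow> real"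
  assumes "continuous_on sg_K f"
  shows "set_integrable sg_m sg_K f"
proof -
  obtain B where "\<And>x. x \<in> sg_K \<Longrightarrow> \<bar>f x\<bar> \<le> B"
    using bounded_continuous_sg_K[OF assms] by blast
  then show ?thesis
    using set_integrable_bounded_sg_K set_borel_measurable_continuous_sg_K[OF assms] by blast
qed

lemma sg_integral_pos:
  fixes f :: "pt \<Rightarrow> real"
  assumes f: "continuous_on sg_K f" and nonneg: "\<And>x. x \<in> sg_K \<Longrightarrow> 0 \<le> f x"
    and x: "x \<in> sg_K" "f x > 0"
  shows "(\<integral>x\<in>sg_K. f x \<partial>sg_m) > 0"
proof -
  obtain d where d: "d > 0" "\<And>y. y \<in> sg_K \<Longrightarrow> dist y x < d \<Longrightarrow> dist (f y) (f x) < f x / 2"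
    using f x unfolding continuous_on_iff by (metis half_gt_zero)
  have "0 < f x / 2 * measure sg_m (ball x d)"
    using sg_m_full_support[OF x(1) d(1)] x(2) by simp
  also have "\<dots> = (\<integral>y. f x / 2 * indicator (ball x d) y \<partial>sg_m)"
    by simp
  also have "\<dots> \<le> (\<integral>y\<in>sg_K. f y \<partial>sg_m)"
    unfolding set_lebesgue_integral_def
  proof (rule integral_mono_AE)
    show "integrable sg_m (\<lambda>y. indicator sg_K y *\<^sub>R f y)"
      using set_integrable_continuous_sg_K[OF f] by (simp add: set_integrable_def)
    show "AE y in sg_m. f x / 2 * indicator (ball x d) y \<le> indicator sg_K y *\<^sub>R f y"
      using AE_sg_m_in_K
    proof eventually_elim
      case (elim y)
      then show ?case
        using d(2)[of y] nonneg[of y]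
        by (auto simp: indicator_def dist_commute dist_real_def abs_real_def split: if_splits)
    qed
    show "integrable sg_m (\<lambda>y. f x / 2 * indicator (ball x d) y)"
      by (intro integrable_mult_right integrable_real_indicator) (auto simp: sg_m.emeasure_eq_measure)
  qed
  finally show ?thesis .
qed

section \<open>The energy form\<close>

text \<open>Edges are kept as ordered pairs, so each is counted twice as in the double sum of
  \<open>sg_EN\<close>. A single finite index set makes self-similarity of the graphs a statement
  about images.\<close>

definition sg_pairs :: "nat \<Rightarrow> (pt \<times> pt) set" where
  "sg_pairs N = {(x, y). sg_adj N x y}"

lemma sg_pairs_iff:
  "(x, y) \<in> sg_pairs N \<longleftrightarrow> x \<noteq> y \<and> (\<exists>w\<in>sg_words N. x \<in> sg_phiw w ` sg_V0 \<and> y \<in> sg_phiw w ` sg_V0)"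
  unfolding sg_pairs_def sg_adj_def sg_V_def by simp blast

lemma sg_pairs_subset: "sg_pairs N \<subseteq> sg_V N \<times> sg_V N"
  unfolding sg_pairs_def sg_adj_def by auto

lemma sg_pairs_in_K:
  assumes "(x, y) \<in> sg_pairs N"
  shows "x \<in> sg_K" "y \<in> sg_K"
  using subsetD[OF sg_pairs_subset assms] sg_V_subset_K[of N] by auto

lemma finite_sg_pairs: "finite (sg_pairs N)"
  using sg_pairs_subset by (rule finite_subset) (simp add: finite_sg_V)

lemma sg_pairs_Suc: "sg_pairs (Suc N) = (\<Union>i\<in>sg_I. map_prod (sg_phi i) (sg_phi i) ` sg_pairs N)"
proof (intro antisym subrelI)
  fix x y assume "(x, y) \<in> sg_pairs (Suc N)"
  then obtain v where v: "x \<noteq> y" "v \<in> sg_words (Suc N)" "x \<in> sg_phiw v ` sg_V0" "y \<in> sg_phiw v ` sg_V0"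
    unfolding sg_pairs_iff by blast
  then obtain i w where "v = i # w" "i \<in> sg_I" "w \<in> sg_words N"
    unfolding sg_words_Suc by blast
  with v have iw: "i \<in> sg_I" "w \<in> sg_words N" "x \<noteq> y"
      "x \<in> sg_phi i ` sg_phiw w ` sg_V0" "y \<in> sg_phi i ` sg_phiw w ` sg_V0"
    by (simp_all only: image_sg_phiw_Cons not_False_eq_True)
  then obtain x' y' where xy: "x = sg_phi i x'" "y = sg_phi i y'" "x' \<in> sg_phiw w ` sg_V0" "y' \<in> sg_phiw w ` sg_V0"
    by blast
  with iw have "(x', y') \<in> sg_pairs N"
    by (auto simp only: sg_pairs_iff)
  then have "(x, y) \<in> map_prod (sg_phi i) (sg_phi i) ` sg_pairs N"
    unfolding xy by (rule map_prod_imageI)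
  then show "(x, y) \<in> (\<Union>i\<in>sg_I. map_prod (sg_phi i) (sg_phi i) ` sg_pairs N)"
    using iw(1) by blast
next
  fix x y assume "(x, y) \<in> (\<Union>i\<in>sg_I. map_prod (sg_phi i) (sg_phi i) ` sg_pairs N)"
  then obtain i x' y' where i: "i \<in> sg_I" "(x', y') \<in> sg_pairs N" "x = sg_phi i x'" "y = sg_phi i y'"
    by (elim UN_E imageE) (metis map_prod_simp prod.collapse prod.inject)
  then obtain w where "x' \<noteq> y'" "w \<in> sg_words N" "x' \<in> sg_phiw w ` sg_V0" "y' \<in> sg_phiw w ` sg_V0"
    by (auto simp only: sg_pairs_iff)
  with i show "(x, y) \<in> sg_pairs (Suc N)"
    unfolding sg_pairs_iff by (intro conjI bexI[of _ "i # w"]) (simp_all only: image_sg_phiw_Cons sg_phi_eq_iff imageI Cons_in_sg_words not_False_eq_True simp_thms)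
qed

text \<open>The three copies of the level \<open>N\<close> graph share vertices but no edges: in one
  copy both ends of a common edge would come from the corner \<open>sg_a j\<close>, while the ends
  of an edge differ.\<close>

lemma sum_sg_pairs_Suc:
  fixes h :: "pt \<Rightarrow> pt \<Rightarrow> real"
  shows "(\<Sum>(x,y)\<in>sg_pairs (Suc N). h x y) = (\<Sum>i\<in>sg_I. \<Sum>(x,y)\<in>sg_pairs N. h (sg_phi i x) (sg_phi i y))"
proof -
  let ?m = "\<lambda>i. map_prod (sg_phi i) (sg_phi i)"
  have disj: "?m i ` sg_pairs N \<inter> ?m j ` sg_pairs N = {}"
    if ij: "i \<in> sg_I" "j \<in> sg_I" "i \<noteq> j" for i j
  proof (rule ccontr)
    assume "?m i ` sg_pairs N \<inter> ?m j ` sg_pairs N \<noteq> {}"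
    then obtain x y x' y' where p: "(x, y) \<in> sg_pairs N" "(x', y') \<in> sg_pairs N"
      and eq: "sg_phi i x = sg_phi j x'" "sg_phi i y = sg_phi j y'"
      by fastforce
    have "x = sg_a j" "y = sg_a j"
      using sg_phi_overlap_K(1)[OF _ _ ij] sg_pairs_in_K[OF p(1)] sg_pairs_in_K[OF p(2)] eq by blast+
    then show False
      using p(1) by (simp add: sg_pairs_iff)
  qed
  have "(\<Sum>(x,y)\<in>sg_pairs (Suc N). h x y) = (\<Sum>i\<in>sg_I. \<Sum>(x,y)\<in>?m i ` sg_pairs N. h x y)"
    unfolding sg_pairs_Suc using disj finite_sg_pairs by (intro sum.UNION_disjoint) auto
  also have "\<dots> = (\<Sum>i\<in>sg_I. \<Sum>(x,y)\<in>sg_pairs N. h (sg_phi i x) (sg_phi i y))"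
  proof (rule sum.cong[OF refl])
    fix i
    have "inj_on (?m i) (sg_pairs N)"
      by (rule inj_onI) (auto simp: map_prod_def split_beta prod_eq_iff[where 'a = "real \<times> real"])
    then show "(\<Sum>(x,y)\<in>?m i ` sg_pairs N. h x y) = (\<Sum>(x,y)\<in>sg_pairs N. h (sg_phi i x) (sg_phi i y))"
      by (simp add: sum.reindex split_beta)
  qed
  finally show ?thesis .
qed

lemma sum_sg_pairs_0:
  fixes h :: "pt \<Rightarrow> pt \<Rightarrow> real"
  assumes "\<And>x. h x x = 0"
  shows "(\<Sum>(x,y)\<in>sg_pairs 0. h x y) = (\<Sum>i\<in>sg_I. \<Sum>j\<in>sg_I. h (sg_a i) (sg_a j))"
proof -
  have inj: "inj_on sg_a sg_I"
    by (rule inj_onI) (simp add: sg_a_eq_iff)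
  have eq: "sg_pairs 0 = sg_V0 \<times> sg_V0 - Id"
    by (intro antisym subrelI) (simp_all add: sg_pairs_iff)
  have "(\<Sum>(x,y)\<in>sg_pairs 0. h x y) = (\<Sum>(x,y)\<in>sg_V0 \<times> sg_V0. h x y)"
    unfolding eq by (rule sum.mono_neutral_left) (auto simp: assms finite_sg_V0)
  also have "\<dots> = (\<Sum>x\<in>sg_V0. \<Sum>y\<in>sg_V0. h x y)"
    by (simp add: sum.cartesian_product)
  finally show ?thesis
    unfolding sg_V0_eq by (simp add: sum.reindex[OF inj] o_def)
qed

definition sg_EN2 :: "nat \<Rightarrow> (pt \<Rightarrow> real) \<Rightarrow> (pt \<Rightarrow> real) \<Rightarrow> real" where
  "sg_EN2 N f g = 1/2 * (5/3) ^ N * (\<Sum>(x,y)\<in>sg_pairs N. (f y - f x) * (g y - g x))"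

lemma sg_EN_eq_EN2: "sg_EN N f = sg_EN2 N f f"
proof -
  have "(\<Sum>x\<in>sg_V N. \<Sum>y\<in>{y\<in>sg_V N. sg_adj N x y}. (f y - f x)^2)
      = (\<Sum>(x,y)\<in>(SIGMA x:sg_V N. {y\<in>sg_V N. sg_adj N x y}). (f y - f x)^2)"
    using finite_sg_V by (intro sum.Sigma) auto
  also have "(SIGMA x:sg_V N. {y\<in>sg_V N. sg_adj N x y}) = sg_pairs N"
    by (auto simp: sg_pairs_def sg_adj_def)
  finally show ?thesis
    by (simp add: sg_EN_def sg_EN2_def power2_eq_square)
qed

lemma sg_EN2_cong:
  assumes "\<And>x. x \<in> sg_K \<Longrightarrow> f x = f' x" "\<And>x. x \<in> sg_K \<Longrightarrow> g x = g' x"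
  shows "sg_EN2 N f g = sg_EN2 N f' g'"
proof -
  have "(f y - f x) * (g y - g x) = (f' y - f' x) * (g' y - g' x)" if "(x, y) \<in> sg_pairs N" for x y
    using assms sg_pairs_in_K[OF that] by simp
  then show ?thesis
    unfolding sg_EN2_def by (intro arg_cong2[where f = "(*)"] refl sum.cong) auto
qed

lemma sg_EN2_commute: "sg_EN2 N f g = sg_EN2 N g f"
  by (simp add: sg_EN2_def mult.commute)

lemma sg_EN2_add_left: "sg_EN2 N (\<lambda>x. f x + g x) h = sg_EN2 N f h + sg_EN2 N g h"
  unfolding sg_EN2_def distrib_left[symmetric] sum.distrib[symmetric]
  by (intro arg_cong2[where f = "(*)"] refl sum.cong) (auto simp: algebra_simps)

lemma sg_EN2_scale_left: "sg_EN2 N (\<lambda>x. c * f x) h = c * sg_EN2 N f h"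
proof -
  have "(\<Sum>(x,y)\<in>sg_pairs N. (c * f y - c * f x) * (h y - h x)) = c * (\<Sum>(x,y)\<in>sg_pairs N. (f y - f x) * (h y - h x))"
    unfolding sum_distrib_left by (intro sum.cong) (auto simp: algebra_simps)
  then show ?thesis
    by (simp add: sg_EN2_def)
qed

lemma sg_EN2_diff_left: "sg_EN2 N (\<lambda>x. f x - g x) h = sg_EN2 N f h - sg_EN2 N g h"
  using sg_EN2_add_left[of N f "\<lambda>x. - 1 * g x" h] sg_EN2_scale_left[of N "- 1" g h] by simp

lemma sg_EN2_add_right: "sg_EN2 N h (\<lambda>x. f x + g x) = sg_EN2 N h f + sg_EN2 N h g"
  by (metis sg_EN2_commute sg_EN2_add_left)

lemma sg_EN2_scale_right: "sg_EN2 N h (\<lambda>x. c * f x) = c * sg_EN2 N h f"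
  by (metis sg_EN2_commute sg_EN2_scale_left)

lemma sg_EN2_diff_right: "sg_EN2 N h (\<lambda>x. f x - g x) = sg_EN2 N h f - sg_EN2 N h g"
  by (metis sg_EN2_commute sg_EN2_diff_left)

lemmas sg_EN2_simps = sg_EN2_add_left sg_EN2_add_right sg_EN2_diff_left sg_EN2_diff_right
  sg_EN2_scale_left sg_EN2_scale_right

lemma sg_EN_nonneg: "0 \<le> sg_EN N f"
  unfolding sg_EN_eq_EN2 sg_EN2_def by (rule mult_nonneg_nonneg[OF _ sum_nonneg]) auto

lemma sg_EN_add: "sg_EN N (\<lambda>x. f x + g x) = sg_EN N f + 2 * sg_EN2 N f g + sg_EN N g"
  by (simp add: sg_EN_eq_EN2 sg_EN2_simps sg_EN2_commute[of N g f])

lemma sg_EN_diff: "sg_EN N (\<lambda>x. f x - g x) = sg_EN N f - 2 * sg_EN2 N f g + sg_EN N g"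
  by (simp add: sg_EN_eq_EN2 sg_EN2_simps sg_EN2_commute[of N g f])

lemma sg_EN_scale: "sg_EN N (\<lambda>x. c * f x) = c\<^sup>2 * sg_EN N f"
  by (simp add: sg_EN_eq_EN2 sg_EN2_simps power2_eq_square)

lemma sg_EN2_AM_GM: "2 * \<bar>sg_EN2 N f g\<bar> \<le> sg_EN N f + sg_EN N g"
  using sg_EN_nonneg[of N "\<lambda>x. f x + g x"] sg_EN_nonneg[of N "\<lambda>x. f x - g x"]
  unfolding sg_EN_add sg_EN_diff by linarith

text \<open>Discrete product rule: the increment of the product along an edge is
  \<open>f y * (g y - g x) + g x * (f y - f x)\<close>, and (u + v)^2 \<le> 2 u^2 + 2 v^2. It yields
  closure of \<open>sg_F\<close> under products.\<close>

lemma sg_EN_mult_le: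
  assumes f: "\<And>x. x \<in> sg_K \<Longrightarrow> \<bar>f x\<bar> \<le> A" and g: "\<And>x. x \<in> sg_K \<Longrightarrow> \<bar>g x\<bar> \<le> B"
  shows "sg_EN N (\<lambda>x. f x * g x) \<le> 2 * A\<^sup>2 * sg_EN N g + 2 * B\<^sup>2 * sg_EN N f"
proof -
  have "(\<Sum>(x,y)\<in>sg_pairs N. (f y * g y - f x * g x) * (f y * g y - f x * g x))
      \<le> (\<Sum>(x,y)\<in>sg_pairs N. 2 * A\<^sup>2 * ((g y - g x) * (g y - g x)) + 2 * B\<^sup>2 * ((f y - f x) * (f y - f x)))"
  proof (rule sum_mono, clarsimp)
    fix a b c d assume p: "((a, b), (c, d)) \<in> sg_pairs N"
    define x y where "x = (a, b)" and "y = (c, d)"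
    have K: "x \<in> sg_K" "y \<in> sg_K"
      using sg_pairs_in_K[OF p] by (auto simp: x_def y_def)
    let ?u = "f y * (g y - g x)" and ?v = "g x * (f y - f x)"
    have "(f y * g y - f x * g x) * (f y * g y - f x * g x) = (?u + ?v)\<^sup>2"
      by (simp add: power2_eq_square algebra_simps)
    also have "\<dots> \<le> 2 * ?u\<^sup>2 + 2 * ?v\<^sup>2"
      using zero_le_power2[of "?u - ?v"] by (simp add: power2_eq_square algebra_simps)
    also have "\<dots> = 2 * (f y)\<^sup>2 * (g y - g x)\<^sup>2 + 2 * (g x)\<^sup>2 * (f y - f x)\<^sup>2"
      by (simp add: power_mult_distrib)
    also have "\<dots> \<le> 2 * A\<^sup>2 * (g y - g x)\<^sup>2 + 2 * B\<^sup>2 * (f y - f x)\<^sup>2"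
      using power_mono[OF f[OF K(2)], of 2] power_mono[OF g[OF K(1)], of 2]
      by (intro add_mono mult_right_mono mult_left_mono) auto
    finally show "(f (c, d) * g (c, d) - f (a, b) * g (a, b)) * (f (c, d) * g (c, d) - f (a, b) * g (a, b))
      \<le> 2 * A\<^sup>2 * ((g (c, d) - g (a, b)) * (g (c, d) - g (a, b))) + 2 * B\<^sup>2 * ((f (c, d) - f (a, b)) * (f (c, d) - f (a, b)))"
      by (simp add: x_def y_def power2_eq_square)
  qed
  also have "\<dots> = 2 * A\<^sup>2 * (\<Sum>(x,y)\<in>sg_pairs N. (g y - g x) * (g y - g x))
      + 2 * B\<^sup>2 * (\<Sum>(x,y)\<in>sg_pairs N. (f y - f x) * (f y - f x))"
    by (simp add: sum.distrib sum_distrib_left split_beta)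
  finally have "1/2 * (5/3)^N * (\<Sum>(x,y)\<in>sg_pairs N. (f y * g y - f x * g x) * (f y * g y - f x * g x))
      \<le> 1/2 * (5/3)^N * (2 * A\<^sup>2 * (\<Sum>(x,y)\<in>sg_pairs N. (g y - g x) * (g y - g x))
      + 2 * B\<^sup>2 * (\<Sum>(x,y)\<in>sg_pairs N. (f y - f x) * (f y - f x)))"
    by (intro mult_left_mono) auto
  then show ?thesis
    by (simp add: sg_EN_eq_EN2 sg_EN2_def distrib_left mult.left_commute)
qed

lemma sg_EN_Suc: "sg_EN (Suc N) f = 5/3 * (\<Sum>i\<in>sg_I. sg_EN N (f \<circ> sg_phi i))"
  unfolding sg_EN_eq_EN2 sg_EN2_def sum_sg_pairs_Suc sum_distrib_left[symmetric] o_apply by simp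

lemma sg_EN_0: "sg_EN 0 f = (f (sg_a 0) - f (sg_a 1))\<^sup>2 + (f (sg_a 1) - f (sg_a 2))\<^sup>2 + (f (sg_a 0) - f (sg_a 2))\<^sup>2"
  unfolding sg_EN_eq_EN2 sg_EN2_def
  by (subst sum_sg_pairs_0) (simp_all add: sum_sg_I power2_eq_square algebra_simps)

text \<open>Completing the square around the harmonic extension, which takes the value
  \<open>(2u + 2v + w)/5\<close> at the midpoint of an edge with end values \<open>u\<close>, \<open>v\<close> and opposite value \<open>w\<close>.\<close>

lemma sg_harmonic_extension_minimises:
  fixes u v w p q r :: real
  shows "(u - v)\<^sup>2 + (v - w)\<^sup>2 + (u - w)\<^sup>2 \<le> 5/3 *
     (((u - p)\<^sup>2 + (p - q)\<^sup>2 + (u - q)\<^sup>2) + ((p - v)\<^sup>2 + (v - r)\<^sup>2 + (p - r)\<^sup>2) + ((q - r)\<^sup>2 + (r - w)\<^sup>2 + (q - w)\<^sup>2))"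
proof -
  define a b c where "a = p - (2 * u + 2 * v + w) / 5" and "b = q - (2 * u + 2 * w + v) / 5"
    and "c = r - (2 * v + 2 * w + u) / 5"
  have pqr: "p = a + (2 * u + 2 * v + w) / 5" "q = b + (2 * u + 2 * w + v) / 5" "r = c + (2 * v + 2 * w + u) / 5"
    by (simp_all add: a_def b_def c_def)
  have "5/3 * (((u - p)\<^sup>2 + (p - q)\<^sup>2 + (u - q)\<^sup>2) + ((p - v)\<^sup>2 + (v - r)\<^sup>2 + (p - r)\<^sup>2) + ((q - r)\<^sup>2 + (r - w)\<^sup>2 + (q - w)\<^sup>2))
     - ((u - v)\<^sup>2 + (v - w)\<^sup>2 + (u - w)\<^sup>2)
     = 5/3 * (2 * a\<^sup>2 + 2 * b\<^sup>2 + 2 * c\<^sup>2 + (a - b)\<^sup>2 + (a - c)\<^sup>2 + (b - c)\<^sup>2)"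
    unfolding pqr by (simp add: power2_eq_square field_simps)
  also have "\<dots> \<ge> 0"
    by simp
  finally show ?thesis
    by simp
qed

text \<open>At level 0 this is minimality of the harmonic extension; self-similarity carries it to
  every level.\<close>

lemma sg_EN_le_Suc: "sg_EN N f \<le> sg_EN (Suc N) f"
proof (induction N arbitrary: f)
  case 0
  \<comment> \<open>Each midpoint has two addresses, which have to be written the same way before
    the nine squares match the inequality.\<close>
  have *: "sg_phi 1 (sg_a 0) = sg_phi 0 (sg_a 1)" "sg_phi 2 (sg_a 0) = sg_phi 0 (sg_a 2)" "sg_phi 2 (sg_a 1) = sg_phi 1 (sg_a 2)"
    by (rule sg_phi_commute_corner)+
  show ?case
    unfolding sg_EN_Suc sum_sg_I sg_EN_0 o_apply sg_phi_fixpoint *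
    by (rule sg_harmonic_extension_minimises)
next
  case (Suc N)
  show ?case
    unfolding sg_EN_Suc[of "Suc N"] by (subst sg_EN_Suc) (intro mult_left_mono sum_mono Suc, simp)
qed

section \<open>The limit energy and its domain\<close>

lemma incseq_sg_EN: "incseq (\<lambda>N. sg_EN N f)"
  by (rule incseq_SucI) (rule sg_EN_le_Suc)

lemma sg_EN_mono: "M \<le> N \<Longrightarrow> sg_EN M f \<le> sg_EN N f"
  using incseqD[OF incseq_sg_EN] .

lemma sg_energy_eq_SUP: "sg_energy f = (SUP N. ereal (sg_EN N f))"
  unfolding sg_energy_def
  by (intro limI LIMSEQ_SUP) (simp add: incseq_def sg_EN_mono)

lemma sg_energy_LIMSEQ: "(\<lambda>N. ereal (sg_EN N f)) \<longlonglongrightarrow> sg_energy f"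
  unfolding sg_energy_eq_SUP by (intro LIMSEQ_SUP) (simp add: incseq_def sg_EN_mono)

lemma sg_energy_nonneg: "0 \<le> sg_energy f"
  unfolding sg_energy_eq_SUP using sg_EN_nonneg by (intro SUP_upper2[of 0]) auto

lemma sg_energy_le: "(\<And>N. sg_EN N f \<le> B) \<Longrightarrow> sg_energy f \<le> ereal B"
  unfolding sg_energy_eq_SUP by (intro SUP_least) simp

lemma sg_F_I: "continuous_on sg_K f \<Longrightarrow> (\<And>N. sg_EN N f \<le> B) \<Longrightarrow> f \<in> sg_F"
  unfolding sg_F_def using sg_energy_le[of f B] by (auto intro: le_less_trans)

lemma sg_F_continuous: "f \<in> sg_F \<Longrightarrow> continuous_on sg_K f"
  by (simp add: sg_F_def)

text \<open>Informative on \<open>sg_F\<close> only: at infinite energy the conversion to a real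
  returns 0, hence the membership hypotheses in upper bounds by \<open>sg_En\<close>.\<close>

definition sg_En :: "(pt \<Rightarrow> real) \<Rightarrow> real" where
  "sg_En f = real_of_ereal (sg_energy f)"

lemma sg_energy_eq_En: "f \<in> sg_F \<Longrightarrow> sg_energy f = ereal (sg_En f)"
  using sg_energy_nonneg[of f] unfolding sg_F_def sg_En_def by (cases "sg_energy f") auto

lemma sg_En_LIMSEQ: "f \<in> sg_F \<Longrightarrow> (\<lambda>N. sg_EN N f) \<longlonglongrightarrow> sg_En f"
  using sg_energy_LIMSEQ[of f] by (simp add: sg_energy_eq_En)

lemma sg_EN_le_En: "f \<in> sg_F \<Longrightarrow> sg_EN N f \<le> sg_En f"
  by (rule incseq_le[OF incseq_sg_EN sg_En_LIMSEQ])

lemma sg_En_nonneg: "0 \<le> sg_En f"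
  unfolding sg_En_def by (rule real_of_ereal_pos[OF sg_energy_nonneg])

lemma sg_En_le: "f \<in> sg_F \<Longrightarrow> (\<And>N. sg_EN N f \<le> B) \<Longrightarrow> sg_En f \<le> B"
  by (rule LIMSEQ_le_const2[OF sg_En_LIMSEQ]) auto

lemma sg_F_add:
  assumes "f \<in> sg_F" "g \<in> sg_F"
  shows "(\<lambda>x. f x + g x) \<in> sg_F"
proof (rule sg_F_I)
  show "sg_EN N (\<lambda>x. f x + g x) \<le> 2 * sg_En f + 2 * sg_En g" for N
    using sg_EN2_AM_GM[of N f g] sg_EN_le_En[OF assms(1), of N] sg_EN_le_En[OF assms(2), of N]
    unfolding sg_EN_add by linarith
qed (intro continuous_intros sg_F_continuous assms)

lemma sg_F_scale:
  assumes "f \<in> sg_F"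
  shows "(\<lambda>x. c * f x) \<in> sg_F"
proof (rule sg_F_I)
  show "sg_EN N (\<lambda>x. c * f x) \<le> c\<^sup>2 * sg_En f" for N
    unfolding sg_EN_scale using sg_EN_le_En[OF assms] by (intro mult_left_mono) auto
qed (intro continuous_intros sg_F_continuous assms)

lemma sg_F_diff:
  assumes "f \<in> sg_F" "g \<in> sg_F"
  shows "(\<lambda>x. f x - g x) \<in> sg_F"
  using sg_F_add[OF assms(1) sg_F_scale[OF assms(2), of "- 1"]] by simp

lemma sg_F_zero: "(\<lambda>x. 0) \<in> sg_F"
  by (rule sg_F_I[of _ 0]) (auto simp: sg_EN_eq_EN2 sg_EN2_def)

lemma sg_F_mult:
  assumes "f \<in> sg_F" "g \<in> sg_F"
  shows "(\<lambda>x. f x * g x) \<in> sg_F"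
proof -
  obtain A where A: "\<And>x. x \<in> sg_K \<Longrightarrow> \<bar>f x\<bar> \<le> A"
    using bounded_continuous_sg_K[OF sg_F_continuous[OF assms(1)]] by metis
  obtain B where B: "\<And>x. x \<in> sg_K \<Longrightarrow> \<bar>g x\<bar> \<le> B"
    using bounded_continuous_sg_K[OF sg_F_continuous[OF assms(2)]] by metis
  show ?thesis
  proof (rule sg_F_I)
    show "sg_EN N (\<lambda>x. f x * g x) \<le> 2 * A\<^sup>2 * sg_En g + 2 * B\<^sup>2 * sg_En f" for N
    proof -
      have "sg_EN N (\<lambda>x. f x * g x) \<le> 2 * A\<^sup>2 * sg_EN N g + 2 * B\<^sup>2 * sg_EN N f"
        by (rule sg_EN_mult_le) (auto simp: A B)
      also have "\<dots> \<le> 2 * A\<^sup>2 * sg_En g + 2 * B\<^sup>2 * sg_En f"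
        using sg_EN_le_En[OF assms(1), of N] sg_EN_le_En[OF assms(2), of N]
        by (intro add_mono mult_left_mono) auto
      finally show ?thesis .
    qed
  qed (intro continuous_intros sg_F_continuous assms)
qed

lemma sg_form_LIMSEQ:
  assumes "f \<in> sg_F" "g \<in> sg_F"
  shows "(\<lambda>N. sg_EN2 N f g) \<longlonglongrightarrow> sg_form f g"
proof -
  have "(\<lambda>N. (sg_EN N (\<lambda>x. f x + g x) - sg_EN N (\<lambda>x. f x - g x)) / 4) \<longlonglongrightarrow> sg_form f g"
    unfolding sg_form_def sg_En_def[symmetric]
    by (intro tendsto_intros sg_En_LIMSEQ sg_F_add sg_F_diff assms) simp
  then show ?thesis
    by (simp add: sg_EN_add sg_EN_diff)
qed

lemma sg_form_self: "f \<in> sg_F \<Longrightarrow> sg_form f f = sg_En f"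
  using LIMSEQ_unique[OF sg_form_LIMSEQ sg_En_LIMSEQ[unfolded sg_EN_eq_EN2]] by blast

lemma sg_form_commute: "f \<in> sg_F \<Longrightarrow> g \<in> sg_F \<Longrightarrow> sg_form f g = sg_form g f"
  using LIMSEQ_unique[OF sg_form_LIMSEQ[of f g]] sg_form_LIMSEQ[of g f] by (simp add: sg_EN2_commute)

lemma sg_form_diff_left:
  assumes "f \<in> sg_F" "g \<in> sg_F" "h \<in> sg_F"
  shows "sg_form (\<lambda>x. f x - g x) h = sg_form f h - sg_form g h"
  using LIMSEQ_unique[OF sg_form_LIMSEQ[OF sg_F_diff[OF assms(1,2)] assms(3), unfolded sg_EN2_diff_left]
      tendsto_diff[OF sg_form_LIMSEQ[OF assms(1,3)] sg_form_LIMSEQ[OF assms(2,3)]]] .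

lemma sg_En_add: "f \<in> sg_F \<Longrightarrow> g \<in> sg_F \<Longrightarrow> sg_En (\<lambda>x. f x + g x) = sg_En f + 2 * sg_form f g + sg_En g"
  by (rule LIMSEQ_unique[OF sg_En_LIMSEQ[OF sg_F_add]], assumption+, unfold sg_EN_add)
    (intro tendsto_intros sg_En_LIMSEQ sg_form_LIMSEQ)

lemma sg_En_diff: "f \<in> sg_F \<Longrightarrow> g \<in> sg_F \<Longrightarrow> sg_En (\<lambda>x. f x - g x) = sg_En f - 2 * sg_form f g + sg_En g"
  by (rule LIMSEQ_unique[OF sg_En_LIMSEQ[OF sg_F_diff]], assumption+, unfold sg_EN_diff)
    (intro tendsto_intros sg_En_LIMSEQ sg_form_LIMSEQ)

lemma sg_En_scale: "f \<in> sg_F \<Longrightarrow> sg_En (\<lambda>x. c * f x) = c\<^sup>2 * sg_En f"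
  by (rule LIMSEQ_unique[OF sg_En_LIMSEQ[OF sg_F_scale]], assumption, unfold sg_EN_scale)
    (intro tendsto_intros sg_En_LIMSEQ)

lemma sg_form_scale_right: "f \<in> sg_F \<Longrightarrow> g \<in> sg_F \<Longrightarrow> sg_form f (\<lambda>x. c * g x) = c * sg_form f g"
  by (rule LIMSEQ_unique[OF sg_form_LIMSEQ[OF _ sg_F_scale]], assumption+, unfold sg_EN2_scale_right)
    (intro tendsto_intros sg_form_LIMSEQ)

lemma sg_form_zero_left: "g \<in> sg_F \<Longrightarrow> sg_form (\<lambda>x. 0) g = 0"
  using sg_form_diff_left[OF sg_F_zero sg_F_zero, of g] by simp

text \<open>Only finitely many vertices enter at a fixed level, so pointwise convergence is enough.
  Letting the level grow afterwards gives lower semicontinuity of the energy without any weak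
  topology.\<close>

lemma sg_EN_LIMSEQ_pointwise:
  assumes "\<And>x. x \<in> sg_K \<Longrightarrow> (\<lambda>n. u n x) \<longlonglongrightarrow> v x"
  shows "(\<lambda>n. sg_EN N (u n)) \<longlonglongrightarrow> sg_EN N v"
  unfolding sg_EN_eq_EN2 sg_EN2_def split_beta
  by (intro tendsto_intros assms) (metis prod.collapse sg_pairs_in_K)+

text \<open>The constant 5 only has to satisfy \<open>1 + 5 * sqrt (3/5) \<le> 5\<close>, the geometric growth
  of the bound along a chain of nested cells.\<close>

lemma sg_V_oscillation:
  assumes "x \<in> sg_V N" "i \<in> sg_I"
  shows "\<bar>f x - f (sg_a i)\<bar> \<le> 5 * sqrt (sg_EN N f)"
  using assms
proof (induction N arbitrary: f x i)
  case 0
  then obtain j where j: "j \<in> sg_I" "x = sg_a j"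
    by (auto simp: sg_V0_eq)
  have "(f (sg_a j) - f (sg_a i))\<^sup>2 \<le> sg_EN 0 f"
    unfolding sg_EN_0 using j(1) 0(2)
    by (elim sg_IE) (simp_all add: power2_commute add_increasing add_increasing2)
  then have "\<bar>f (sg_a j) - f (sg_a i)\<bar> \<le> sqrt (sg_EN 0 f)"
    by (rule real_le_rsqrt[of "\<bar>_\<bar>", unfolded power2_abs])
  then show ?case
    using j sg_EN_nonneg[of 0 f] real_sqrt_ge_zero[of "sg_EN 0 f"] by simp
next
  case (Suc N)
  then obtain j y where j: "j \<in> sg_I" "y \<in> sg_V N" "x = sg_phi j y"
    by (auto simp: sg_V_Suc)
  let ?E = "sg_EN (Suc N) f"
  have "5/3 * sg_EN N (f \<circ> sg_phi j) \<le> ?E"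
    unfolding sg_EN_Suc using j(1) sg_EN_nonneg by (intro mult_left_mono member_le_sum) auto
  then have "sqrt (sg_EN N (f \<circ> sg_phi j)) \<le> sqrt (3/5 * ?E)"
    by (intro real_sqrt_le_mono) simp
  also have "\<dots> = sqrt (3/5) * sqrt ?E"
    by (rule real_sqrt_mult)
  also have "\<dots> \<le> 4/5 * sqrt ?E"
    using sg_EN_nonneg by (intro mult_right_mono real_le_lsqrt) (auto simp: power2_eq_square)
  finally have step: "sqrt (sg_EN N (f \<circ> sg_phi j)) \<le> 4/5 * sqrt ?E" .
  have "\<bar>f x - f (sg_a j)\<bar> \<le> 5 * sqrt (sg_EN N (f \<circ> sg_phi j))"
    using Suc.IH[OF j(2,1), of "f \<circ> sg_phi j"] j(3) by (simp add: comp_def)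
  moreover have "(f (sg_a j) - f (sg_a i))\<^sup>2 \<le> sg_EN 0 f"
    unfolding sg_EN_0 using j(1) Suc.prems(2)
    by (elim sg_IE) (simp_all add: power2_commute add_increasing add_increasing2)
  then have "(f (sg_a j) - f (sg_a i))\<^sup>2 \<le> ?E"
    using sg_EN_mono[of 0 "Suc N" f] by simp
  then have "\<bar>f (sg_a j) - f (sg_a i)\<bar> \<le> sqrt ?E"
    by (rule real_le_rsqrt[of "\<bar>_\<bar>", unfolded power2_abs])
  ultimately show ?case
    using step by linarith
qed

text \<open>The bound at vertices has a constant independent of the level, and the vertices are
  dense.\<close>

lemma sg_F_oscillation:
  assumes f: "f \<in> sg_F" and x: "x \<in> sg_K" and i: "i \<in> sg_I"
  shows "\<bar>f x - f (sg_a i)\<bar> \<le> 5 * sqrt (sg_En f)"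
proof (rule continuous_le_on_closure[of "\<Union>N. sg_V N" "\<lambda>x. \<bar>f x - f (sg_a i)\<bar>"])
  show "continuous_on (closure (\<Union>N. sg_V N)) (\<lambda>x. \<bar>f x - f (sg_a i)\<bar>)"
    using sg_F_continuous[OF f] unfolding sg_K_eq_closure by (intro continuous_intros)
  show "x \<in> closure (\<Union>N. sg_V N)"
    using x unfolding sg_K_eq_closure .
  fix y assume "y \<in> (\<Union>N. sg_V N)"
  then obtain N where "y \<in> sg_V N"
    by blast
  then have "\<bar>f y - f (sg_a i)\<bar> \<le> 5 * sqrt (sg_EN N f)"
    using i by (rule sg_V_oscillation)
  also have "\<dots> \<le> 5 * sqrt (sg_En f)"
    using sg_EN_le_En[OF f] by simp
  finally show "\<bar>f y - f (sg_a i)\<bar> \<le> 5 * sqrt (sg_En f)" .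
qed

text \<open>The form domain with Dirichlet condition. The oscillation bound, taken at a corner where
  the function vanishes, makes the energy alone control the supremum here.\<close>

definition sg_F0 :: "(pt \<Rightarrow> real) set" where
  "sg_F0 = {f \<in> sg_F. \<forall>a\<in>sg_V0. f a = 0}"

lemma sg_F0_in_F: "f \<in> sg_F0 \<Longrightarrow> f \<in> sg_F"
  by (simp add: sg_F0_def)

lemma sg_F0_add: "f \<in> sg_F0 \<Longrightarrow> g \<in> sg_F0 \<Longrightarrow> (\<lambda>x. f x + g x) \<in> sg_F0"
  and sg_F0_diff: "f \<in> sg_F0 \<Longrightarrow> g \<in> sg_F0 \<Longrightarrow> (\<lambda>x. f x - g x) \<in> sg_F0"
  and sg_F0_scale: "f \<in> sg_F0 \<Longrightarrow> (\<lambda>x. c * f x) \<in> sg_F0"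
  and sg_F0_zero: "(\<lambda>x. 0) \<in> sg_F0"
  by (simp_all add: sg_F0_def sg_F_add sg_F_diff sg_F_scale sg_F_zero)

lemma sg_F0_sup_bound:
  assumes "f \<in> sg_F0" "x \<in> sg_K"
  shows "\<bar>f x\<bar> \<le> 5 * sqrt (sg_En f)"
  using sg_F_oscillation[OF sg_F0_in_F[OF assms(1)] assms(2), of 0] assms(1) by (simp add: sg_F0_def)

lemma sg_F0_square_bound:
  assumes "f \<in> sg_F0" "x \<in> sg_K"
  shows "(f x)\<^sup>2 \<le> 25 * sg_En f"
  using power_mono[OF sg_F0_sup_bound[OF assms], of 2] sg_En_nonneg[of f] by (simp add: power_mult_distrib)

section \<open>Harmonic functions and uniqueness of the Laplacian\<close>

text \<open>The order of the cases fixes the value at shared points arbitrarily. It becomes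
  irrelevant once \<open>g i (sg_a j) = g j (sg_a i)\<close>, since \<open>sg_phi i (sg_a j)\<close>
  and \<open>sg_phi j (sg_a i)\<close> are the same point and cells share no others.\<close>

definition sg_glue :: "(nat \<Rightarrow> pt \<Rightarrow> real) \<Rightarrow> pt \<Rightarrow> real" where
  "sg_glue g x = (if x \<in> sg_phi 0 ` sg_K then g 0 (sg_unphi 0 x)
     else if x \<in> sg_phi 1 ` sg_K then g 1 (sg_unphi 1 x) else g 2 (sg_unphi 2 x))"

lemma sg_glue_phi:
  assumes compat: "\<And>i j. i \<in> sg_I \<Longrightarrow> j \<in> sg_I \<Longrightarrow> g i (sg_a j) = g j (sg_a i)"
    and i: "i \<in> sg_I" and x: "x \<in> sg_K"
  shows "sg_glue g (sg_phi i x) = g i x"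
proof -
  have key: "g j (sg_unphi j (sg_phi i x)) = g i x" if j: "j \<in> sg_I" "sg_phi i x \<in> sg_phi j ` sg_K" for j
  proof (cases "j = i")
    case False
    obtain y where y: "y \<in> sg_K" "sg_phi i x = sg_phi j y"
      using j(2) by blast
    show ?thesis
      using sg_phi_overlap_K[OF x y(1) i j(1) False[symmetric] y(2)] y(2) compat[OF i j(1)] by simp
  qed simp
  have "sg_phi i x \<in> sg_phi i ` sg_K"
    using x by (rule imageI)
  then show ?thesis
    using i key[of 0] key[of 1] key[of 2] unfolding sg_glue_def by (elim sg_IE) auto
qed

lemma continuous_on_sg_glue:
  assumes compat: "\<And>i j. i \<in> sg_I \<Longrightarrow> j \<in> sg_I \<Longrightarrow> g i (sg_a j) = g j (sg_a i)"
    and g: "\<And>i. i \<in> sg_I \<Longrightarrow> continuous_on sg_K (g i)"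
  shows "continuous_on sg_K (sg_glue g)"
proof -
  have "continuous_on (\<Union>i\<in>sg_I. sg_phi i ` sg_K) (sg_glue g)"
  proof (rule continuous_on_closed_Union)
    fix i assume i: "i \<in> sg_I"
    show "closed (sg_phi i ` sg_K)"
      by (intro compact_imp_closed compact_continuous_image continuous_on_sg_phi compact_sg_K)
    have "continuous_on (sg_phi i ` sg_K) (\<lambda>x. g i (sg_unphi i x))"
      by (rule continuous_on_compose2[OF g[OF i] continuous_on_sg_unphi]) auto
    moreover have "sg_glue g x = g i (sg_unphi i x)" if "x \<in> sg_phi i ` sg_K" for x
      using that sg_glue_phi[where g = g, OF compat i] by auto
    ultimately show "continuous_on (sg_phi i ` sg_K) (sg_glue g)"
      by (simp cong: continuous_on_cong)
  qed simp
  then show ?thesis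
    by (simp flip: sg_K_self_similar)
qed

lemma sg_EN_cong: "(\<And>x. x \<in> sg_K \<Longrightarrow> f x = g x) \<Longrightarrow> sg_EN N f = sg_EN N g"
  unfolding sg_EN_eq_EN2 by (rule sg_EN2_cong)

lemma sg_EN_glue:
  assumes "\<And>i j. i \<in> sg_I \<Longrightarrow> j \<in> sg_I \<Longrightarrow> g i (sg_a j) = g j (sg_a i)"
  shows "sg_EN (Suc N) (sg_glue g) = 5/3 * (\<Sum>i\<in>sg_I. sg_EN N (g i))"
  unfolding sg_EN_Suc
  by (intro arg_cong2[where f = "(*)"] refl sum.cong sg_EN_cong) (simp add: sg_glue_phi assms)

text \<open>A harmonic function with corner values \<open>b\<close> restricts to the cell \<open>i\<close> as the harmonic function with corner
  values \<open>sg_hext i b\<close>; here \<open>(b 0 + b 1 + b 2 + b i + b j) / 5\<close> is the \<open>(2u + 2v + w)/5\<close> rule for the midpoint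
  of the edge from \<open>i\<close> to \<open>j\<close>.\<close>

definition sg_hext :: "nat \<Rightarrow> (nat \<Rightarrow> real) \<Rightarrow> nat \<Rightarrow> real" where
  "sg_hext i b j = (if j = i then b i else (b 0 + b 1 + b 2 + b i + b j) / 5)"

text \<open>\<open>sg_hap n b\<close> follows the harmonic rule through \<open>n\<close>
  subdivisions and interpolates affinely inside the remaining cells. It is a continuous
  approximation that already has the harmonic values on the level \<open>n\<close> vertices.\<close>

fun sg_hap :: "nat \<Rightarrow> (nat \<Rightarrow> real) \<Rightarrow> pt \<Rightarrow> real" where
  "sg_hap 0 b x = (\<Sum>i\<in>sg_I. b i * sg_bary i x)"
| "sg_hap (Suc n) b x = sg_glue (\<lambda>i. sg_hap n (sg_hext i b)) x"

lemma sg_hext_commute: "sg_hext i b j = sg_hext j b i"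
  by (simp add: sg_hext_def add_ac)

text \<open>The two claims need a joint induction: gluing requires the corner values of one level to
  match, and the corner values of the next level are read off from the glued function.\<close>

lemma sg_hap_corner_phi:
  "j \<in> sg_I \<Longrightarrow> sg_hap n b (sg_a j) = b j"
  "i \<in> sg_I \<Longrightarrow> x \<in> sg_K \<Longrightarrow> sg_hap (Suc n) b (sg_phi i x) = sg_hap n (sg_hext i b) x"
proof -
  have "(\<forall>b. \<forall>j\<in>sg_I. sg_hap n b (sg_a j) = b j) \<and>
      (\<forall>b. \<forall>i\<in>sg_I. \<forall>x\<in>sg_K. sg_hap (Suc n) b (sg_phi i x) = sg_hap n (sg_hext i b) x)"
  proof (induction n)
    case 0
    have corner: "sg_hap 0 b (sg_a j) = b j" if "j \<in> sg_I" for b j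
      using that by (elim sg_IE) (simp_all add: sum_sg_I sg_bary_corner)
    then show ?case
      by (auto simp del: sg_hap.simps(1) intro!: sg_glue_phi) (simp_all add: sg_hext_commute)
  next
    case (Suc n)
    have corner: "sg_hap (Suc n) b (sg_a j) = b j" if j: "j \<in> sg_I" for b j
    proof -
      have "sg_hap (Suc n) b (sg_phi j (sg_a j)) = sg_hap n (sg_hext j b) (sg_a j)"
        using Suc j sg_corner_in_K[OF j] by blast
      then show ?thesis
        using Suc j by (simp add: sg_hext_def del: sg_hap.simps)
    qed
    have "sg_hap (Suc (Suc n)) b (sg_phi i x) = sg_hap (Suc n) (sg_hext i b) x" if "i \<in> sg_I" "x \<in> sg_K" for b i x
      unfolding sg_hap.simps(2)[of "Suc n"] using that
      by (intro sg_glue_phi) (simp_all only: corner sg_hext_commute)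
    with corner show ?case
      by blast
  qed
  then show "j \<in> sg_I \<Longrightarrow> sg_hap n b (sg_a j) = b j"
    "i \<in> sg_I \<Longrightarrow> x \<in> sg_K \<Longrightarrow> sg_hap (Suc n) b (sg_phi i x) = sg_hap n (sg_hext i b) x"
    by blast+
qed

lemma continuous_on_sg_hap: "continuous_on sg_K (sg_hap n b)"
proof (induction n arbitrary: b)
  case 0
  then show ?case
    by (auto intro!: continuous_intros)
next
  case (Suc n)
  have "continuous_on sg_K (sg_glue (\<lambda>i. sg_hap n (sg_hext i b)))"
    by (intro continuous_on_sg_glue Suc) (simp add: sg_hap_corner_phi sg_hext_commute)
  then show ?case
    by simp
qed

text \<open>Let \<open>S\<close> be the sum of the three differences from \<open>b k\<close>, one of
  them zero. A new corner value differs from \<open>b k\<close> by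
  \<open>(S + (b k - b l)) / 5\<close>, hence by at most 3/5 of \<open>D\<close>; two new values
  differ by only a fifth of an old difference.\<close>

lemma sg_hext_oscillation:
  assumes D: "\<And>i j. i \<in> sg_I \<Longrightarrow> j \<in> sg_I \<Longrightarrow> \<bar>b i - b j\<bar> \<le> D"
    and i: "i \<in> sg_I" and j: "j \<in> sg_I" and k: "k \<in> sg_I"
  shows "\<bar>sg_hext k b i - sg_hext k b j\<bar> \<le> 3/5 * D"
proof -
  have D0: "0 \<le> D"
    using D[OF i i] by simp
  define S where "S = b k - b 0 + (b k - b 1) + (b k - b 2)"
  have S: "S \<le> 2 * D" "- 2 * D \<le> S"
    unfolding S_def using D[OF k, of 0] D[OF k, of 1] D[OF k, of 2] k unfolding abs_le_iff by (elim sg_IE; simp)+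
  have corner: "\<bar>b k - sg_hext k b l\<bar> \<le> 3/5 * D" if "l \<in> sg_I" "l \<noteq> k" for l
  proof -
    have eq: "b k - sg_hext k b l = (S + (b k - b l)) / 5"
      using that(2) by (simp add: S_def sg_hext_def field_simps)
    have "\<bar>S + (b k - b l)\<bar> \<le> 3 * D"
      using S D[OF k that(1)] by (simp add: abs_le_iff)
    then show ?thesis
      unfolding eq by simp
  qed
  consider "i = j" | "i = k" "j \<noteq> k" | "j = k" "i \<noteq> k" | "i \<noteq> k" "j \<noteq> k"
    by blast
  then show ?thesis
  proof cases
    case 2
    then show ?thesis
      using corner[OF j] by (simp add: sg_hext_def)
  next
    case 3
    then show ?thesis
      using corner[OF i] by (simp add: sg_hext_def abs_minus_commute)
  next
    case 4
    then have "sg_hext k b i - sg_hext k b j = (b i - b j) / 5"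
      by (simp add: sg_hext_def diff_divide_distrib[symmetric])
    then have "\<bar>sg_hext k b i - sg_hext k b j\<bar> = \<bar>b i - b j\<bar> / 5"
      by (simp only: abs_divide abs_numeral)
    also have "\<dots> \<le> D / 5"
      using D[OF i j] by simp
    also have "\<dots> \<le> 3/5 * D"
      using D0 by simp
    finally show ?thesis .
  qed (use D0 in simp)
qed

lemma sg_bary_nonneg_K: "x \<in> sg_K \<Longrightarrow> i \<in> sg_I \<Longrightarrow> 0 \<le> sg_bary i x"
  using sg_K_subset_triangle by (auto simp: sg_triangle_def)

text \<open>The constant 5/2 solves c = 1 + (3/5) c: moving to the corner of the right cell costs
  \<open>D\<close>, and inside the cell the oscillation has shrunk to 3/5 of
  \<open>D\<close>.\<close>

lemma sg_hap_close:
  assumes "\<And>i j. i \<in> sg_I \<Longrightarrow> j \<in> sg_I \<Longrightarrow> \<bar>b i - b j\<bar> \<le> D" "i \<in> sg_I" "x \<in> sg_K"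
  shows "\<bar>sg_hap n b x - b i\<bar> \<le> 5/2 * D"
  using assms
proof (induction n arbitrary: b D i x)
  case 0
  have D: "0 \<le> D"
    using 0(1)[of 0 0] by simp
  have "sg_hap 0 b x - b i = (\<Sum>j\<in>sg_I. b j * sg_bary j x) - b i * (\<Sum>j\<in>sg_I. sg_bary j x)"
    using sg_bary_sum[of x] by (simp add: sum_sg_I)
  also have "\<dots> = (\<Sum>j\<in>sg_I. (b j - b i) * sg_bary j x)"
    by (simp add: sum_distrib_left left_diff_distrib sum_subtractf)
  finally have "\<bar>sg_hap 0 b x - b i\<bar> \<le> (\<Sum>j\<in>sg_I. \<bar>(b j - b i) * sg_bary j x\<bar>)"
    by (simp only: sum_abs)
  also have "\<dots> \<le> (\<Sum>j\<in>sg_I. D * sg_bary j x)"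
    using 0 sg_bary_nonneg_K by (intro sum_mono) (simp add: abs_mult mult_right_mono)
  also have "\<dots> = D"
    using sg_bary_sum[of x] by (simp add: sum_sg_I flip: distrib_left)
  finally show ?case
    using D by simp
next
  case (Suc n)
  obtain k y where k: "k \<in> sg_I" "y \<in> sg_K" "x = sg_phi k y"
    using Suc.prems(3) by (rule sg_K_cases)
  have "\<bar>sg_hap n (sg_hext k b) y - sg_hext k b k\<bar> \<le> 5/2 * (3/5 * D)"
    using Suc.prems(1) k by (intro Suc.IH sg_hext_oscillation) auto
  moreover have "sg_hext k b k = b k"
    by (simp add: sg_hext_def)
  moreover have "sg_hap (Suc n) b x = sg_hap n (sg_hext k b) y"
    using k sg_hap_corner_phi(2) by simp
  moreover have "\<bar>b k - b i\<bar> \<le> D"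
    using Suc.prems k by blast
  ultimately show ?case
    by linarith
qed

text \<open>Two uses of the 5/2 bound give 5 D at level 0, and each passage into a cell multiplies
  the oscillation by 3/5.\<close>

lemma sg_hap_step:
  assumes "\<And>i j. i \<in> sg_I \<Longrightarrow> j \<in> sg_I \<Longrightarrow> \<bar>b i - b j\<bar> \<le> D" "x \<in> sg_K"
  shows "\<bar>sg_hap (Suc n) b x - sg_hap n b x\<bar> \<le> 5 * D * (3/5) ^ n"
  using assms
proof (induction n arbitrary: b D x)
  case 0
  have "\<bar>sg_hap n b x - b 0\<bar> \<le> 5/2 * D" for n
    using 0 by (intro sg_hap_close) auto
  from this[of 0] this[of "Suc 0"] show ?case
    unfolding abs_le_iff power_0 by linarith
next
  case (Suc n)
  obtain k y where k: "k \<in> sg_I" "y \<in> sg_K" "x = sg_phi k y"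
    using Suc.prems(2) by (rule sg_K_cases)
  have "\<bar>sg_hap (Suc n) (sg_hext k b) y - sg_hap n (sg_hext k b) y\<bar> \<le> 5 * (3/5 * D) * (3/5) ^ n"
    using Suc.prems(1) k by (intro Suc.IH sg_hext_oscillation) auto
  then show ?case
    using k by (simp add: sg_hap_corner_phi(2) del: sg_hap.simps)
qed

text \<open>Written as a telescoping series so that the Weierstrass test yields a uniform limit of
  the functions \<open>sg_hap n b\<close>.\<close>

definition sg_harmonic :: "(nat \<Rightarrow> real) \<Rightarrow> pt \<Rightarrow> real" where
  "sg_harmonic b x = sg_hap 0 b x + (\<Sum>n. sg_hap (Suc n) b x - sg_hap n b x)"

lemma sg_hap_uniform_limit: "uniform_limit sg_K (\<lambda>n. sg_hap n b) (sg_harmonic b) sequentially"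
proof -
  define D where "D = \<bar>b 0 - b 1\<bar> + \<bar>b 0 - b 2\<bar> + \<bar>b 1 - b 2\<bar>"
  have D: "\<bar>b i - b j\<bar> \<le> D" if "i \<in> sg_I" "j \<in> sg_I" for i j
    using that unfolding D_def by (elim sg_IE) auto
  have "uniform_limit sg_K (\<lambda>n x. \<Sum>i<n. sg_hap (Suc i) b x - sg_hap i b x)
      (\<lambda>x. \<Sum>i. sg_hap (Suc i) b x - sg_hap i b x) sequentially"
    using sg_hap_step[OF D]
    by (intro Weierstrass_m_test[where M = "\<lambda>n. 5 * D * (3/5) ^ n"]) (auto simp del: sg_hap.simps)
  then have "uniform_limit sg_K (\<lambda>n x. sg_hap 0 b x + (\<Sum>i<n. sg_hap (Suc i) b x - sg_hap i b x))
      (sg_harmonic b) sequentially"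
    unfolding sg_harmonic_def by (intro uniform_limit_intros)
  moreover have "sg_hap 0 b x + (\<Sum>i<n. sg_hap (Suc i) b x - sg_hap i b x) = sg_hap n b x" for n x
    using sum_lessThan_telescope[of "\<lambda>i. sg_hap i b x" n] by (simp del: sg_hap.simps)
  ultimately show ?thesis
    by (simp only:)
qed

lemma sg_hap_LIMSEQ: "x \<in> sg_K \<Longrightarrow> (\<lambda>n. sg_hap n b x) \<longlonglongrightarrow> sg_harmonic b x"
  by (rule tendsto_uniform_limitI[OF sg_hap_uniform_limit])

lemma continuous_on_sg_harmonic: "continuous_on sg_K (sg_harmonic b)"
  by (rule uniform_limit_theorem[OF _ sg_hap_uniform_limit]) (simp_all add: continuous_on_sg_hap)

lemma sg_harmonic_phi:
  "i \<in> sg_I \<Longrightarrow> x \<in> sg_K \<Longrightarrow> sg_harmonic b (sg_phi i x) = sg_harmonic (sg_hext i b) x"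
  using LIMSEQ_Suc[OF sg_hap_LIMSEQ[OF sg_phi_in_K, of i x b]] sg_hap_LIMSEQ[of x "sg_hext i b"]
  by (simp add: sg_hap_corner_phi(2) LIMSEQ_unique del: sg_hap.simps)

lemma sg_harmonic_corner: "j \<in> sg_I \<Longrightarrow> sg_harmonic b (sg_a j) = b j"
  using sg_hap_LIMSEQ[OF sg_corner_in_K, of j b] by (simp add: sg_hap_corner_phi(1) LIMSEQ_const_iff)

lemma sg_harmonic_nonneg:
  assumes "\<And>i. i \<in> sg_I \<Longrightarrow> 0 \<le> b i" "x \<in> sg_K"
  shows "0 \<le> sg_harmonic b x"
proof -
  have "0 \<le> sg_hap n b x" for n
    using assms
  proof (induction n arbitrary: b x)
    case 0
    then show ?case
      by (auto intro!: sum_nonneg mult_nonneg_nonneg sg_bary_nonneg_K)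
  next
    case (Suc n)
    obtain k y where k: "k \<in> sg_I" "y \<in> sg_K" "x = sg_phi k y"
      using Suc.prems(2) by (rule sg_K_cases)
    have "0 \<le> sg_hap n (sg_hext k b) y"
      using Suc.prems(1) k(1) by (intro Suc.IH k) (auto simp: sg_hext_def)
    then show ?case
      using k by (simp add: sg_hap_corner_phi(2) del: sg_hap.simps)
  qed
  then show ?thesis
    by (intro LIMSEQ_le_const[OF sg_hap_LIMSEQ[OF assms(2)]]) blast
qed

text \<open>For the harmonic extension the energy inequality between consecutive levels is an
  equality, so harmonic functions have finite energy.\<close>

lemma sg_EN_harmonic: "sg_EN N (sg_harmonic b) = (b 0 - b 1)\<^sup>2 + (b 1 - b 2)\<^sup>2 + (b 0 - b 2)\<^sup>2"
proof (induction N arbitrary: b)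
  case 0
  show ?case
    unfolding sg_EN_0 by (simp add: sg_harmonic_corner)
next
  case (Suc N)
  have "sg_EN N (sg_harmonic b \<circ> sg_phi i) = sg_EN N (sg_harmonic (sg_hext i b))" if "i \<in> sg_I" for i
    using that by (intro sg_EN_cong) (simp add: sg_harmonic_phi)
  then show ?case
    unfolding sg_EN_Suc sum_sg_I by (simp add: Suc) (simp add: sg_hext_def power2_eq_square field_simps)
qed

lemma sg_harmonic_in_F: "sg_harmonic b \<in> sg_F"
  by (rule sg_F_I[OF continuous_on_sg_harmonic eq_refl[OF sg_EN_harmonic]])

text \<open>On the whole gasket take the product of two harmonic functions peaking at different
  corners. For a longer word glue the previous bump into one cell and zero into the others, which
  fits because all corner values are zero.\<close>

lemma sg_bump_exists:
  assumes "set w \<subseteq> sg_I"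
  shows "\<exists>v\<in>sg_F0. (\<forall>x\<in>sg_K. 0 \<le> v x) \<and> (\<forall>x\<in>sg_K - sg_phiw w ` sg_K. v x = 0) \<and> (\<exists>p\<in>sg_phiw w ` sg_K. 0 < v p)"
  using assms
proof (induction w)
  case Nil
  define e :: "nat \<Rightarrow> nat \<Rightarrow> real" where "e i j = (if i = j then 1 else 0)" for i j
  let ?v = "\<lambda>x. sg_harmonic (e 0) x * sg_harmonic (e 1) x"
  have "?v \<in> sg_F0"
    unfolding sg_F0_def sg_V0_eq by (auto intro!: sg_F_mult sg_harmonic_in_F simp: sg_harmonic_corner e_def)
  moreover have "0 \<le> ?v x" if "x \<in> sg_K" for x
    using that by (intro mult_nonneg_nonneg sg_harmonic_nonneg) (auto simp: e_def)
  \<comment> \<open>At this midpoint both factors equal 2/5.\<close>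
  moreover have "sg_phi 0 (sg_a 1) \<in> sg_K" "0 < ?v (sg_phi 0 (sg_a 1))"
    by (simp_all add: sg_phi_in_K sg_harmonic_phi sg_harmonic_corner sg_hext_def e_def)
  ultimately show ?case
    by (intro bexI[of _ ?v]) auto
next
  case (Cons i w)
  then have i: "i \<in> sg_I" and "set w \<subseteq> sg_I"
    by auto
  then obtain v p where v: "v \<in> sg_F0" "\<And>x. x \<in> sg_K \<Longrightarrow> 0 \<le> v x"
      "\<And>x. x \<in> sg_K \<Longrightarrow> x \<notin> sg_phiw w ` sg_K \<Longrightarrow> v x = 0" and p: "p \<in> sg_phiw w ` sg_K" "0 < v p"
    using Cons.IH by blast
  have pK: "p \<in> sg_K"
    using p(1) sg_cell_subset_K[of w "length w"] \<open>set w \<subseteq> sg_I\<close> by (auto simp: sg_words_eq)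
  define g :: "nat \<Rightarrow> pt \<Rightarrow> real" where "g j = (if j = i then v else (\<lambda>x. 0))" for j
  have g_corner: "g j (sg_a k) = 0" if "k \<in> sg_I" for j k
    using v(1) that by (simp add: g_def sg_F0_def)
  then have compat: "g j (sg_a k) = g k (sg_a j)" if "j \<in> sg_I" "k \<in> sg_I" for j k
    using that by simp
  have gF: "g j \<in> sg_F" for j
    using v(1) by (simp add: g_def sg_F0_in_F sg_F_zero)
  have glue: "sg_glue g (sg_phi j x) = g j x" if "j \<in> sg_I" "x \<in> sg_K" for j x
    by (rule sg_glue_phi[where g = g, OF compat that])
  have "sg_EN N (sg_glue g) \<le> 5/3 * (\<Sum>j\<in>sg_I. sg_En (g j))" for N
  proof -
    have "sg_EN N (sg_glue g) \<le> sg_EN (Suc N) (sg_glue g)"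
      by (rule sg_EN_le_Suc)
    also have "\<dots> = 5/3 * (\<Sum>j\<in>sg_I. sg_EN N (g j))"
      by (rule sg_EN_glue) (rule compat)
    also have "\<dots> \<le> 5/3 * (\<Sum>j\<in>sg_I. sg_En (g j))"
      by (intro mult_left_mono sum_mono sg_EN_le_En gF) simp
    finally show ?thesis .
  qed
  moreover have "continuous_on sg_K (sg_glue g)"
    by (rule continuous_on_sg_glue) (rule compat, assumption+, rule sg_F_continuous[OF gF])
  ultimately have "sg_glue g \<in> sg_F"
    by (intro sg_F_I)
  moreover have "sg_glue g (sg_a j) = 0" if "j \<in> sg_I" for j
    using glue[OF that sg_corner_in_K[OF that]] g_corner[OF that] by simp
  ultimately have F0: "sg_glue g \<in> sg_F0"
    by (auto simp: sg_F0_def sg_V0_eq)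
  have nonneg: "0 \<le> sg_glue g x" if "x \<in> sg_K" for x
    using that by (rule sg_K_cases) (simp add: glue g_def v(2))
  have zero: "sg_glue g x = 0" if x: "x \<in> sg_K" "x \<notin> sg_phiw (i # w) ` sg_K" for x
  proof -
    obtain j y where j: "j \<in> sg_I" "y \<in> sg_K" "x = sg_phi j y"
      using x(1) by (rule sg_K_cases)
    then show ?thesis
      using x(2) v(3)[of y] by (auto simp: glue g_def image_sg_phiw_Cons simp del: sg_phiw_Cons)
  qed
  have "sg_phi i p \<in> sg_phiw (i # w) ` sg_K" "0 < sg_glue g (sg_phi i p)"
    unfolding image_sg_phiw_Cons using p i pK by (auto simp: glue g_def)
  then show ?case
    using F0 nonneg zero by blast
qed

text \<open>If \<open>f x\<close> were nonzero, \<open>f\<close> would keep its sign on a small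
  cell, and a bump supported in that cell would give a nonzero integral.\<close>

lemma sg_F0_separating:
  assumes f: "continuous_on sg_K f" and orth: "\<And>v. v \<in> sg_F0 \<Longrightarrow> (\<integral>x\<in>sg_K. f x * v x \<partial>sg_m) = 0"
    and x: "x \<in> sg_K"
  shows "f x = 0"
proof (rule ccontr)
  assume nz: "f x \<noteq> 0"
  define s where "s = sgn (f x)"
  obtain d where d: "d > 0" "\<And>y. y \<in> sg_K \<Longrightarrow> dist y x < d \<Longrightarrow> dist (f y) (f x) < \<bar>f x\<bar>"
    using f x nz unfolding continuous_on_iff by (metis zero_less_abs_iff)
  obtain N w where w: "w \<in> sg_words N" "sg_phiw w ` sg_K \<subseteq> ball x d"
    by (rule sg_cell_in_ball[OF x d(1)])
  then obtain v p where v: "v \<in> sg_F0" "\<And>y. y \<in> sg_K \<Longrightarrow> 0 \<le> v y"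
      "\<And>y. y \<in> sg_K \<Longrightarrow> y \<notin> sg_phiw w ` sg_K \<Longrightarrow> v y = 0" and p: "p \<in> sg_phiw w ` sg_K" "0 < v p"
    using sg_bump_exists[of w] unfolding sg_words_eq by blast
  have pK: "p \<in> sg_K"
    using p(1) sg_cell_subset_K[OF w(1)] by blast
  have pos: "0 < s * f y" if "y \<in> sg_K" "y \<in> sg_phiw w ` sg_K" for y
  proof -
    have "dist y x < d"
      using w(2) that(2) by (auto simp: dist_commute)
    from d(2)[OF that(1) this] show ?thesis
      using nz by (auto simp: s_def sgn_if dist_real_def abs_real_def split: if_splits)
  qed
  have "0 < (\<integral>y\<in>sg_K. s * (f y * v y) \<partial>sg_m)"
  proof (rule sg_integral_pos[OF _ _ pK])
    show "continuous_on sg_K (\<lambda>y. s * (f y * v y))"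
      by (intro continuous_intros f sg_F_continuous sg_F0_in_F v(1))
    show "0 \<le> s * (f y * v y)" if "y \<in> sg_K" for y
      using pos[of y] v(2,3)[of y] that mult_nonneg_nonneg[of "s * f y" "v y"] by (cases "y \<in> sg_phiw w ` sg_K") (auto simp: mult.assoc)
    show "0 < s * (f p * v p)"
      using mult_pos_pos[OF pos[OF pK p(1)] p(2)] by (simp add: mult.assoc)
  qed
  then show False
    using orth[OF v(1)] by simp
qed

lemma sg_lap_witness_F0:
  "sg_lap_witness u f \<longleftrightarrow> continuous_on sg_K f \<and> (\<forall>v\<in>sg_F0. sg_form u v = (\<integral>x\<in>sg_K. f x * v x \<partial>sg_m))"
  unfolding sg_lap_witness_def sg_F0_def by auto

text \<open>\<open>sg_lap\<close> chooses some witness; two witnesses agree on the gasket because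
  their difference annihilates \<open>sg_F0\<close>. Off the gasket the choice is arbitrary, so the
  identity is claimed on \<open>sg_K\<close> alone.\<close>

lemma sg_lap_eq:
  assumes f: "sg_lap_witness u f" and x: "x \<in> sg_K"
  shows "sg_lap u x = - f x"
proof -
  define g where "g = (SOME f. sg_lap_witness u f)"
  have g: "sg_lap_witness u g"
    unfolding g_def by (rule someI[of "sg_lap_witness u", OF f])
  have cont: "continuous_on sg_K f" "continuous_on sg_K g"
    using f g by (auto simp: sg_lap_witness_F0)
  have "g x - f x = 0"
  proof (rule sg_F0_separating[OF _ _ x])
    fix v assume v: "v \<in> sg_F0"
    have "set_integrable sg_m sg_K (\<lambda>x. f x * v x)" "set_integrable sg_m sg_K (\<lambda>x. g x * v x)"
      by (intro set_integrable_continuous_sg_K continuous_intros cont sg_F_continuous sg_F0_in_F v)+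
    then show "(\<integral>x\<in>sg_K. (g x - f x) * v x \<partial>sg_m) = 0"
      using f g v by (simp add: left_diff_distrib sg_lap_witness_F0)
  qed (intro continuous_intros cont)
  then show ?thesis
    by (simp add: sg_lap_def g_def)
qed

section \<open>The Green operator\<close>

text \<open>The supremum bound turns Cauchy in energy into uniformly Cauchy. The energy estimate
  survives by sending \<open>m\<close> to infinity at a fixed graph level. Splitting the modulus as
  \<open>d m + d n\<close> leaves the rate \<open>d n\<close> for the limit.\<close>

lemma sg_F0_complete:
  fixes u :: "nat \<Rightarrow> pt \<Rightarrow> real"
  assumes u: "\<And>n. u n \<in> sg_F0" and d: "d \<longlonglongrightarrow> 0"
    and cauchy: "\<And>m n. sg_En (\<lambda>x. u n x - u m x) \<le> d m + d n"
  obtains v where "v \<in> sg_F0" "\<And>n. sg_En (\<lambda>x. u n x - v x) \<le> d n" "\<And>x. x \<in> sg_K \<Longrightarrow> (\<lambda>n. u n x) \<longlonglongrightarrow> v x"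
proof -
  have diff: "\<bar>u n x - u m x\<bar> \<le> 5 * sqrt (d m + d n)" if "x \<in> sg_K" for m n x
    by (rule order_trans[OF sg_F0_sup_bound[OF sg_F0_diff[OF u u] that]]) (simp add: cauchy)
  have conv: "\<exists>l. (\<lambda>n. u n x) \<longlonglongrightarrow> l" if x: "x \<in> sg_K" for x
  proof -
    have "Cauchy (\<lambda>n. u n x)"
    proof (rule metric_CauchyI)
      fix e :: real assume e: "e > 0"
      then have "\<forall>\<^sub>F n in sequentially. d n < (e / 5)\<^sup>2 / 2"
        using d by (intro order_tendstoD) auto
      then obtain N where N: "\<And>n. n \<ge> N \<Longrightarrow> d n < (e / 5)\<^sup>2 / 2"
        unfolding eventually_sequentially by auto
      have "dist (u m x) (u n x) < e" if "m \<ge> N" "n \<ge> N" for m n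
      proof -
        have "sqrt (d n + d m) < e / 5"
          using N[OF that(1)] N[OF that(2)] e by (intro real_less_lsqrt) auto
        then show ?thesis
          using diff[OF x, of m n] by (simp add: dist_real_def)
      qed
      then show "\<exists>M. \<forall>m\<ge>M. \<forall>n\<ge>M. dist (u m x) (u n x) < e"
        by blast
    qed
    then show ?thesis
      by (simp add: Cauchy_convergent_iff convergent_def)
  qed
  define v where "v x = lim (\<lambda>n. u n x)" for x
  have v: "(\<lambda>n. u n x) \<longlonglongrightarrow> v x" if "x \<in> sg_K" for x
    using conv[OF that] limI unfolding v_def by blast
  have close: "\<bar>u n x - v x\<bar> \<le> 5 * sqrt (d n)" if x: "x \<in> sg_K" for n x
  proof (rule LIMSEQ_le[OF _ _ exI[of _ 0]])
    show "(\<lambda>m. \<bar>u n x - u m x\<bar>) \<longlonglongrightarrow> \<bar>u n x - v x\<bar>"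
      by (intro tendsto_intros v x)
    have "(\<lambda>m. 5 * sqrt (d m + d n)) \<longlonglongrightarrow> 5 * sqrt (0 + d n)"
      by (intro tendsto_intros d)
    then show "(\<lambda>m. 5 * sqrt (d m + d n)) \<longlonglongrightarrow> 5 * sqrt (d n)"
      by simp
  qed (use diff[OF x] in blast)
  have "uniform_limit sg_K u v sequentially"
  proof (rule uniform_limitI)
    fix e :: real assume e: "e > 0"
    have "(\<lambda>n. 5 * sqrt (d n)) \<longlonglongrightarrow> 5 * sqrt 0"
      by (intro tendsto_intros d)
    then have "\<forall>\<^sub>F n in sequentially. 5 * sqrt (d n) < e"
      using e by (intro order_tendstoD) auto
    then show "\<forall>\<^sub>F n in sequentially. \<forall>x\<in>sg_K. dist (u n x) (v x) < e"
      by eventually_elim (auto simp: dist_real_def intro: le_less_trans[OF close])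
  qed
  then have cont: "continuous_on sg_K v"
    by (rule uniform_limit_theorem[rotated]) (simp_all add: u sg_F0_in_F sg_F_continuous)
  have EN: "sg_EN N (\<lambda>x. u n x - v x) \<le> d n" for N n
  proof (rule LIMSEQ_le[OF _ _ exI[of _ 0]])
    show "(\<lambda>m. sg_EN N (\<lambda>x. u n x - u m x)) \<longlonglongrightarrow> sg_EN N (\<lambda>x. u n x - v x)"
      by (intro sg_EN_LIMSEQ_pointwise tendsto_intros v)
    have "(\<lambda>m. d m + d n) \<longlonglongrightarrow> 0 + d n"
      by (intro tendsto_intros d)
    then show "(\<lambda>m. d m + d n) \<longlonglongrightarrow> d n"
      by simp
    have "sg_EN N (\<lambda>x. u n x - u m x) \<le> d m + d n" for m
      by (rule order_trans[OF sg_EN_le_En[OF sg_F0_in_F[OF sg_F0_diff[OF u u]]] cauchy])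
    then show "\<forall>m\<ge>0. sg_EN N (\<lambda>x. u n x - u m x) \<le> d m + d n"
      by blast
  qed
  have F: "(\<lambda>x. u n x - v x) \<in> sg_F" for n
    by (rule sg_F_I[OF _ EN]) (intro continuous_intros cont sg_F_continuous sg_F0_in_F u)
  have "v \<in> sg_F"
    using sg_F_diff[OF sg_F0_in_F[OF u[of 0]] F[of 0]] by simp
  moreover have "v a = 0" if "a \<in> sg_V0" for a
    using v[OF subsetD[OF sg_V0_subset_K that]] u that by (simp add: sg_F0_def LIMSEQ_const_iff)
  ultimately have "v \<in> sg_F0"
    by (simp add: sg_F0_def)
  then show ?thesis
    using that[of v] sg_En_le[OF F EN] v by blast
qed

text \<open>The representing function minimises \<open>E(v) - 2 l(v)\<close>; minimising sequences are Cauchy by the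
  parallelogram law.\<close>

lemma sg_F0_riesz:
  fixes l :: "(pt \<Rightarrow> real) \<Rightarrow> real"
  assumes add: "\<And>u v. u \<in> sg_F0 \<Longrightarrow> v \<in> sg_F0 \<Longrightarrow> l (\<lambda>x. u x + v x) = l u + l v"
    and scale: "\<And>c u. u \<in> sg_F0 \<Longrightarrow> l (\<lambda>x. c * u x) = c * l u"
    and bound: "\<And>u. u \<in> sg_F0 \<Longrightarrow> \<bar>l u\<bar> \<le> C * sqrt (sg_En u)"
  shows "\<exists>u\<in>sg_F0. \<forall>v\<in>sg_F0. sg_form u v = l v"
proof -
  define J where "J v = sg_En v - 2 * l v" for v
  define I where "I = Inf (J ` sg_F0)"
  have diff: "l (\<lambda>x. u x - v x) = l u - l v" if "u \<in> sg_F0" "v \<in> sg_F0" for u v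
    using add[OF that(1) sg_F0_scale[OF that(2), of "- 1"]] scale[OF that(2), of "- 1"] by simp
  have lower: "- C\<^sup>2 \<le> J v" if v: "v \<in> sg_F0" for v
  proof -
    have "0 \<le> (sqrt (sg_En v) - C)\<^sup>2"
      by simp
    also have "\<dots> = sg_En v - 2 * (C * sqrt (sg_En v)) + C\<^sup>2"
      using sg_En_nonneg[of v] by (simp add: power2_diff)
    finally show ?thesis
      using bound[OF v] unfolding J_def by linarith
  qed
  have I_le: "I \<le> J v" if "v \<in> sg_F0" for v
    unfolding I_def using that lower by (intro cINF_lower bdd_belowI2[where m = "- C\<^sup>2"]) auto
  have "\<exists>v\<in>sg_F0. J v < I + 1 / Suc n" for n
  proof -
    have "J ` sg_F0 \<noteq> {}"
      using sg_F0_zero by blast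
    then show ?thesis
      using cInf_lessD[of "J ` sg_F0" "I + 1 / Suc n"] unfolding I_def by auto
  qed
  then obtain u where u: "\<And>n. u n \<in> sg_F0" and Ju: "\<And>n. J (u n) < I + 1 / Suc n"
    by metis
  have cauchy: "sg_En (\<lambda>x. u n x - u m x) \<le> 2 / Suc m + 2 / Suc n" for m n
  proof -
    let ?s = "\<lambda>x. u n x + u m x"
    let ?h = "\<lambda>x. (1/2) * ?s x"
    note F = sg_F0_in_F[OF u]
    have s: "?s \<in> sg_F0"
      by (intro sg_F0_add u)
    have "sg_En (\<lambda>x. u n x - u m x) = 2 * sg_En (u n) + 2 * sg_En (u m) - sg_En ?s"
      using sg_En_diff[OF F F, of n m] sg_En_add[OF F F, of n m] by simp
    also have "sg_En ?s = 4 * sg_En ?h"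
      using sg_En_scale[OF sg_F0_in_F[OF s], of "1/2"] by (simp add: power2_eq_square)
    also have "sg_En ?h = J ?h + l (u n) + l (u m)"
      unfolding J_def scale[OF s] using add[OF u u, of n m] by simp
    finally have "sg_En (\<lambda>x. u n x - u m x) = 2 * (J (u n) - J ?h) + 2 * (J (u m) - J ?h)"
      by (simp add: J_def algebra_simps)
    also have "\<dots> \<le> 2 * (1 / Suc n) + 2 * (1 / Suc m)"
      using I_le[OF sg_F0_scale[OF s, of "1/2"]] Ju[of n] Ju[of m] by (intro add_mono mult_left_mono) auto
    finally show ?thesis
      by simp
  qed
  have lim0: "(\<lambda>n. 2 / real (Suc n)) \<longlonglongrightarrow> 0"
    using tendsto_mult_right_zero[OF LIMSEQ_inverse_real_of_nat, of 2] by (simp add: field_simps)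
  obtain w where w: "w \<in> sg_F0" and dw: "\<And>n. sg_En (\<lambda>x. u n x - w x) \<le> 2 / Suc n"
    and pw: "\<And>x. x \<in> sg_K \<Longrightarrow> (\<lambda>n. u n x) \<longlonglongrightarrow> w x"
    using sg_F0_complete[OF u lim0 cauchy] by blast
  have lw: "(\<lambda>n. l (u n)) \<longlonglongrightarrow> l w"
  proof (rule LIM_zero_cancel, rule Lim_null_comparison)
    have "\<bar>l (u n) - l w\<bar> \<le> \<bar>C\<bar> * sqrt (2 / Suc n)" for n
    proof -
      have "\<bar>l (u n) - l w\<bar> \<le> C * sqrt (sg_En (\<lambda>x. u n x - w x))"
        using bound[OF sg_F0_diff[OF u w], of n] diff[OF u w, of n] by simp
      also have "\<dots> \<le> \<bar>C\<bar> * sqrt (2 / Suc n)"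
        using dw[of n] sg_En_nonneg[of "\<lambda>x. u n x - w x"] by (intro mult_mono real_sqrt_le_mono) auto
      finally show ?thesis .
    qed
    then show "\<forall>\<^sub>F n in sequentially. norm (l (u n) - l w) \<le> \<bar>C\<bar> * sqrt (2 / Suc n)"
      by simp
    have "(\<lambda>n. \<bar>C\<bar> * sqrt (2 / Suc n)) \<longlonglongrightarrow> \<bar>C\<bar> * sqrt 0"
      by (intro tendsto_intros lim0)
    then show "(\<lambda>n. \<bar>C\<bar> * sqrt (2 / Suc n)) \<longlonglongrightarrow> 0"
      by simp
  qed
  have "sg_EN N w \<le> I + 2 * l w" for N
  proof (rule LIMSEQ_le[OF _ _ exI[of _ 0]])
    show "(\<lambda>n. sg_EN N (u n)) \<longlonglongrightarrow> sg_EN N w"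
      by (intro sg_EN_LIMSEQ_pointwise pw)
    have "(\<lambda>n. I + 1 / real (Suc n) + 2 * l (u n)) \<longlonglongrightarrow> I + 0 + 2 * l w"
      using LIMSEQ_inverse_real_of_nat by (intro tendsto_intros lw) (simp add: field_simps)
    then show "(\<lambda>n. I + 1 / real (Suc n) + 2 * l (u n)) \<longlonglongrightarrow> I + 2 * l w"
      by simp
    show "\<forall>n\<ge>0. sg_EN N (u n) \<le> I + 1 / real (Suc n) + 2 * l (u n)"
    proof (intro allI impI)
      fix n
      show "sg_EN N (u n) \<le> I + 1 / real (Suc n) + 2 * l (u n)"
        using sg_EN_le_En[OF sg_F0_in_F[OF u], of N n] Ju[of n] unfolding J_def by linarith
    qed
  qed
  then have Jw: "J w \<le> I"
    using sg_En_le[OF sg_F0_in_F[OF w], of "I + 2 * l w"] by (simp add: J_def)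
  have "sg_form w v = l v" if v: "v \<in> sg_F0" for v
  proof (rule ccontr)
    assume neq: "sg_form w v \<noteq> l v"
    define a where "a = sg_form w v - l v"
    \<comment> \<open>Up to the extra 1, which keeps the denominator positive, this is the minimiser
      of the quadratic in \<open>s\<close>; moving by it would push \<open>J\<close> below its
      infimum.\<close>
    define s where "s = - a / (sg_En v + 1)"
    have pos: "sg_En v + 1 > 0"
      using sg_En_nonneg[of v] by simp
    have sv: "(\<lambda>x. s * v x) \<in> sg_F0"
      by (rule sg_F0_scale[OF v])
    have "J w \<le> J (\<lambda>x. w x + s * v x)"
      using Jw I_le[OF sg_F0_add[OF w sv]] by simp
    also have "\<dots> = J w + s\<^sup>2 * sg_En v + 2 * s * a"
      unfolding J_def a_def
      by (simp add: sg_En_add sg_F0_in_F w sv v add scale sg_En_scale sg_form_scale_right algebra_simps)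
    finally have "0 \<le> s\<^sup>2 * sg_En v + 2 * s * a"
      by simp
    also have "\<dots> \<le> s\<^sup>2 * (sg_En v + 1) + 2 * s * a"
      by (simp add: distrib_left)
    also have "\<dots> = s * (s * (sg_En v + 1)) + 2 * s * a"
      by (simp add: power2_eq_square)
    also have "s * (sg_En v + 1) = - a"
      using pos by (simp add: s_def)
    also have "s * - a + 2 * s * a = - (a\<^sup>2 / (sg_En v + 1))"
      by (simp add: s_def power2_eq_square)
    also have "\<dots> < 0"
      using pos neq by (simp add: a_def)
    finally show False
      by simp
  qed
  then show ?thesis
    using w by blast
qed

text \<open>For a non-integrable function the integral is 0 by convention, and \<open>B\<close> is
  nonnegative because the gasket is nonempty.\<close>

lemma sg_integral_abs_le:
  fixes f :: "pt \<Rightarrow> real"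
  assumes "\<And>x. x \<in> sg_K \<Longrightarrow> \<bar>f x\<bar> \<le> B"
  shows "\<bar>\<integral>x\<in>sg_K. f x \<partial>sg_m\<bar> \<le> B"
proof (cases "set_integrable sg_m sg_K f")
  case True
  have "\<bar>\<integral>x\<in>sg_K. f x \<partial>sg_m\<bar> \<le> (\<integral>x. \<bar>indicator sg_K x *\<^sub>R f x\<bar> \<partial>sg_m)"
    unfolding set_lebesgue_integral_def by (rule integral_abs_bound)
  also have "\<dots> \<le> (\<integral>x. B \<partial>sg_m)"
    using True AE_sg_m_in_K assms unfolding set_integrable_def
    by (intro integral_mono_AE) (auto elim!: eventually_mono)
  finally show ?thesis
    by (simp add: sg_m.prob_space[unfolded space_sg_m])
next
  case False
  then show ?thesis
    using order_trans[OF abs_ge_zero assms] sg_K_nonempty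
    by (auto simp: set_lebesgue_integral_def set_integrable_def not_integrable_integral_eq)
qed

text \<open>The Green kernel with pole \<open>x\<close>: the representing function of evaluation at
  \<open>x\<close>, which the supremum bound makes a bounded functional.\<close>

definition sg_point :: "pt \<Rightarrow> pt \<Rightarrow> real" where
  "sg_point x = (SOME g. g \<in> sg_F0 \<and> (\<forall>v\<in>sg_F0. sg_form g v = v x))"

lemma sg_point:
  assumes x: "x \<in> sg_K"
  shows "sg_point x \<in> sg_F0" "\<And>v. v \<in> sg_F0 \<Longrightarrow> sg_form (sg_point x) v = v x"
proof -
  have "\<exists>g. g \<in> sg_F0 \<and> (\<forall>v\<in>sg_F0. sg_form g v = v x)"
    using sg_F0_riesz[of "\<lambda>v. v x" 5] sg_F0_sup_bound x by auto
  from someI_ex[OF this] show "sg_point x \<in> sg_F0" "\<And>v. v \<in> sg_F0 \<Longrightarrow> sg_form (sg_point x) v = v x"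
    unfolding sg_point_def by blast+
qed

text \<open>An integral against the kernel, in place of choosing a solution for each
  \<open>f\<close>: when \<open>f\<close> depends measurably on time, so does the value at each
  point.\<close>

definition sg_green :: "(pt \<Rightarrow> real) \<Rightarrow> pt \<Rightarrow> real" where
  "sg_green f x = (\<integral>y\<in>sg_K. f y * sg_point x y \<partial>sg_m)"

lemma sg_energy_cong: "(\<And>x. x \<in> sg_K \<Longrightarrow> f x = g x) \<Longrightarrow> sg_energy f = sg_energy g"
  unfolding sg_energy_def using sg_EN_cong[of f g] by simp

lemma sg_form_cong:
  "(\<And>x. x \<in> sg_K \<Longrightarrow> f x = f' x) \<Longrightarrow> (\<And>x. x \<in> sg_K \<Longrightarrow> g x = g' x) \<Longrightarrow> sg_form f g = sg_form f' g'"
  unfolding sg_form_def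
  using sg_energy_cong[of "\<lambda>x. f x + g x" "\<lambda>x. f' x + g' x"] sg_energy_cong[of "\<lambda>x. f x - g x" "\<lambda>x. f' x - g' x"]
  by simp

lemma sg_F0_cong:
  assumes "\<And>x. x \<in> sg_K \<Longrightarrow> f x = g x" "f \<in> sg_F0"
  shows "g \<in> sg_F0"
  using assms sg_energy_cong[of f g] continuous_on_cong[of sg_K sg_K f g] sg_V0_subset_K
  by (auto simp: sg_F0_def sg_F_def subset_iff)

text \<open>A Riesz representative \<open>u\<close> of the integral functional exists. Its pairing
  with the kernel is \<open>u x\<close> on one side and the integral that defines
  \<open>sg_green f x\<close> on the other.\<close>

lemma sg_green:
  assumes f: "continuous_on sg_K f"
  shows "sg_green f \<in> sg_F0" "\<And>v. v \<in> sg_F0 \<Longrightarrow> sg_form (sg_green f) v = (\<integral>x\<in>sg_K. f x * v x \<partial>sg_m)"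
proof -
  obtain B where B: "B > 0" "\<And>x. x \<in> sg_K \<Longrightarrow> \<bar>f x\<bar> \<le> B"
    using bounded_continuous_sg_K[OF f] by metis
  have int: "set_integrable sg_m sg_K (\<lambda>x. f x * v x)" if "v \<in> sg_F0" for v
    by (intro set_integrable_continuous_sg_K continuous_intros f sg_F_continuous sg_F0_in_F that)
  have "\<exists>u\<in>sg_F0. \<forall>v\<in>sg_F0. sg_form u v = (\<integral>x\<in>sg_K. f x * v x \<partial>sg_m)"
  proof (rule sg_F0_riesz)
    show "\<bar>\<integral>x\<in>sg_K. f x * v x \<partial>sg_m\<bar> \<le> (B * 5) * sqrt (sg_En v)" if "v \<in> sg_F0" for v
    proof (rule sg_integral_abs_le)
      show "\<bar>f x * v x\<bar> \<le> (B * 5) * sqrt (sg_En v)" if "x \<in> sg_K" for x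
        unfolding abs_mult mult.assoc using B that \<open>v \<in> sg_F0\<close> by (intro mult_mono sg_F0_sup_bound) auto
    qed
    show "(\<integral>x\<in>sg_K. f x * (c * v x) \<partial>sg_m) = c * (\<integral>x\<in>sg_K. f x * v x \<partial>sg_m)" for c v
      by (simp add: mult.left_commute)
  qed (simp add: distrib_left int)
  then obtain u where u: "u \<in> sg_F0" "\<And>v. v \<in> sg_F0 \<Longrightarrow> sg_form u v = (\<integral>x\<in>sg_K. f x * v x \<partial>sg_m)"
    by blast
  have eq: "u x = sg_green f x" if x: "x \<in> sg_K" for x
    using u(2)[OF sg_point(1)[OF x]] sg_point[OF x] u(1)
    by (simp add: sg_green_def sg_form_commute[of u] sg_F0_in_F)
  show "sg_green f \<in> sg_F0"
    by (rule sg_F0_cong[OF eq u(1)])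
  show "sg_form (sg_green f) v = (\<integral>x\<in>sg_K. f x * v x \<partial>sg_m)" if "v \<in> sg_F0" for v
    using u(2)[OF that] sg_form_cong[of u "sg_green f" v v] eq by simp
qed

lemma sg_green_lap_witness: "continuous_on sg_K f \<Longrightarrow> sg_lap_witness (sg_green f) f"
  unfolding sg_lap_witness_F0 using sg_green(2) by blast

lemma sg_green_symmetric:
  assumes "continuous_on sg_K f" "continuous_on sg_K g"
  shows "(\<integral>x\<in>sg_K. f x * sg_green g x \<partial>sg_m) = (\<integral>x\<in>sg_K. g x * sg_green f x \<partial>sg_m)"
  using sg_green[OF assms(1)] sg_green[OF assms(2)]
    sg_form_commute[OF sg_F0_in_F sg_F0_in_F, of "sg_green f" "sg_green g"] by simp

text \<open>Testing the solution with itself bounds its energy by \<open>B\<close> times its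
  supremum, hence by 5 B times the root of the energy; dividing and squaring yields 25.\<close>

lemma sg_En_green_le:
  assumes f: "continuous_on sg_K f" and B: "\<And>x. x \<in> sg_K \<Longrightarrow> \<bar>f x\<bar> \<le> B"
  shows "sg_En (sg_green f) \<le> 25 * B\<^sup>2"
proof -
  define e where "e = sqrt (sg_En (sg_green f))"
  note G = sg_green[OF f]
  have B0: "0 \<le> B"
    using order_trans[OF abs_ge_zero B] sg_K_nonempty by blast
  have e: "0 \<le> e" "e\<^sup>2 = sg_En (sg_green f)"
    using sg_En_nonneg[of "sg_green f"] by (simp_all add: e_def)
  have "e\<^sup>2 = (\<integral>x\<in>sg_K. f x * sg_green f x \<partial>sg_m)"
    using G(2)[OF G(1)] sg_form_self[OF sg_F0_in_F[OF G(1)]] e by simp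
  also have "\<dots> \<le> B * (5 * e)"
  proof (rule order_trans[OF abs_ge_self sg_integral_abs_le])
    show "\<bar>f x * sg_green f x\<bar> \<le> B * (5 * e)" if "x \<in> sg_K" for x
      unfolding abs_mult e_def using B that B0 by (intro mult_mono sg_F0_sup_bound G(1)) auto
  qed
  finally have "e * e \<le> (5 * B) * e"
    by (simp add: power2_eq_square mult_ac)
  then have "e \<le> 5 * B"
    using e(1) B0 by (cases "e = 0") (auto simp: mult_le_cancel_right)
  then have "e\<^sup>2 \<le> (5 * B)\<^sup>2"
    using e(1) by (intro power_mono)
  then show ?thesis
    using e by (simp add: power_mult_distrib)
qed

section \<open>Integral calculus\<close>

text \<open>The square is a double integral, split into the halves r \<le> s and s < r, which are
  exchanged by Fubini. This serves as the chain rule for the square of a primitive that need not be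
  differentiable everywhere.\<close>

lemma integral_square_eq:
  fixes f :: "real \<Rightarrow> real"
  assumes f: "integrable lborel f"
  shows "integrable lborel (\<lambda>s. f s * (\<integral>r. (if r \<le> s then f r else 0) \<partial>lborel))"
    and "(\<integral>s. f s \<partial>lborel)\<^sup>2 = 2 * (\<integral>s. f s * (\<integral>r. (if r \<le> s then f r else 0) \<partial>lborel) \<partial>lborel)"
proof -
  have [measurable]: "f \<in> borel_measurable borel"
    using borel_measurable_integrable[OF f] by simp
  have int_if: "integrable lborel (\<lambda>r. if P r then f r else 0)" if [measurable]: "Measurable.pred borel P" for P
    by (rule Bochner_Integration.integrable_bound[OF f]) auto
  let ?W = "\<lambda>s. \<integral>r. (if r \<le> s then f r else 0) \<partial>lborel"
  let ?V = "\<lambda>s. \<integral>r. (if s < r then f r else 0) \<partial>lborel"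
  have bound: "\<bar>\<integral>r. (if P r then f r else 0) \<partial>lborel\<bar> \<le> (\<integral>r. \<bar>f r\<bar> \<partial>lborel)"
    if [measurable]: "Measurable.pred borel P" for P
    using f int_if[OF that] by (intro order_trans[OF integral_abs_bound] integral_mono) auto
  have int_mult: "integrable lborel (\<lambda>s. f s * g s)"
    if [measurable]: "g \<in> borel_measurable borel" and "\<And>s. \<bar>g s\<bar> \<le> (\<integral>r. \<bar>f r\<bar> \<partial>lborel)" for g
  proof (rule Bochner_Integration.integrable_bound)
    show "integrable lborel (\<lambda>s. (\<integral>r. \<bar>f r\<bar> \<partial>lborel) * f s)"
      using f by simp
    show "AE s in lborel. norm (f s * g s) \<le> norm ((\<integral>r. \<bar>f r\<bar> \<partial>lborel) * f s)"
      using that(2) order_trans[OF that(2) abs_ge_self] by (intro AE_I2) (simp add: abs_mult mult.commute mult_left_mono)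
  qed simp
  show W: "integrable lborel (\<lambda>s. f s * ?W s)"
    by (intro int_mult bound) measurable
  have V: "integrable lborel (\<lambda>s. f s * ?V s)"
    by (intro int_mult bound) measurable
  have "integrable (lborel \<Otimes>\<^sub>M lborel) (\<lambda>(s, r). if s < r then f s * f r else 0)"
  proof (rule lborel_pair.Fubini_integrable)
    have "integrable lborel (\<lambda>s. \<bar>f s\<bar> * (\<integral>r. (if s < r then \<bar>f r\<bar> else 0) \<partial>lborel))"
    proof (rule Bochner_Integration.integrable_bound)
      show "integrable lborel (\<lambda>s. (\<integral>r. \<bar>f r\<bar> \<partial>lborel) * f s)"
        using f by simp
      have "\<bar>\<integral>r. (if s < r then \<bar>f r\<bar> else 0) \<partial>lborel\<bar> \<le> \<bar>\<integral>r. \<bar>f r\<bar> \<partial>lborel\<bar>" for s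
        using f by (subst (1 2) abs_of_nonneg, simp, simp, intro integral_mono)
          (auto intro: Bochner_Integration.integrable_bound[OF f])
      then show "AE s in lborel. norm (\<bar>f s\<bar> * (\<integral>r. (if s < r then \<bar>f r\<bar> else 0) \<partial>lborel)) \<le> norm ((\<integral>r. \<bar>f r\<bar> \<partial>lborel) * f s)"
        by (intro AE_I2) (simp add: abs_mult mult.commute mult_left_mono)
    qed measurable
    also have "(\<lambda>s. \<bar>f s\<bar> * (\<integral>r. (if s < r then \<bar>f r\<bar> else 0) \<partial>lborel))
        = (\<lambda>s. \<integral>r. norm (case (s, r) of (s, r) \<Rightarrow> if s < r then f s * f r else 0) \<partial>lborel)"
    proof
      fix s
      have "\<bar>f s\<bar> * (\<integral>r. (if s < r then \<bar>f r\<bar> else 0) \<partial>lborel) = (\<integral>r. \<bar>f s\<bar> * (if s < r then \<bar>f r\<bar> else 0) \<partial>lborel)"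
        by (rule integral_mult_right_zero[symmetric])
      also have "\<dots> = (\<integral>r. norm (case (s, r) of (s, r) \<Rightarrow> if s < r then f s * f r else 0) \<partial>lborel)"
        by (intro Bochner_Integration.integral_cong) (auto simp: abs_mult)
      finally show "\<bar>f s\<bar> * (\<integral>r. (if s < r then \<bar>f r\<bar> else 0) \<partial>lborel)
          = (\<integral>r. norm (case (s, r) of (s, r) \<Rightarrow> if s < r then f s * f r else 0) \<partial>lborel)" .
    qed
    finally show "integrable lborel (\<lambda>s. \<integral>r. norm (case (s, r) of (s, r) \<Rightarrow> if s < r then f s * f r else 0) \<partial>lborel)" .
    show "AE s in lborel. integrable lborel (\<lambda>r. case (s, r) of (s, r) \<Rightarrow> if s < r then f s * f r else 0)"
    proof (rule AE_I2)
      fix s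
      show "integrable lborel (\<lambda>r. case (s, r) of (s, r) \<Rightarrow> if s < r then f s * f r else 0)"
        using integrable_mult_right[OF int_if[of "\<lambda>r. s < r"], of "f s"]
        by (simp add: if_distrib[of "(*) (f s)"] cong: if_cong)
    qed
  qed measurable
  then have swap: "(\<integral>r. (\<integral>s. (if s < r then f s * f r else 0) \<partial>lborel) \<partial>lborel)
      = (\<integral>s. (\<integral>r. (if s < r then f s * f r else 0) \<partial>lborel) \<partial>lborel)"
    by (rule lborel_pair.Fubini_integral)
  have "(\<integral>s. f s * ?V s \<partial>lborel) = (\<integral>s. (\<integral>r. (if s < r then f s * f r else 0) \<partial>lborel) \<partial>lborel)"
  proof (intro Bochner_Integration.integral_cong refl)
    fix s
    have "f s * ?V s = (\<integral>r. f s * (if s < r then f r else 0) \<partial>lborel)"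
      by (rule integral_mult_right_zero[symmetric])
    also have "\<dots> = (\<integral>r. (if s < r then f s * f r else 0) \<partial>lborel)"
      by (intro Bochner_Integration.integral_cong) auto
    finally show "f s * ?V s = (\<integral>r. (if s < r then f s * f r else 0) \<partial>lborel)" .
  qed
  also have "\<dots> = (\<integral>r. f r * ?W r \<partial>lborel)"
    unfolding swap[symmetric]
  proof (intro Bochner_Integration.integral_cong refl)
    fix r
    have "(\<integral>s. (if s < r then f s * f r else 0) \<partial>lborel) = (\<integral>s. f r * (if s \<le> r then f s else 0) \<partial>lborel)"
    proof (rule integral_cong_AE)
      \<comment> \<open>The two halves differ on the diagonal, a single point for each
        \<open>r\<close>.\<close>
      show "AE s in lborel. (if s < r then f s * f r else 0) = f r * (if s \<le> r then f s else 0)"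
        using AE_lborel_singleton[of r] by eventually_elim auto
    qed measurable
    then show "(\<integral>s. (if s < r then f s * f r else 0) \<partial>lborel) = f r * ?W r"
      by simp
  qed
  finally have VW: "(\<integral>s. f s * ?V s \<partial>lborel) = (\<integral>r. f r * ?W r \<partial>lborel)" .
  have split: "?W s + ?V s = (\<integral>r. f r \<partial>lborel)" for s
    by (subst Bochner_Integration.integral_add[symmetric]) (auto intro!: int_if Bochner_Integration.integral_cong)
  have "(\<integral>s. f s \<partial>lborel)\<^sup>2 = (\<integral>s. f s * (\<integral>r. f r \<partial>lborel) \<partial>lborel)"
    by (simp add: power2_eq_square)
  also have "\<dots> = (\<integral>s. f s * ?W s + f s * ?V s \<partial>lborel)"
  proof (intro Bochner_Integration.integral_cong refl)
    show "f s * (\<integral>r. f r \<partial>lborel) = f s * ?W s + f s * ?V s" for s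
      unfolding split[of s, symmetric] by (rule distrib_left)
  qed
  also have "\<dots> = 2 * (\<integral>s. f s * ?W s \<partial>lborel)"
    using Bochner_Integration.integral_add[OF W V] VW by simp
  finally show "(\<integral>s. f s \<partial>lborel)\<^sup>2 = 2 * (\<integral>s. f s * ?W s \<partial>lborel)" .
qed

lemma gronwall_AE_zero:
  fixes h :: "real \<Rightarrow> real"
  assumes h: "integrable lborel h" and nonneg: "\<And>s. 0 \<le> h s" and C: "0 \<le> C"
    and ineq: "AE t in lborel. t \<in> {0..T} \<longrightarrow> h t \<le> C * (\<integral>s. indicator {0..t} s * h s \<partial>lborel)"
  shows "AE t in lborel. t \<in> {0..T} \<longrightarrow> h t = 0"
proof -
  let ?H = "\<lambda>t. \<integral>s. indicator {0..t} s * h s \<partial>lborel"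
  define M where "M = (\<integral>s. h s \<partial>lborel)"
  have [measurable]: "h \<in> borel_measurable borel"
    using borel_measurable_integrable[OF h] by simp
  have int: "integrable lborel (\<lambda>s. indicator {0..t} s * h s)" for t
    by (rule Bochner_Integration.integrable_bound[OF h]) (auto simp: indicator_def)
  have bound: "?H t \<le> M * ((C * t) ^ n / fact n)" if "t \<in> {0..T}" for t n
    using that
  proof (induction n arbitrary: t)
    case 0
    have "?H t \<le> M"
      unfolding M_def using h int nonneg by (intro integral_mono) (auto simp: indicator_def)
    then show ?case
      by simp
  next
    case (Suc n)
    let ?c = "C * M * C ^ n / fact n"
    have pow: "integrable lborel (\<lambda>s. s ^ n * indicator {0..t} s :: real)"
      using borel_integrable_atLeastAtMost'[of 0 t "\<lambda>s. s ^ n"]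
      by (simp add: set_integrable_def mult.commute continuous_intros)
    have "?H t \<le> (\<integral>s. ?c * (s ^ n * indicator {0..t} s) \<partial>lborel)"
    proof (rule integral_mono_AE)
      show "AE s in lborel. indicator {0..t} s * h s \<le> ?c * (s ^ n * indicator {0..t} s)"
        using ineq
      proof eventually_elim
        case (elim s)
        show ?case
        proof (cases "s \<in> {0..t}")
          case True
          then have s: "s \<in> {0..T}"
            using Suc.prems by auto
          have "h s \<le> C * ?H s"
            using elim s by blast
          also have "\<dots> \<le> C * (M * ((C * s) ^ n / fact n))"
            using C Suc.IH[OF s] by (rule mult_left_mono[rotated])
          finally show ?thesis
            using True by (simp add: power_mult_distrib mult_ac)
        qed simp
      qed
    qed (use int pow in auto)
    also have "\<dots> = ?c * (t ^ Suc n / Suc n)"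
      using Suc.prems integral_power[of 0 t n] by simp
    also have "\<dots> = M * ((C * t) ^ Suc n / fact (Suc n))"
      by (simp add: power_mult_distrib mult_ac)
    finally show ?case .
  qed
  have "?H t \<le> 0" if t: "t \<in> {0..T}" for t
  proof (rule LIMSEQ_le_const)
    have "(\<lambda>n. (C * t) ^ n / fact n) \<longlonglongrightarrow> 0"
      using summable_LIMSEQ_zero[OF summable_exp[of "C * t"]] by (simp add: field_simps)
    then show "(\<lambda>n. M * ((C * t) ^ n / fact n)) \<longlonglongrightarrow> 0"
      by (rule tendsto_mult_right_zero)
  qed (use bound[OF t] in blast)
  then show ?thesis
    using ineq
  proof eventually_elim
    case (elim t)
    then have "h t \<le> 0" if "t \<in> {0..T}"
      using that C mult_nonneg_nonpos[of C "?H t"] \<open>\<And>t. t \<in> {0..T} \<Longrightarrow> ?H t \<le> 0\<close> by force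
    then show ?case
      using nonneg[of t] elim by (auto intro: antisym)
  qed
qed

lemma sg_integral_le:
  fixes f :: "pt \<Rightarrow> real"
  assumes "set_integrable sg_m sg_K f" "\<And>x. x \<in> sg_K \<Longrightarrow> f x \<le> B"
  shows "(\<integral>x\<in>sg_K. f x \<partial>sg_m) \<le> B"
proof -
  have "(\<integral>x\<in>sg_K. f x \<partial>sg_m) \<le> (\<integral>x. B \<partial>sg_m)"
    unfolding set_lebesgue_integral_def using assms AE_sg_m_in_K
    by (intro integral_mono_AE) (auto simp: set_integrable_def elim!: eventually_mono)
  then show ?thesis
    by (simp add: sg_m.prob_space[unfolded space_sg_m])
qed

text \<open>The last clause bounds the averages uniformly in \<open>n\<close> by any bound of
  \<open>g\<close>; it supplies the majorant when the limit is later taken under a time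
  integral.\<close>

lemma sg_mollifier:
  assumes x: "x \<in> sg_K"
  shows "\<exists>f :: nat \<Rightarrow> pt \<Rightarrow> real. (\<forall>n. continuous_on sg_K (f n)) \<and>
    (\<forall>g. continuous_on sg_K g \<longrightarrow> (\<lambda>n. \<integral>y\<in>sg_K. g y * f n y \<partial>sg_m) \<longlonglongrightarrow> g x) \<and>
    (\<forall>g n B. continuous_on sg_K g \<longrightarrow> (\<forall>y\<in>sg_K. \<bar>g y\<bar> \<le> B) \<longrightarrow> \<bar>\<integral>y\<in>sg_K. g y * f n y \<partial>sg_m\<bar> \<le> B)"
proof -
  \<comment> \<open>A tent of radius \<open>1 / Suc n\<close>; full support of the measure makes its
    integral positive, so it can be normalised.\<close>
  define k where "k n y = max 0 (1 - real (Suc n) * dist y x)" for n y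
  have k_cont: "continuous_on sg_K (k n)" for n
    unfolding k_def by (intro continuous_intros)
  have k_nonneg: "0 \<le> k n y" for n y
    by (simp add: k_def)
  define c where "c n = (\<integral>y\<in>sg_K. k n y \<partial>sg_m)" for n
  have c: "c n > 0" for n
    unfolding c_def by (rule sg_integral_pos[OF k_cont k_nonneg x]) (simp add: k_def)
  define f where "f n y = k n y / c n" for n y
  have f_cont: "continuous_on sg_K (f n)" for n
    unfolding f_def using c[of n] by (intro continuous_intros k_cont) simp
  have f_nonneg: "0 \<le> f n y" for n y
    unfolding f_def using k_nonneg c[of n] by simp
  have f_one: "(\<integral>y\<in>sg_K. f n y \<partial>sg_m) = 1" for n
    unfolding f_def using c[of n] by (simp add: c_def[symmetric])
  have int: "set_integrable sg_m sg_K (\<lambda>y. g y * f n y)" if "continuous_on sg_K g" for g n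
    by (intro set_integrable_continuous_sg_K continuous_intros f_cont that)
  have upper: "(\<integral>y\<in>sg_K. g y * f n y \<partial>sg_m) \<le> B"
    if g: "continuous_on sg_K g" and B: "\<And>y. y \<in> sg_K \<Longrightarrow> f n y \<noteq> 0 \<Longrightarrow> g y \<le> B" for g n B
  proof -
    have "(\<integral>y\<in>sg_K. g y * f n y \<partial>sg_m) \<le> (\<integral>y\<in>sg_K. B * f n y \<partial>sg_m)"
    proof (rule set_integral_mono)
      show "g y * f n y \<le> B * f n y" if "y \<in> sg_K" for y
        using B[OF that] f_nonneg[of n y] by (cases "f n y = 0") (auto intro: mult_right_mono)
    qed (intro int g continuous_intros)+
    then show ?thesis
      using f_one by simp
  qed
  have abs_bound: "\<bar>\<integral>y\<in>sg_K. g y * f n y \<partial>sg_m\<bar> \<le> B"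
    if g: "continuous_on sg_K g" and B: "\<And>y. y \<in> sg_K \<Longrightarrow> f n y \<noteq> 0 \<Longrightarrow> \<bar>g y\<bar> \<le> B" for g n B
  proof -
    have "(\<integral>y\<in>sg_K. g y * f n y \<partial>sg_m) \<le> B"
      using B by (intro upper g) (auto dest: abs_le_D1)
    moreover have "(\<integral>y\<in>sg_K. (- g y) * f n y \<partial>sg_m) \<le> B"
      using B by (intro upper continuous_intros g) (auto dest: abs_le_D2)
    then have "- (\<integral>y\<in>sg_K. g y * f n y \<partial>sg_m) \<le> B"
      by (simp add: set_lebesgue_integral_def)
    ultimately show ?thesis
      by (rule abs_leI)
  qed
  have conv: "(\<lambda>n. \<integral>y\<in>sg_K. g y * f n y \<partial>sg_m) \<longlonglongrightarrow> g x" if g: "continuous_on sg_K g" for g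
  proof (rule LIMSEQ_I)
    fix e :: real assume e: "e > 0"
    obtain d where d: "d > 0" "\<And>y. y \<in> sg_K \<Longrightarrow> dist y x < d \<Longrightarrow> dist (g y) (g x) < e / 2"
      using g x e unfolding continuous_on_iff by (metis half_gt_zero)
    obtain N where N: "1 / d < real N"
      using reals_Archimedean2 by blast
    have "norm ((\<integral>y\<in>sg_K. g y * f n y \<partial>sg_m) - g x) < e" if n: "n \<ge> N" for n
    proof -
      have "(\<integral>y\<in>sg_K. g y * f n y \<partial>sg_m) - g x = (\<integral>y\<in>sg_K. (g y - g x) * f n y \<partial>sg_m)"
        using f_one[of n] int[OF g, of n] int[OF continuous_on_const, of "g x" n] by (simp add: left_diff_distrib)
      also have "\<bar>\<dots>\<bar> \<le> e / 2"
      proof (rule abs_bound)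
        fix y assume y: "y \<in> sg_K" "f n y \<noteq> 0"
        then have "real (Suc n) * dist y x < 1"
          by (auto simp: f_def k_def max_def split: if_splits)
        moreover have "1 < real (Suc n) * d"
        proof -
          have "1 < real N * d"
            using N d(1) by (simp add: field_simps)
          also have "\<dots> \<le> real (Suc n) * d"
            using n d(1) by (intro mult_right_mono) auto
          finally show ?thesis .
        qed
        ultimately have "real (Suc n) * dist y x < real (Suc n) * d"
          by linarith
        then have "dist y x < d"
          by (rule mult_left_less_imp_less) simp
        then show "\<bar>g y - g x\<bar> \<le> e / 2"
          using d(2)[OF y(1)] by (simp add: dist_real_def)
      qed (intro continuous_intros g)
      finally show ?thesis
        using e by simp
    qed
    then show "\<exists>N. \<forall>n\<ge>N. norm ((\<integral>y\<in>sg_K. g y * f n y \<partial>sg_m) - g x) < e"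
      by blast
  qed
  show ?thesis
    by (intro exI[of _ f] conjI allI impI) (simp_all add: f_cont conv abs_bound)
qed

section \<open>The energy estimate\<close>

lemma sg_En_add_le:
  assumes "f \<in> sg_F" "g \<in> sg_F"
  shows "sg_En (\<lambda>x. f x + g x) \<le> 2 * sg_En f + 2 * sg_En g"
  using sg_En_add[OF assms] sg_En_diff[OF assms] sg_En_nonneg[of "\<lambda>x. f x - g x"] by simp

lemma borel_measurable_sg_EN [measurable]:
  assumes "\<And>x. x \<in> sg_K \<Longrightarrow> (\<lambda>s. f s x) \<in> borel_measurable M" "\<And>x. x \<in> sg_K \<Longrightarrow> (\<lambda>s. g s x) \<in> borel_measurable M"
  shows "(\<lambda>s. sg_EN2 N (f s) (g s)) \<in> borel_measurable M"
  unfolding sg_EN2_def split_beta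
  by (intro borel_measurable_times borel_measurable_const borel_measurable_sum borel_measurable_diff assms)
    (metis prod.collapse sg_pairs_in_K)+

lemma sg_pair_integral_measurable:
  fixes h :: "real \<Rightarrow> pt \<Rightarrow> real" and g :: "pt \<Rightarrow> real"
  assumes h: "(\<lambda>(s, x). h s x) \<in> borel_measurable (lborel \<Otimes>\<^sub>M sg_m)" and g: "continuous_on sg_K g"
  shows "(\<lambda>s. \<integral>x\<in>sg_K. h s x * g x \<partial>sg_m) \<in> borel_measurable borel"
proof -
  have [measurable]: "(\<lambda>x. indicator sg_K x *\<^sub>R g x) \<in> borel_measurable sg_m"
    using set_borel_measurable_continuous_sg_K[OF g] by (simp add: set_borel_measurable_def)
  note h[measurable]
  have "(\<lambda>s. \<integral>x. h s x * (indicator sg_K x *\<^sub>R g x) \<partial>sg_m) \<in> borel_measurable lborel"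
    by measurable
  then show ?thesis
    by (simp add: set_lebesgue_integral_def mult_ac)
qed

text \<open>\<open>d\<close> is the difference of two solutions, \<open>p\<close> that of their reaction terms, and \<open>q\<close> an
  integrable majorant of the square root of the energy of \<open>d\<close>.\<close>

locale sg_linear_solution =
  fixes T L :: real and d p :: "real \<Rightarrow> pt \<Rightarrow> real" and q :: "real \<Rightarrow> real"
  assumes L: "0 \<le> L"
    and d_measurable [measurable]: "(\<lambda>(s, x). d s x) \<in> borel_measurable (lborel \<Otimes>\<^sub>M sg_m)"
    and p_measurable [measurable]: "(\<lambda>(s, x). p s x) \<in> borel_measurable (lborel \<Otimes>\<^sub>M sg_m)"
    and q_nonneg: "\<And>s. 0 \<le> q s"
    and q_integrable: "integrable lborel q"
    and q_square_integrable: "integrable lborel (\<lambda>s. (q s)\<^sup>2)"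
    and regular: "AE s in lborel. d s \<in> sg_F0 \<and> sg_En (d s) \<le> (q s)\<^sup>2 \<and> continuous_on sg_K (p s) \<and>
      (\<forall>x\<in>sg_K. \<bar>p s x\<bar> \<le> L * \<bar>d s x\<bar>)"
    and weak: "AE t in lborel. t \<in> {0..T} \<longrightarrow> (\<forall>f. continuous_on sg_K f \<longrightarrow>
      (\<integral>x\<in>sg_K. d t x * sg_green f x \<partial>sg_m) = (\<integral>s. indicator {0..t} s *
        ((\<integral>x\<in>sg_K. p s x * sg_green f x \<partial>sg_m) - 2/3 * (\<integral>x\<in>sg_K. d s x * f x \<partial>sg_m)) \<partial>lborel))"
begin

lemma borel_q [measurable]: "q \<in> borel_measurable borel"
  using borel_measurable_integrable[OF q_integrable] by simp

text \<open>Collects the pointwise facts valid at almost every time, so that the estimates below are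
  plain statements about one such \<open>s\<close>.\<close>

definition regular_time :: "real \<Rightarrow> bool" where
  "regular_time s \<longleftrightarrow> d s \<in> sg_F0 \<and> sg_En (d s) \<le> (q s)\<^sup>2 \<and> continuous_on sg_K (p s) \<and>
      (\<forall>x\<in>sg_K. \<bar>p s x\<bar> \<le> L * \<bar>d s x\<bar>)"

definition Y :: "real \<Rightarrow> pt \<Rightarrow> real" where
  "Y s = sg_green (d s)"

definition Z :: "real \<Rightarrow> pt \<Rightarrow> real" where
  "Z s x = sg_green (p s) x - 2/3 * d s x"

lemma AE_regular_time: "AE s in lborel. regular_time s"
  using regular unfolding regular_time_def .

lemma d_section [measurable]: "(\<lambda>s. d s x) \<in> borel_measurable borel"
  using measurable_compose[OF measurable_Pair2'[of x sg_m lborel] d_measurable] by simp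

text \<open>The kernel turns this into a parameter integral of the jointly measurable
  \<open>d\<close>, with no function-space valued map to discuss.\<close>

lemma Y_section: "x \<in> sg_K \<Longrightarrow> (\<lambda>s. Y s x) \<in> borel_measurable borel"
  unfolding Y_def sg_green_def
  by (intro sg_pair_integral_measurable d_measurable sg_F_continuous sg_F0_in_F sg_point)

lemma Z_section: "x \<in> sg_K \<Longrightarrow> (\<lambda>s. Z s x) \<in> borel_measurable borel"
  unfolding Z_def sg_green_def
  by (intro borel_measurable_diff borel_measurable_times borel_measurable_const d_section
      sg_pair_integral_measurable p_measurable sg_F_continuous sg_F0_in_F sg_point)

context
  fixes s assumes s: "regular_time s"
begin

lemma d_F0: "d s \<in> sg_F0"
  using s by (simp add: regular_time_def)

lemma d_continuous: "continuous_on sg_K (d s)"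
  by (intro sg_F_continuous sg_F0_in_F d_F0)

lemma p_continuous: "continuous_on sg_K (p s)"
  using s by (simp add: regular_time_def)

lemma d_bound:
  assumes "x \<in> sg_K"
  shows "\<bar>d s x\<bar> \<le> 5 * q s"
proof -
  have "sqrt (sg_En (d s)) \<le> q s"
    using s q_nonneg by (intro real_le_lsqrt) (auto simp: regular_time_def)
  then show ?thesis
    using sg_F0_sup_bound[OF d_F0 assms] by simp
qed

lemma p_le_d: "x \<in> sg_K \<Longrightarrow> \<bar>p s x\<bar> \<le> L * \<bar>d s x\<bar>"
  using s by (simp add: regular_time_def)

lemma p_bound: "x \<in> sg_K \<Longrightarrow> \<bar>p s x\<bar> \<le> 5 * L * q s"
  using p_le_d mult_left_mono[OF d_bound L, of x] by fastforce

lemma Y_F0: "Y s \<in> sg_F0"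
  unfolding Y_def by (rule sg_green(1)[OF d_continuous])

lemma Z_F0: "Z s \<in> sg_F0"
  unfolding Z_def by (intro sg_F0_diff sg_F0_scale d_F0 sg_green(1) p_continuous)

lemma En_green_p: "sg_En (sg_green (p s)) \<le> 625 * L\<^sup>2 * (q s)\<^sup>2"
  using sg_En_green_le[OF p_continuous p_bound] by (simp add: power_mult_distrib)

lemma En_Y: "sg_En (Y s) \<le> 625 * (q s)\<^sup>2"
  unfolding Y_def using sg_En_green_le[OF d_continuous d_bound] by (simp add: power_mult_distrib)

text \<open>From E(f + g) \<le> 2 E(f) + 2 E(g): 1250 is twice 625, and 2 (2/3)^2 = 8/9 is rounded
  up to 1.\<close>

lemma En_Z: "sg_En (Z s) \<le> (1250 * L\<^sup>2 + 1) * (q s)\<^sup>2"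
proof -
  have "sg_En (Z s) = sg_En (\<lambda>x. sg_green (p s) x + (- 2/3) * d s x)"
    by (rule arg_cong[where f = sg_En]) (simp add: Z_def fun_eq_iff)
  also have "\<dots> \<le> 2 * sg_En (sg_green (p s)) + 2 * sg_En (\<lambda>x. (- 2/3) * d s x)"
    by (intro sg_En_add_le sg_F_scale sg_F0_in_F d_F0 sg_green(1) p_continuous)
  also have "sg_En (\<lambda>x. (- 2/3) * d s x) = (- 2/3)\<^sup>2 * sg_En (d s)"
    by (intro sg_En_scale sg_F0_in_F d_F0)
  also have "2 * sg_En (sg_green (p s)) + 2 * ((- 2/3)\<^sup>2 * sg_En (d s)) \<le> 2 * (625 * L\<^sup>2 * (q s)\<^sup>2) + 1 * (q s)\<^sup>2"
  proof (intro add_mono mult_left_mono En_green_p)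
    show "2 * ((- 2/3)\<^sup>2 * sg_En (d s)) \<le> 1 * (q s)\<^sup>2"
      using s sg_En_nonneg[of "d s"] by (simp add: regular_time_def power2_eq_square)
  qed simp
  finally show ?thesis
    by (simp add: distrib_right)
qed

text \<open>The root of the Green energy is at most 25 L q, which the supremum bound multiplies by
  5; and (2/3) 5 = 10/3 is rounded up to 4.\<close>

lemma Z_bound:
  assumes x: "x \<in> sg_K"
  shows "\<bar>Z s x\<bar> \<le> (125 * L + 4) * q s"
proof -
  have "sqrt (sg_En (sg_green (p s))) \<le> sqrt ((25 * L * q s)\<^sup>2)"
    using En_green_p by (intro real_sqrt_le_mono) (simp add: power_mult_distrib)
  also have "\<dots> = 25 * L * q s"
    using L q_nonneg by simp
  finally have "\<bar>sg_green (p s) x\<bar> \<le> 125 * L * q s"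
    using sg_F0_sup_bound[OF sg_green(1)[OF p_continuous] x] by simp
  moreover have "\<bar>2/3 * d s x\<bar> \<le> 4 * q s"
    using d_bound[OF x] q_nonneg[of s] by (simp add: abs_mult)
  ultimately show ?thesis
    unfolding Z_def using abs_triangle_ineq4[of "sg_green (p s) x" "2/3 * d s x"] by (simp add: distrib_right)
qed

text \<open>Since \<open>Y\<close> solves the Green problem for \<open>d\<close>, the form is
  \<integral> d Z dm, and symmetry moves the Green operator from \<open>p\<close> to
  \<open>d\<close>. The resulting product of \<open>p\<close> and \<open>Y\<close> is absorbed
  pointwise by the negative square of \<open>d\<close>.\<close>

lemma form_Z_Y_le: "2 * sg_form (Z s) (Y s) \<le> 19 * L\<^sup>2 * sg_En (Y s)"
proof -
  note cont = d_continuous p_continuous sg_F_continuous[OF sg_F0_in_F[OF Y_F0]]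
    sg_F_continuous[OF sg_F0_in_F[OF sg_green(1)[OF p_continuous]]]
  note int = set_integrable_continuous_sg_K
  have "sg_form (Z s) (Y s) = sg_form (Y s) (Z s)"
    by (intro sg_form_commute sg_F0_in_F Y_F0 Z_F0)
  also have "\<dots> = (\<integral>x\<in>sg_K. d s x * Z s x \<partial>sg_m)"
    unfolding Y_def by (rule sg_green(2)[OF d_continuous Z_F0])
  also have "\<dots> = (\<integral>x\<in>sg_K. d s x * sg_green (p s) x - 2/3 * (d s x)\<^sup>2 \<partial>sg_m)"
    by (simp add: Z_def right_diff_distrib power2_eq_square mult.left_commute)
  also have "\<dots> = (\<integral>x\<in>sg_K. d s x * sg_green (p s) x \<partial>sg_m) - (\<integral>x\<in>sg_K. 2/3 * (d s x)\<^sup>2 \<partial>sg_m)"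
    by (intro set_integral_diff(2) int continuous_intros cont)
  also have "(\<integral>x\<in>sg_K. d s x * sg_green (p s) x \<partial>sg_m) = (\<integral>x\<in>sg_K. p s x * Y s x \<partial>sg_m)"
    unfolding Y_def by (rule sg_green_symmetric[OF d_continuous p_continuous])
  also have "\<dots> - (\<integral>x\<in>sg_K. 2/3 * (d s x)\<^sup>2 \<partial>sg_m) = (\<integral>x\<in>sg_K. p s x * Y s x - 2/3 * (d s x)\<^sup>2 \<partial>sg_m)"
    by (intro set_integral_diff(2)[symmetric] int continuous_intros cont)
  also have "\<dots> \<le> 19/2 * L\<^sup>2 * sg_En (Y s)"
  proof (rule sg_integral_le)
    show "set_integrable sg_m sg_K (\<lambda>x. p s x * Y s x - 2/3 * (d s x)\<^sup>2)"
      by (intro int continuous_intros cont)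
    show "p s x * Y s x - 2/3 * (d s x)\<^sup>2 \<le> 19/2 * L\<^sup>2 * sg_En (Y s)" if x: "x \<in> sg_K" for x
    proof -
      have "p s x * Y s x \<le> (L * \<bar>d s x\<bar>) * \<bar>Y s x\<bar>"
        by (rule order_trans[OF abs_ge_self]) (simp add: abs_mult p_le_d[OF x] mult_right_mono)
      \<comment> \<open>This is 3/2 times the nonnegativity of the square below, weighted so that
        the coefficient of \<open>(d s x)\<^sup>2\<close> is exactly 2/3.\<close>
      also have "\<dots> \<le> 2/3 * (d s x)\<^sup>2 + 3/8 * L\<^sup>2 * (Y s x)\<^sup>2"
        using zero_le_power2[of "2/3 * \<bar>d s x\<bar> - 1/2 * (L * \<bar>Y s x\<bar>)"]
        by (simp add: power2_diff power_mult_distrib power2_abs field_simps)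
      also have "3/8 * L\<^sup>2 * (Y s x)\<^sup>2 \<le> 3/8 * L\<^sup>2 * (25 * sg_En (Y s))"
        by (intro mult_left_mono sg_F0_square_bound Y_F0 x) simp
      \<comment> \<open>Here 3/8 times 25 is 9.375, rounded up to 19/2.\<close>
      also have "\<dots> \<le> 19/2 * L\<^sup>2 * sg_En (Y s)"
        using sg_En_nonneg[of "Y s"] by (simp add: mult_right_mono)
      finally show ?thesis
        by simp
    qed
  qed
  finally show ?thesis
    by simp
qed

end

text \<open>\<open>Z\<close> is the time derivative of \<open>Y\<close>: test with the Green potentials of an approximate identity at \<open>x\<close>.\<close>

lemma AE_Y_eq_integral:
  "AE t in lborel. t \<in> {0..T} \<longrightarrow> (\<forall>x\<in>sg_K. Y t x = (\<integral>s. indicator {0..t} s * Z s x \<partial>lborel))"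
  using weak AE_regular_time
proof eventually_elim
  case (elim t)
  show ?case
  proof (intro impI ballI)
    fix x assume t: "t \<in> {0..T}" and x: "x \<in> sg_K"
    obtain f :: "nat \<Rightarrow> pt \<Rightarrow> real" where *: "(\<forall>n. continuous_on sg_K (f n)) \<and>
      (\<forall>g. continuous_on sg_K g \<longrightarrow> (\<lambda>n. \<integral>y\<in>sg_K. g y * f n y \<partial>sg_m) \<longlonglongrightarrow> g x) \<and>
      (\<forall>g n B. continuous_on sg_K g \<longrightarrow> (\<forall>y\<in>sg_K. \<bar>g y\<bar> \<le> B) \<longrightarrow> \<bar>\<integral>y\<in>sg_K. g y * f n y \<partial>sg_m\<bar> \<le> B)"
      using sg_mollifier[OF x] by (rule exE)
    have f: "continuous_on sg_K (f n)" for n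
      using * by simp
    have f_lim: "(\<lambda>n. \<integral>y\<in>sg_K. g y * f n y \<partial>sg_m) \<longlonglongrightarrow> g x" if "continuous_on sg_K g" for g
      using * that by simp
    have f_bound: "\<bar>\<integral>y\<in>sg_K. g y * f n y \<partial>sg_m\<bar> \<le> B"
      if "continuous_on sg_K g" "\<And>y. y \<in> sg_K \<Longrightarrow> \<bar>g y\<bar> \<le> B" for g n B
      using * that by simp
    define k where "k n s = (\<integral>x\<in>sg_K. p s x * sg_green (f n) x \<partial>sg_m) - 2/3 * (\<integral>x\<in>sg_K. d s x * f n x \<partial>sg_m)" for n s
    have [measurable]: "k n \<in> borel_measurable borel" for n
      unfolding k_def
      by (intro borel_measurable_diff borel_measurable_times borel_measurable_const sg_pair_integral_measurable
          p_measurable d_measurable f sg_F_continuous sg_F0_in_F sg_green(1))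
    note [measurable] = Z_section[OF x]
    \<comment> \<open>Symmetry moves the Green operator from the mollifier to \<open>p s\<close>, so
      \<open>k n s\<close> is an average of \<open>Z s\<close> near \<open>x\<close>: it converges
      to \<open>Z s x\<close> and inherits the bound on \<open>Z s\<close>.\<close>
    have k_eq: "k n s = (\<integral>y\<in>sg_K. Z s y * f n y \<partial>sg_m)" and Z_cont: "continuous_on sg_K (Z s)"
      if s: "regular_time s" for n s
    proof -
      note cont = f d_continuous[OF s] p_continuous[OF s] sg_F_continuous[OF sg_F0_in_F[OF sg_green(1)[OF p_continuous[OF s]]]]
      show "continuous_on sg_K (Z s)"
        by (intro sg_F_continuous sg_F0_in_F Z_F0 s)
      have "(\<integral>y\<in>sg_K. Z s y * f n y \<partial>sg_m) = (\<integral>y\<in>sg_K. f n y * sg_green (p s) y - 2/3 * (d s y * f n y) \<partial>sg_m)"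
        by (simp add: Z_def algebra_simps)
      also have "\<dots> = (\<integral>y\<in>sg_K. f n y * sg_green (p s) y \<partial>sg_m) - (\<integral>y\<in>sg_K. 2/3 * (d s y * f n y) \<partial>sg_m)"
        by (intro set_integral_diff(2) set_integrable_continuous_sg_K continuous_intros cont)
      also have "(\<integral>y\<in>sg_K. f n y * sg_green (p s) y \<partial>sg_m) = (\<integral>y\<in>sg_K. p s y * sg_green (f n) y \<partial>sg_m)"
        by (rule sg_green_symmetric[OF f p_continuous[OF s]])
      finally show "k n s = (\<integral>y\<in>sg_K. Z s y * f n y \<partial>sg_m)"
        by (simp add: k_def)
    qed
    have "(\<lambda>n. \<integral>s. indicator {0..t} s * k n s \<partial>lborel) \<longlonglongrightarrow> (\<integral>s. indicator {0..t} s * Z s x \<partial>lborel)"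
    proof (rule integral_dominated_convergence)
      show "integrable lborel (\<lambda>s. (125 * L + 4) * q s)"
        using q_integrable by simp
      show "AE s in lborel. (\<lambda>n. indicator {0..t} s * k n s) \<longlonglongrightarrow> indicator {0..t} s * Z s x"
        using AE_regular_time
        by eventually_elim (intro tendsto_intros, simp add: k_eq f_lim Z_cont)
      show "AE s in lborel. norm (indicator {0..t} s * k n s) \<le> (125 * L + 4) * q s" for n
        using AE_regular_time
      proof eventually_elim
        case (elim s)
        have "\<bar>k n s\<bar> \<le> (125 * L + 4) * q s"
          unfolding k_eq[OF elim] by (intro f_bound Z_cont elim Z_bound)
        then show ?case
          using L q_nonneg[of s] by (auto simp: indicator_def)
      qed
    qed measurable
    moreover have "(\<integral>s. indicator {0..t} s * k n s \<partial>lborel) = (\<integral>y\<in>sg_K. Y t y * f n y \<partial>sg_m)" for n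
    proof -
      have "(\<integral>y\<in>sg_K. d t y * sg_green (f n) y \<partial>sg_m) = (\<integral>s. indicator {0..t} s * k n s \<partial>lborel)"
        unfolding k_def using elim(1) t f by blast
      moreover have "(\<integral>y\<in>sg_K. d t y * sg_green (f n) y \<partial>sg_m) = (\<integral>y\<in>sg_K. f n y * Y t y \<partial>sg_m)"
        unfolding Y_def by (rule sg_green_symmetric[OF d_continuous[OF elim(2)] f])
      ultimately show ?thesis
        by (simp add: mult.commute)
    qed
    moreover have "(\<lambda>n. \<integral>y\<in>sg_K. Y t y * f n y \<partial>sg_m) \<longlonglongrightarrow> Y t x"
      by (intro f_lim sg_F_continuous sg_F0_in_F Y_F0 elim)
    ultimately show "Y t x = (\<integral>s. indicator {0..t} s * Z s x \<partial>lborel)"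
      using LIMSEQ_unique by simp
  qed
qed

section \<open>A chain rule for the energy in time\<close>

definition time_represented :: "real \<Rightarrow> bool" where
  "time_represented t \<longleftrightarrow> (\<forall>x\<in>sg_K. Y t x = (\<integral>s. indicator {0..t} s * Z s x \<partial>lborel))"

text \<open>The edge increment of \<open>Y\<close> is the primitive of that of \<open>Z\<close>, so
  its square is twice the integral of their product. The inner primitive is recognised as an
  increment of \<open>Y\<close> at almost every \<open>s\<close>, which is enough under the outer
  integral.\<close>

lemma increment_square:
  assumes t: "t \<in> {0..T}" "time_represented t" and xy: "x \<in> sg_K" "y \<in> sg_K"
  defines "g \<equiv> \<lambda>s. indicator {0..t} s * ((Z s y - Z s x) * (Y s y - Y s x))"
  shows "integrable lborel g" "(Y t y - Y t x) * (Y t y - Y t x) = (\<integral>s. 2 * g s \<partial>lborel)"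
proof -
  note [measurable] = Z_section[OF xy(1)] Z_section[OF xy(2)] Y_section[OF xy(1)] Y_section[OF xy(2)]
  have int_Z: "integrable lborel (\<lambda>s. indicator {0..r} s * Z s z)"
    if z: "z \<in> sg_K" for r z
  proof (rule Bochner_Integration.integrable_bound)
    show "integrable lborel (\<lambda>s. (125 * L + 4) * q s)"
      using q_integrable by simp
    show "AE s in lborel. norm (indicator {0..r} s * Z s z) \<le> norm ((125 * L + 4) * q s)"
      using AE_regular_time
    proof eventually_elim
      case (elim s)
      then show ?case
        using Z_bound[OF elim z] by (auto simp: indicator_def)
    qed
    show "(\<lambda>s. indicator {0..r} s * Z s z) \<in> borel_measurable lborel"
      using Z_section[OF z] by measurable
  qed
  define f where "f s = indicator {0..t} s * (Z s y - Z s x)" for s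
  have f: "integrable lborel f"
    unfolding f_def right_diff_distrib by (intro Bochner_Integration.integrable_diff int_Z xy)
  have increment: "(\<integral>s. indicator {0..r} s * (Z s y - Z s x) \<partial>lborel) = Y r y - Y r x" if "time_represented r" for r
    using that xy unfolding right_diff_distrib
    by (simp add: time_represented_def Bochner_Integration.integral_diff int_Z)
  have f_g: "AE s in lborel. f s * (\<integral>r. (if r \<le> s then f r else 0) \<partial>lborel) = g s"
    using AE_Y_eq_integral
  proof eventually_elim
    case (elim s)
    show ?case
    proof (cases "s \<in> {0..t}")
      case True
      then have "(\<integral>r. (if r \<le> s then f r else 0) \<partial>lborel) = (\<integral>r. indicator {0..s} r * (Z r y - Z r x) \<partial>lborel)"
        by (intro Bochner_Integration.integral_cong) (auto simp: f_def indicator_def)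
      also have "\<dots> = Y s y - Y s x"
        using True t elim by (intro increment) (auto simp: time_represented_def)
      finally show ?thesis
        by (simp add: f_def g_def)
    qed (simp add: f_def g_def)
  qed
  have [measurable]: "g \<in> borel_measurable lborel" "f \<in> borel_measurable lborel"
    unfolding g_def f_def by measurable
  show g: "integrable lborel g"
    by (rule integrable_cong_AE_imp[OF integral_square_eq(1)[OF f] _ f_g]) simp
  have "(Y t y - Y t x) * (Y t y - Y t x) = (\<integral>s. f s \<partial>lborel)\<^sup>2"
    using increment[OF t(2)] by (simp add: f_def power2_eq_square)
  also have "\<dots> = 2 * (\<integral>s. g s \<partial>lborel)"
    unfolding integral_square_eq(2)[OF f]
    by (intro arg_cong2[where f = "(*)"] refl integral_cong_AE f_g borel_measurable_integrable g integral_square_eq(1)[OF f])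
  finally show "(Y t y - Y t x) * (Y t y - Y t x) = (\<integral>s. 2 * g s \<partial>lborel)"
    by simp
qed

lemma EN_Y_eq_integral:
  assumes t: "t \<in> {0..T}" "time_represented t"
  shows "sg_EN N (Y t) = (\<integral>s. indicator {0..t} s * (2 * sg_EN2 N (Z s) (Y s)) \<partial>lborel)"
proof -
  let ?g = "\<lambda>z s. indicator {0..t} s * ((Z s (snd z) - Z s (fst z)) * (Y s (snd z) - Y s (fst z)))"
  have pK: "fst z \<in> sg_K" "snd z \<in> sg_K" if "z \<in> sg_pairs N" for z
    using sg_pairs_in_K[of "fst z" "snd z" N] that by auto
  have "sg_EN N (Y t) = 1/2 * (5/3) ^ N * (\<Sum>z\<in>sg_pairs N. (Y t (snd z) - Y t (fst z)) * (Y t (snd z) - Y t (fst z)))"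
    by (simp add: sg_EN_eq_EN2 sg_EN2_def split_beta)
  also have "(\<Sum>z\<in>sg_pairs N. (Y t (snd z) - Y t (fst z)) * (Y t (snd z) - Y t (fst z))) = (\<Sum>z\<in>sg_pairs N. \<integral>s. 2 * ?g z s \<partial>lborel)"
    by (intro sum.cong refl increment_square(2)[OF t] pK)
  also have "\<dots> = (\<integral>s. (\<Sum>z\<in>sg_pairs N. 2 * ?g z s) \<partial>lborel)"
    by (intro Bochner_Integration.integral_sum[symmetric] integrable_mult_right increment_square(1)[OF t] pK)
  also have "1/2 * (5/3) ^ N * \<dots> = (\<integral>s. 1/2 * (5/3) ^ N * (\<Sum>z\<in>sg_pairs N. 2 * ?g z s) \<partial>lborel)"
    by simp
  also have "\<dots> = (\<integral>s. indicator {0..t} s * (2 * sg_EN2 N (Z s) (Y s)) \<partial>lborel)"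
    by (intro Bochner_Integration.integral_cong) (auto simp: sg_EN2_def split_beta sum_distrib_left mult_ac)
  finally show ?thesis .
qed

text \<open>Limit and absolute value make this measurable and nonnegative at every time, exceptional
  ones included; at regular times in [0, T] it is the energy of \<open>Y\<close>.\<close>

definition E :: "real \<Rightarrow> real" where
  "E s = indicator {0..T} s * \<bar>lim (\<lambda>N. sg_EN N (Y s))\<bar>"

lemma E_measurable [measurable]: "E \<in> borel_measurable borel"
  unfolding E_def sg_EN_eq_EN2 using Y_section by measurable

lemma E_eq: "regular_time s \<Longrightarrow> s \<in> {0..T} \<Longrightarrow> E s = sg_En (Y s)"
  unfolding E_def using limI[OF sg_En_LIMSEQ[OF sg_F0_in_F[OF Y_F0]]] sg_En_nonneg by simp

lemma E_nonneg: "0 \<le> E s"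
  by (simp add: E_def)

lemma E_integrable: "integrable lborel E"
proof (rule Bochner_Integration.integrable_bound)
  show "integrable lborel (\<lambda>s. 625 * (q s)\<^sup>2)"
    using q_square_integrable by simp
  show "AE s in lborel. norm (E s) \<le> norm (625 * (q s)\<^sup>2)"
    using AE_regular_time
  proof eventually_elim
    case (elim s)
    then show ?case
      using E_eq[OF elim] En_Y[OF elim] E_nonneg[of s] by (cases "s \<in> {0..T}") (auto simp: E_def)
  qed
qed measurable

text \<open>The integral identity holds at every graph level, and twice the mixed form is at most
  the sum of both energies. This gives a majorant independent of the level, with 626 = 1 + 625 from
  the bounds on \<open>Z\<close> and \<open>Y\<close>.\<close>

lemma E_le_integral:
  assumes t: "t \<in> {0..T}" "time_represented t" "regular_time t"
  shows "E t \<le> 19 * L\<^sup>2 * (\<integral>s. indicator {0..t} s * E s \<partial>lborel)"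
proof -
  define J where "J s = lim (\<lambda>N. 2 * sg_EN2 N (Z s) (Y s))" for s
  have [measurable]: "(\<lambda>s. sg_EN2 N (Z s) (Y s)) \<in> borel_measurable borel" for N
    by (intro borel_measurable_sg_EN Z_section Y_section)
  have [measurable]: "J \<in> borel_measurable borel"
    unfolding J_def by measurable
  have lim: "(\<lambda>N. 2 * sg_EN2 N (Z s) (Y s)) \<longlonglongrightarrow> J s" "J s = 2 * sg_form (Z s) (Y s)" if s: "regular_time s" for s
  proof -
    have *: "(\<lambda>N. 2 * sg_EN2 N (Z s) (Y s)) \<longlonglongrightarrow> 2 * sg_form (Z s) (Y s)"
      by (intro tendsto_intros sg_form_LIMSEQ sg_F0_in_F Z_F0 Y_F0 s)
    show "J s = 2 * sg_form (Z s) (Y s)"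
      unfolding J_def by (rule limI[OF *])
    with * show "(\<lambda>N. 2 * sg_EN2 N (Z s) (Y s)) \<longlonglongrightarrow> J s"
      by (simp only:)
  qed
  let ?c = "1250 * L\<^sup>2 + 626"
  have dom_int: "integrable lborel (\<lambda>s. ?c * (q s)\<^sup>2)"
    using q_square_integrable by simp
  have dom: "AE s in lborel. norm (indicator {0..t} s * (2 * sg_EN2 N (Z s) (Y s))) \<le> ?c * (q s)\<^sup>2" for N
    using AE_regular_time
  proof eventually_elim
    case (elim s)
    have "2 * \<bar>sg_EN2 N (Z s) (Y s)\<bar> \<le> sg_EN N (Z s) + sg_EN N (Y s)"
      by (rule sg_EN2_AM_GM)
    also have "\<dots> \<le> sg_En (Z s) + sg_En (Y s)"
      by (intro add_mono sg_EN_le_En sg_F0_in_F Z_F0 Y_F0 elim)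
    also have "\<dots> \<le> (1250 * L\<^sup>2 + 1) * (q s)\<^sup>2 + 625 * (q s)\<^sup>2"
      by (intro add_mono En_Z En_Y elim)
    also have "\<dots> = ?c * (q s)\<^sup>2"
      by (simp add: distrib_right)
    finally show ?case
      by (auto simp: indicator_def abs_mult)
  qed
  have conv: "AE s in lborel. (\<lambda>N. indicator {0..t} s * (2 * sg_EN2 N (Z s) (Y s))) \<longlonglongrightarrow> indicator {0..t} s * J s"
    using AE_regular_time by eventually_elim (intro tendsto_mult tendsto_const lim(1))
  have meas: "(\<lambda>s. indicator {0..t} s * J s) \<in> borel_measurable lborel"
    "\<And>N. (\<lambda>s. indicator {0..t} s * (2 * sg_EN2 N (Z s) (Y s))) \<in> borel_measurable lborel"
    by measurable
  have "(\<lambda>N. sg_EN N (Y t)) \<longlonglongrightarrow> (\<integral>s. indicator {0..t} s * J s \<partial>lborel)"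
    unfolding EN_Y_eq_integral[OF t(1,2)]
    by (rule integral_dominated_convergence[OF meas dom_int conv dom])
  then have "E t = (\<integral>s. indicator {0..t} s * J s \<partial>lborel)"
    using LIMSEQ_unique[OF sg_En_LIMSEQ[OF sg_F0_in_F[OF Y_F0[OF t(3)]]]] E_eq[OF t(3,1)] by simp
  also have "\<dots> \<le> (\<integral>s. 19 * L\<^sup>2 * (indicator {0..t} s * E s) \<partial>lborel)"
  proof (rule integral_mono_AE)
    show "integrable lborel (\<lambda>s. indicator {0..t} s * J s)"
      by (rule integrable_dominated_convergence[OF meas dom_int conv dom])
    have "integrable lborel (\<lambda>s. indicator {0..t} s * E s)"
      by (rule Bochner_Integration.integrable_bound[OF E_integrable]) (auto simp: indicator_def)
    then show "integrable lborel (\<lambda>s. 19 * L\<^sup>2 * (indicator {0..t} s * E s))"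
      by (rule integrable_mult_right)
    show "AE s in lborel. indicator {0..t} s * J s \<le> 19 * L\<^sup>2 * (indicator {0..t} s * E s)"
      using AE_regular_time
    proof eventually_elim
      case (elim s)
      show ?case
        using lim(2)[OF elim] form_Z_Y_le[OF elim] E_eq[OF elim] t(1) by (auto simp: indicator_def)
    qed
  qed
  finally show ?thesis
    by simp
qed

text \<open>Once the energy of \<open>Y\<close> vanishes, so does \<open>Y\<close> on the gasket;
  pairing it with \<open>d\<close> itself in the Green identity leaves \<integral> d^2 dm = 0, and
  continuity with full support finishes.\<close>

lemma AE_zero: "AE t in lborel. t \<in> {0..T} \<longrightarrow> (\<forall>x\<in>sg_K. d t x = 0)"
proof -
  have "AE t in lborel. t \<in> {0..T} \<longrightarrow> E t \<le> 19 * L\<^sup>2 * (\<integral>s. indicator {0..t} s * E s \<partial>lborel)"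
    using AE_regular_time AE_Y_eq_integral
    by eventually_elim (auto intro: E_le_integral simp: time_represented_def)
  then have "AE t in lborel. t \<in> {0..T} \<longrightarrow> E t = 0"
    by (intro gronwall_AE_zero E_integrable E_nonneg) auto
  then show ?thesis
    using AE_regular_time
  proof eventually_elim
    case (elim t)
    show ?case
    proof (intro impI ballI)
      fix x assume t: "t \<in> {0..T}" and x: "x \<in> sg_K"
      have "sg_En (Y t) = 0"
        using elim t E_eq by simp
      then have Y0: "Y t y = 0" if "y \<in> sg_K" for y
        using sg_F0_sup_bound[OF Y_F0[OF elim(2)] that] by simp
      have "sg_form (Y t) (d t) = sg_form (\<lambda>_. 0) (d t)"
        by (rule sg_form_cong) (simp_all add: Y0)
      then have zero: "(\<integral>x\<in>sg_K. d t x * d t x \<partial>sg_m) = 0"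
        using sg_green(2)[OF d_continuous d_F0, of t] elim(2) sg_form_zero_left[OF sg_F0_in_F[OF d_F0]]
        by (simp add: Y_def)
      show "d t x = 0"
      proof (rule ccontr)
        assume "d t x \<noteq> 0"
        then have "0 < d t x * d t x"
          by (metis not_real_square_gt_zero)
        then have "0 < (\<integral>x\<in>sg_K. d t x * d t x \<partial>sg_m)"
          using x by (intro sg_integral_pos[of "\<lambda>x. d t x * d t x"] continuous_intros d_continuous elim) auto
        then show False
          using zero by simp
      qed
    qed
  qed
qed

end

section \<open>Weak solutions\<close>

text \<open>A weak solution is only controlled on \<open>(0,T) \<times> K\<close>; cutting it off there makes it Borel measurable on
  the whole space.\<close>

definition sg_cut :: "real \<Rightarrow> (real \<Rightarrow> pt \<Rightarrow> real) \<Rightarrow> real \<Rightarrow> pt \<Rightarrow> real" where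
  "sg_cut T \<rho> s x = (if s \<in> {0<..<T} \<and> x \<in> sg_K then \<rho> s x else 0)"

lemma sg_cut_outside: "s \<notin> {0<..<T} \<Longrightarrow> sg_cut T \<rho> s = (\<lambda>x. 0)"
  by (auto simp: sg_cut_def)

lemma emeasure_lborel_Ioo_finite: "emeasure lborel {a<..<b::real} < \<infinity>"
  by (cases "a \<le> b") simp_all

text \<open>Both factors carry their Borel sets, so the product sigma-algebra is the Borel one of
  the product space, and the hypothesis on the restricted space extends by zero.\<close>

lemma sg_cut_measurable:
  assumes "(\<lambda>(t, x). \<rho> t x) \<in> borel_measurable (restrict_space borel ({0..T} \<times> sg_K))"
  shows "(\<lambda>(s, x). sg_cut T \<rho> s x) \<in> borel_measurable (lborel \<Otimes>\<^sub>M sg_m)"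
proof -
  have "{0..T} \<times> sg_K \<in> sets (borel :: (real \<times> pt) measure)"
    by (intro borel_closed closed_Times closed_sg_K) simp
  then have 1: "(\<lambda>z. indicator ({0..T} \<times> sg_K) z *\<^sub>R (case z of (t, x) \<Rightarrow> \<rho> t x)) \<in> borel_measurable borel"
    using assms by (subst (asm) borel_measurable_restrict_space_iff) auto
  have "{0<..<T} \<times> UNIV \<in> sets (borel :: (real \<times> pt) measure)"
    by (intro borel_open open_Times) auto
  then have 2: "indicator ({0<..<T} \<times> UNIV) \<in> borel_measurable (borel :: (real \<times> pt) measure)"
    by (rule borel_measurable_indicator)
  have eq: "(\<lambda>(s, x). sg_cut T \<rho> s x) = (\<lambda>z. indicator ({0<..<T} \<times> UNIV) z *
      (indicator ({0..T} \<times> sg_K) z *\<^sub>R (case z of (t, x) \<Rightarrow> \<rho> t x)))"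
    by (auto simp: sg_cut_def indicator_def fun_eq_iff)
  have "sets (lborel \<Otimes>\<^sub>M sg_m) = sets ((borel :: real measure) \<Otimes>\<^sub>M (borel :: pt measure))"
    by (rule sets_pair_measure_cong) simp_all
  then have sets: "sets (lborel \<Otimes>\<^sub>M sg_m) = sets (borel :: (real \<times> pt) measure)"
    by (simp only: borel_prod)
  show ?thesis
    unfolding eq measurable_cong_sets[OF sets refl] using 2 1 by (rule borel_measurable_times)
qed

lemma sg_En_zero: "sg_En (\<lambda>x. 0) = 0"
  using sg_En_scale[OF sg_F_zero, of 0] by simp

interpretation lborel_sg_m: pair_sigma_finite "lborel :: real measure" sg_m
  by (intro pair_sigma_finite.intro lborel.sigma_finite_measure_axioms sg_m.sigma_finite_measure_axioms)

locale sg_weak_sol =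
  fixes T :: real and \<rho>B \<rho>0 :: "pt \<Rightarrow> real" and \<Phi> :: "real \<Rightarrow> real" and \<rho> :: "real \<Rightarrow> pt \<Rightarrow> real"
  assumes weak_solution: "sg_weak_solution T \<rho>B \<rho>0 \<Phi> \<rho>"
begin

abbreviation r :: "real \<Rightarrow> pt \<Rightarrow> real" where
  "r \<equiv> sg_cut T \<rho>"

lemma r_measurable [measurable]: "(\<lambda>(s, x). r s x) \<in> borel_measurable (lborel \<Otimes>\<^sub>M sg_m)"
  using weak_solution unfolding sg_weak_solution_def by (intro sg_cut_measurable) (elim conjE)

lemma r_section [measurable]: "(\<lambda>s. r s x) \<in> borel_measurable borel"
  using measurable_compose[OF measurable_Pair2'[of x sg_m lborel] r_measurable] by simp

lemma AE_F: "AE s in lborel. s \<in> {0<..<T} \<longrightarrow> \<rho> s \<in> sg_F"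
  using weak_solution unfolding sg_weak_solution_def by (elim conjE)

lemma AE_boundary: "AE s in lborel. s \<in> {0<..<T} \<longrightarrow> (\<forall>a\<in>sg_V0. \<rho> s a = \<rho>B a)"
  using weak_solution unfolding sg_weak_solution_def by (elim conjE)

lemma E1_finite: "(\<integral>\<^sup>+s. indicator {0<..<T} s * sg_E1sq (\<rho> s) \<partial>lborel) < \<infinity>"
  using weak_solution unfolding sg_weak_solution_def by (elim conjE)

lemma r_in_F:
  assumes "s \<in> {0<..<T} \<longrightarrow> \<rho> s \<in> sg_F"
  shows "r s \<in> sg_F"
proof (cases "s \<in> {0<..<T}")
  case True
  have "continuous_on sg_K (r s)" "sg_energy (r s) = sg_energy (\<rho> s)"
    using sg_F_continuous[of "\<rho> s"] assms True
    by (auto simp: sg_cut_def cong: continuous_on_cong intro!: sg_energy_cong)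
  then show ?thesis
    using assms True by (simp add: sg_F_def)
qed (simp add: sg_cut_outside sg_F_zero)

text \<open>A version of the energy of \<open>r s\<close> that is measurable in \<open>s\<close> by
  construction and agrees with \<open>sg_En (r s)\<close> when \<open>r s\<close> lies in
  \<open>sg_F\<close>.\<close>

definition e :: "real \<Rightarrow> real" where
  "e s = \<bar>lim (\<lambda>N. sg_EN N (r s))\<bar>"

lemma e_measurable [measurable]: "e \<in> borel_measurable borel"
  unfolding e_def sg_EN_eq_EN2 by measurable

lemma e_nonneg: "0 \<le> e s"
  by (simp add: e_def)

lemma e_eq: "r s \<in> sg_F \<Longrightarrow> e s = sg_En (r s)"
  unfolding e_def using limI[OF sg_En_LIMSEQ] sg_En_nonneg by simp

lemma e_integrable: "integrable lborel e"
proof (rule integrableI_bounded)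
  have "(\<integral>\<^sup>+s. ennreal (norm (e s)) \<partial>lborel) \<le> (\<integral>\<^sup>+s. indicator {0<..<T} s * sg_E1sq (\<rho> s) \<partial>lborel)"
  proof (rule nn_integral_mono_AE)
    show "AE s in lborel. ennreal (norm (e s)) \<le> indicator {0<..<T} s * sg_E1sq (\<rho> s)"
      using AE_F
    proof eventually_elim
      case (elim s)
      note e_s = e_eq[OF r_in_F[OF elim]]
      show ?case
      proof (cases "s \<in> {0<..<T}")
        case True
        have "ennreal (e s) = e2ennreal (sg_energy (r s))"
          using sg_energy_eq_En[OF r_in_F[OF elim]] e_s by (simp add: e2ennreal_ereal)
        also have "sg_energy (r s) = sg_energy (\<rho> s)"
          using True by (intro sg_energy_cong) (simp add: sg_cut_def)
        also have "e2ennreal (sg_energy (\<rho> s)) \<le> sg_E1sq (\<rho> s)"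
          by (simp add: sg_E1sq_def)
        finally show ?thesis
          using True e_nonneg by simp
      next
        case False
        then show ?thesis
          using e_s by (simp add: sg_cut_outside sg_En_zero)
      qed
    qed
  qed
  also have "\<dots> < \<infinity>"
    by (rule E1_finite)
  finally show "(\<integral>\<^sup>+s. ennreal (norm (e s)) \<partial>lborel) < \<infinity>" .
qed measurable

lemma r_square_integrable: "integrable (lborel \<Otimes>\<^sub>M sg_m) (\<lambda>(s, x). (r s x)\<^sup>2)"
proof (rule integrableI_bounded)
  have "(\<integral>\<^sup>+z. ennreal (norm (case z of (s, x) \<Rightarrow> (r s x)\<^sup>2)) \<partial>(lborel \<Otimes>\<^sub>M sg_m))
      = (\<integral>\<^sup>+s. \<integral>\<^sup>+x. ennreal ((r s x)\<^sup>2) \<partial>sg_m \<partial>lborel)"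
    by (subst sg_m.nn_integral_fst[symmetric]) auto
  also have "\<dots> \<le> (\<integral>\<^sup>+s. indicator {0<..<T} s * sg_E1sq (\<rho> s) \<partial>lborel)"
  proof (rule nn_integral_mono)
    fix s
    show "(\<integral>\<^sup>+x. ennreal ((r s x)\<^sup>2) \<partial>sg_m) \<le> indicator {0<..<T} s * sg_E1sq (\<rho> s)"
    proof (cases "s \<in> {0<..<T}")
      case True
      then have "(\<integral>\<^sup>+x. ennreal ((r s x)\<^sup>2) \<partial>sg_m) = (\<integral>\<^sup>+x. indicator sg_K x * ennreal ((\<rho> s x)\<^sup>2) \<partial>sg_m)"
        by (intro nn_integral_cong) (auto simp: sg_cut_def indicator_def)
      then show ?thesis
        using True by (simp add: sg_E1sq_def)
    qed (simp add: sg_cut_outside)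
  qed
  also have "\<dots> < \<infinity>"
    by (rule E1_finite)
  finally show "(\<integral>\<^sup>+z. ennreal (norm (case z of (s, x) \<Rightarrow> (r s x)\<^sup>2)) \<partial>(lborel \<Otimes>\<^sub>M sg_m)) < \<infinity>" .
qed measurable

section \<open>Pairings of a weak solution with a fixed function\<close>

definition moment :: "(real \<Rightarrow> real) \<Rightarrow> (pt \<Rightarrow> real) \<Rightarrow> real \<Rightarrow> real" where
  "moment \<psi> g s = indicator {0<..<T} s * (\<integral>x\<in>sg_K. \<psi> (r s x) * g x \<partial>sg_m)"

text \<open>Lipschitz continuity bounds \<open>\<bar>\<psi> u\<bar>\<close> by
  \<open>\<bar>\<psi> 0\<bar> + L * (1 + u\<^sup>2)\<close>, integrable over a bounded time interval
  because the solution is square integrable; Fubini then removes the space variable. The diffusion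
  and the reaction term are both instances.\<close>

lemma moment_integrable:
  assumes \<psi>: "L-lipschitz_on UNIV \<psi>" and g: "continuous_on sg_K g"
  shows "integrable lborel (moment \<psi> g)"
proof -
  obtain B where B: "B > 0" "\<And>x. x \<in> sg_K \<Longrightarrow> \<bar>g x\<bar> \<le> B"
    using bounded_continuous_sg_K[OF g] by metis
  have L: "0 \<le> L"
    using \<psi> by (simp add: lipschitz_on_def)
  have lip: "\<bar>\<psi> u\<bar> \<le> \<bar>\<psi> 0\<bar> + L * \<bar>u\<bar>" for u
    using lipschitz_onD[OF \<psi>, of u 0] by (simp add: dist_real_def)
  have [measurable]: "(\<lambda>x. indicator sg_K x *\<^sub>R g x) \<in> borel_measurable sg_m"
    using set_borel_measurable_continuous_sg_K[OF g] by (simp add: set_borel_measurable_def)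
  have [measurable]: "\<psi> \<in> borel_measurable borel"
    by (intro borel_measurable_continuous_onI lipschitz_on_continuous_on[OF \<psi>])
  let ?k = "\<lambda>(s, x). indicator {0<..<T} s * (\<psi> (r s x) * (indicator sg_K x *\<^sub>R g x))"
  let ?w = "\<lambda>z. B * (\<bar>\<psi> 0\<bar> + L) * indicator ({0<..<T} \<times> UNIV) z + B * L * (case z of (s, x) \<Rightarrow> (r s x)\<^sup>2)"
  have "integrable (lborel \<Otimes>\<^sub>M sg_m) ?k"
  proof (rule Bochner_Integration.integrable_bound)
    have "emeasure (lborel \<Otimes>\<^sub>M sg_m) ({0<..<T} \<times> UNIV) < \<infinity>"
      using emeasure_lborel_Ioo_finite[of 0 T]
      by (subst sg_m.emeasure_pair_measure_Times) (auto simp: sg_m.emeasure_eq_measure ennreal_mult_less_top)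
    then have "integrable (lborel \<Otimes>\<^sub>M sg_m) (indicator ({0<..<T} \<times> UNIV) :: real \<times> pt \<Rightarrow> real)"
      by (intro integrable_real_indicator) auto
    then show "integrable (lborel \<Otimes>\<^sub>M sg_m) ?w"
      using r_square_integrable by (intro Bochner_Integration.integrable_add integrable_mult_right)
    show "AE z in lborel \<Otimes>\<^sub>M sg_m. norm (?k z) \<le> norm (?w z)"
    proof (rule AE_I2)
      fix z :: "real \<times> pt"
      obtain s x where z: "z = (s, x)"
        by (cases z)
      have w: "0 \<le> ?w (s, x)"
        using B(1) L by (auto intro!: add_nonneg_nonneg mult_nonneg_nonneg)
      have "\<bar>?k (s, x)\<bar> \<le> ?w (s, x)"
      proof (cases "s \<in> {0<..<T} \<and> x \<in> sg_K")
        case True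
        have "\<bar>r s x\<bar> \<le> 1 + (r s x)\<^sup>2"
        proof -
          have "0 \<le> (\<bar>r s x\<bar> - 1)\<^sup>2 + \<bar>r s x\<bar>"
            by simp
          also have "\<dots> = 1 + (r s x)\<^sup>2 - \<bar>r s x\<bar>"
            by (simp add: power2_diff)
          finally show ?thesis
            by simp
        qed
        then have "\<bar>\<psi> (r s x)\<bar> \<le> \<bar>\<psi> 0\<bar> + L * (1 + (r s x)\<^sup>2)"
          using L by (intro order_trans[OF lip] add_left_mono mult_left_mono)
        then have "\<bar>\<psi> (r s x)\<bar> * \<bar>g x\<bar> \<le> (\<bar>\<psi> 0\<bar> + L * (1 + (r s x)\<^sup>2)) * B"
          using True B L by (intro mult_mono) auto
        then show ?thesis
          using True by (simp add: abs_mult algebra_simps)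
      next
        case False
        then show ?thesis
          using w by (auto simp: indicator_def)
      qed
      then show "norm (?k z) \<le> norm (?w z)"
        unfolding z real_norm_def by (rule order_trans[OF _ abs_ge_self])
    qed
  qed measurable
  then have "integrable lborel (\<lambda>s. \<integral>x. ?k (s, x) \<partial>sg_m)"
    by (rule lborel_sg_m.integrable_fst')
  moreover have "(\<lambda>s. \<integral>x. ?k (s, x) \<partial>sg_m) = moment \<psi> g"
  proof
    fix s
    have "(\<integral>x. ?k (s, x) \<partial>sg_m) = (\<integral>x. indicator {0<..<T} s * (\<psi> (r s x) * (indicator sg_K x *\<^sub>R g x)) \<partial>sg_m)"
      by simp
    also have "\<dots> = indicator {0<..<T} s * (\<integral>x. \<psi> (r s x) * (indicator sg_K x *\<^sub>R g x) \<partial>sg_m)"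
      by (rule integral_mult_right_zero)
    also have "\<dots> = moment \<psi> g s"
      by (simp add: moment_def set_lebesgue_integral_def mult.left_commute)
    finally show "(\<integral>x. ?k (s, x) \<partial>sg_m) = moment \<psi> g s" .
  qed
  ultimately show ?thesis
    by simp
qed

lemma moment_set_integral:
  assumes \<psi>: "L-lipschitz_on UNIV \<psi>" and g: "continuous_on sg_K g" and t: "t \<in> {0<..<T}"
  defines "h \<equiv> \<lambda>s. \<integral>x\<in>sg_K. \<psi> (\<rho> s x) * g x \<partial>sg_m"
  shows "integrable lborel (\<lambda>s. indicator {0..t} s * moment \<psi> g s)"
    and "set_integrable lborel {0..t} h"
    and "(\<integral>s\<in>{0..t}. h s \<partial>lborel) = (\<integral>s. indicator {0..t} s * moment \<psi> g s \<partial>lborel)"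
proof -
  have "h s = moment \<psi> g s" if "s \<in> {0<..<T}" for s
    unfolding h_def moment_def using that
    by (simp add: sg_cut_def) (rule set_lebesgue_integral_cong, auto)
  \<comment> \<open>On [0, t] the two integrands differ only at time 0, where \<open>moment\<close>
    is cut off while \<open>h 0\<close> can be any number.\<close>
  then have eq: "(\<lambda>s. indicator {0..t} s *\<^sub>R h s) = (\<lambda>s. indicator {0..t} s * moment \<psi> g s + indicator {0} s * h 0)"
    using t by (auto simp: fun_eq_iff indicator_def moment_def)
  show 1: "integrable lborel (\<lambda>s. indicator {0..t} s * moment \<psi> g s)"
    by (rule Bochner_Integration.integrable_bound[OF moment_integrable[OF \<psi> g]])
      (use borel_measurable_integrable[OF moment_integrable[OF \<psi> g]] in \<open>auto simp: indicator_def\<close>)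
  have 2: "integrable lborel (\<lambda>s. indicator {0} s * h 0 :: real)"
    by (intro integrable_mult_left integrable_real_indicator) auto
  show "set_integrable lborel {0..t} h"
    unfolding set_integrable_def eq by (intro Bochner_Integration.integrable_add 1 2)
  show "(\<integral>s\<in>{0..t}. h s \<partial>lborel) = (\<integral>s. indicator {0..t} s * moment \<psi> g s \<partial>lborel)"
    unfolding set_lebesgue_integral_def eq by (simp add: Bochner_Integration.integral_add[OF 1 2])
qed

end

lemma sg_supK_eq_zero: "(\<And>x. x \<in> sg_K \<Longrightarrow> g x = 0) \<Longrightarrow> sg_supK g = 0"
  unfolding sg_supK_def using sg_K_nonempty by (simp cong: SUP_cong)

lemma sg_zero_lap_witness: "sg_lap_witness (\<lambda>x. 0) (\<lambda>x. 0)"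
  unfolding sg_lap_witness_F0 by (simp add: sg_form_zero_left sg_F0_in_F)

lemma sg_domLap0_iff: "u \<in> sg_domLap0 \<longleftrightarrow> u \<in> sg_F0 \<and> (\<exists>f. sg_lap_witness u f)"
  by (auto simp: sg_domLap0_def sg_domLap_def sg_F0_def)

lemma sg_test_const:
  assumes "u \<in> sg_domLap0"
  shows "sg_test T (\<lambda>_. u) (\<lambda>_ _. 0)"
proof -
  \<comment> \<open>As \<open>sg_lap\<close> is defined by choice, even the zero function requires
    uniqueness of the witness.\<close>
  have lap0: "sg_lap (\<lambda>x. 0) x = 0" if "x \<in> sg_K" for x
    using sg_lap_eq[OF sg_zero_lap_witness that] by simp
  have "(\<lambda>x. 0) \<in> sg_domLap0"
    unfolding sg_domLap0_iff using sg_F0_zero sg_zero_lap_witness by blast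
  then show ?thesis
    using assms by (simp add: sg_test_def sg_distD_def sg_supK_eq_zero lap0)
qed

context sg_weak_sol
begin

text \<open>The test path is constantly \<open>sg_green f\<close>, whose Laplacian is -f on the
  gasket; the three integrability premises of the weak formulation are discharged on the way. The
  last two terms are the same for both solutions and cancel in the difference.\<close>

lemma stationary_test:
  assumes \<Phi>: "L-lipschitz_on UNIV \<Phi>" and f: "continuous_on sg_K f" and t: "t \<in> {0<..<T}"
  shows "(\<integral>x\<in>sg_K. \<rho> t x * sg_green f x \<partial>sg_m) =
      (\<integral>s. indicator {0..t} s * moment (\<lambda>x. x) (\<lambda>x. - 2/3 * f x) s \<partial>lborel)
      + (\<integral>s. indicator {0..t} s * moment \<Phi> (sg_green f) s \<partial>lborel)
      + (\<integral>x\<in>sg_K. \<rho>0 x * sg_green f x \<partial>sg_m)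
      - 2/3 * (\<integral>s\<in>{0..t}. (\<Sum>a\<in>sg_V0. \<rho>B a * sg_normal (sg_green f) a) \<partial>lborel)"
proof -
  let ?u = "sg_green f"
  have id: "1-lipschitz_on UNIV (\<lambda>x::real. x)"
    by (auto simp: lipschitz_on_def)
  have u_cont: "continuous_on sg_K ?u"
    by (intro sg_F_continuous sg_F0_in_F sg_green f)
  have g_cont: "continuous_on sg_K (\<lambda>x. - 2/3 * f x)"
    by (intro continuous_intros f)
  have u: "?u \<in> sg_domLap0"
    unfolding sg_domLap0_iff using sg_green(1)[OF f] sg_green_lap_witness[OF f] by blast
  have lap: "(\<lambda>s. \<integral>x\<in>sg_K. \<rho> s x * (2/3 * sg_lap ?u x + 0) \<partial>sg_m) = (\<lambda>s. \<integral>x\<in>sg_K. \<rho> s x * (- 2/3 * f x) \<partial>sg_m)"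
    by (intro ext set_lebesgue_integral_cong) (simp_all add: sg_lap_eq[OF sg_green_lap_witness[OF f]])
  note I1 = moment_set_integral[OF id g_cont t]
  note I2 = moment_set_integral[OF \<Phi> u_cont t]
  have I3: "set_integrable lborel {0..t} (\<lambda>s. \<Sum>a\<in>sg_V0. \<rho>B a * sg_normal ?u a)"
    by (rule borel_integrable_atLeastAtMost') (rule continuous_on_const)
  have "\<forall>t\<in>{0<..<T}. \<forall>F G. sg_test T F G \<longrightarrow>
        set_integrable lborel {0..t}
          (\<lambda>s. \<integral>x\<in>sg_K. \<rho> s x * (2/3 * sg_lap (F s) x + G s x) \<partial>sg_m) \<longrightarrow>
        set_integrable lborel {0..t} (\<lambda>s. \<integral>x\<in>sg_K. \<Phi> (\<rho> s x) * F s x \<partial>sg_m) \<longrightarrow>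
        set_integrable lborel {0..t} (\<lambda>s. \<Sum>a\<in>sg_V0. \<rho>B a * sg_normal (F s) a) \<longrightarrow>
        0 = (\<integral>x\<in>sg_K. \<rho> t x * F t x \<partial>sg_m) - (\<integral>x\<in>sg_K. \<rho>0 x * F 0 x \<partial>sg_m)
            - (\<integral>s\<in>{0..t}. (\<integral>x\<in>sg_K. \<rho> s x * (2/3 * sg_lap (F s) x + G s x) \<partial>sg_m) \<partial>lborel)
            - (\<integral>s\<in>{0..t}. (\<integral>x\<in>sg_K. \<Phi> (\<rho> s x) * F s x \<partial>sg_m) \<partial>lborel)
            + 2/3 * (\<integral>s\<in>{0..t}. (\<Sum>a\<in>sg_V0. \<rho>B a * sg_normal (F s) a) \<partial>lborel)"
    using weak_solution unfolding sg_weak_solution_def by (elim conjE)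
  from this[rule_format, OF t sg_test_const[OF u], unfolded lap, OF I1(2) I2(2) I3]
  show ?thesis
    unfolding I1(3) I2(3) by linarith
qed

end

text \<open>Equal boundary values put the difference into \<open>sg_F0\<close>, and the nonlinearity
  enters the locale only through the Lipschitz inequality between \<open>p\<close> and
  \<open>d\<close>.\<close>

lemma sg_linear_solution_difference:
  assumes \<Phi>: "L-lipschitz_on UNIV \<Phi>"
    and \<rho>1: "sg_weak_solution T \<rho>B \<rho>0 \<Phi> \<rho>1" and \<rho>2: "sg_weak_solution T \<rho>B \<rho>0 \<Phi> \<rho>2"
  defines "d \<equiv> \<lambda>s x. sg_cut T \<rho>1 s x - sg_cut T \<rho>2 s x"
    and "p \<equiv> \<lambda>s x. \<Phi> (sg_cut T \<rho>1 s x) - \<Phi> (sg_cut T \<rho>2 s x)"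
  shows "\<exists>q. sg_linear_solution T L d p q"
proof -
  interpret A: sg_weak_sol T \<rho>B \<rho>0 \<Phi> \<rho>1
    by unfold_locales (rule \<rho>1)
  interpret B: sg_weak_sol T \<rho>B \<rho>0 \<Phi> \<rho>2
    by unfold_locales (rule \<rho>2)
  have L: "0 \<le> L"
    using \<Phi> by (simp add: lipschitz_on_def)
  have lip: "\<bar>\<Phi> u - \<Phi> v\<bar> \<le> L * \<bar>u - v\<bar>" for u v
    using lipschitz_onD[OF \<Phi>, of u v] by (simp add: dist_real_def)
  have \<Phi>_cont: "continuous_on UNIV \<Phi>"
    by (rule lipschitz_on_continuous_on[OF \<Phi>])
  have [measurable]: "\<Phi> \<in> borel_measurable borel"
    by (intro borel_measurable_continuous_onI \<Phi>_cont)
  \<comment> \<open>By the parallelogram law the energy of a difference is at most twice the sum of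
    the energies, which is \<open>(q s)\<^sup>2\<close> inside the interval.\<close>
  define q where "q s = indicator {0<..<T} s * sqrt (2 * A.e s + 2 * B.e s)" for s
  have e_nonneg: "0 \<le> 2 * A.e s + 2 * B.e s" for s
    using A.e_nonneg B.e_nonneg by simp
  have e_int: "integrable lborel (\<lambda>s. 2 * A.e s + 2 * B.e s)"
    by (intro Bochner_Integration.integrable_add integrable_mult_right A.e_integrable B.e_integrable)
  have d_meas [measurable]: "(\<lambda>(s, x). d s x) \<in> borel_measurable (lborel \<Otimes>\<^sub>M sg_m)"
    unfolding d_def by measurable
  have p_meas [measurable]: "(\<lambda>(s, x). p s x) \<in> borel_measurable (lborel \<Otimes>\<^sub>M sg_m)"
    unfolding p_def by measurable
  have AE_F: "AE s in lborel. A.r s \<in> sg_F \<and> B.r s \<in> sg_F"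
    using A.AE_F B.AE_F by eventually_elim (simp add: A.r_in_F B.r_in_F)
  have id: "1-lipschitz_on UNIV (\<lambda>x::real. x)"
    by (auto simp: lipschitz_on_def)
  have [measurable]: "q \<in> borel_measurable borel"
    unfolding q_def by measurable
  have "sg_linear_solution T L d p q"
  proof
    show "0 \<le> q s" for s
      using e_nonneg by (simp add: q_def)
    show "integrable lborel (\<lambda>s. (q s)\<^sup>2)"
      by (rule Bochner_Integration.integrable_bound[OF e_int])
        (use e_nonneg in \<open>auto simp: q_def indicator_def\<close>)
    have "integrable lborel (\<lambda>s. indicator {0<..<T} s + (2 * A.e s + 2 * B.e s))"
      using emeasure_lborel_Ioo_finite[of 0 T]
      by (intro Bochner_Integration.integrable_add[OF integrable_real_indicator e_int]) auto
    then show "integrable lborel q"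
    proof (rule Bochner_Integration.integrable_bound)
      \<comment> \<open>On an interval of finite length this lets the integrable energies dominate
        \<open>q\<close> itself, besides its square.\<close>
      have "sqrt a \<le> 1 + a" if "0 \<le> a" for a :: real
        using that by (intro real_le_lsqrt) (auto simp: power2_eq_square algebra_simps)
      then show "AE s in lborel. norm (q s) \<le> norm (indicator {0<..<T} s + (2 * A.e s + 2 * B.e s))"
        using e_nonneg by (intro AE_I2) (auto simp: q_def indicator_def)
    qed simp
    show "AE s in lborel. d s \<in> sg_F0 \<and> sg_En (d s) \<le> (q s)\<^sup>2 \<and> continuous_on sg_K (p s) \<and>
        (\<forall>x\<in>sg_K. \<bar>p s x\<bar> \<le> L * \<bar>d s x\<bar>)"
      using AE_F A.AE_boundary B.AE_boundary
    proof eventually_elim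
      case (elim s)
      have F: "d s \<in> sg_F"
        unfolding d_def using elim by (intro sg_F_diff) auto
      have "d s a = 0" if "a \<in> sg_V0" for a
        using elim that by (auto simp: d_def sg_cut_def)
      then have F0: "d s \<in> sg_F0"
        using F by (simp add: sg_F0_def)
      have En: "sg_En (d s) \<le> (q s)\<^sup>2"
      proof (cases "s \<in> {0<..<T}")
        case True
        have "sg_En (d s) \<le> 2 * sg_En (A.r s) + 2 * sg_En (B.r s)"
          using sg_En_add[of "A.r s" "B.r s"] sg_En_diff[of "A.r s" "B.r s"] elim
            sg_En_nonneg[of "\<lambda>x. A.r s x + B.r s x"] by (simp add: d_def)
        also have "\<dots> = (q s)\<^sup>2"
          using True elim e_nonneg[of s] by (simp add: q_def A.e_eq B.e_eq)
        finally show ?thesis .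
      next
        case False
        then show ?thesis
          by (simp add: d_def sg_cut_outside sg_En_zero)
      qed
      have "continuous_on sg_K (p s)"
        unfolding p_def using elim
        by (intro continuous_on_diff continuous_on_compose2[OF \<Phi>_cont] sg_F_continuous) auto
      then show ?case
        using F0 En lip by (simp add: p_def d_def)
    qed
    show "AE t in lborel. t \<in> {0..T} \<longrightarrow> (\<forall>f. continuous_on sg_K f \<longrightarrow>
      (\<integral>x\<in>sg_K. d t x * sg_green f x \<partial>sg_m) = (\<integral>s. indicator {0..t} s *
        ((\<integral>x\<in>sg_K. p s x * sg_green f x \<partial>sg_m) - 2/3 * (\<integral>x\<in>sg_K. d s x * f x \<partial>sg_m)) \<partial>lborel))"
      \<comment> \<open>The endpoints are discarded because the weak formulation speaks of interior
        times only.\<close>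
      using AE_F AE_lborel_singleton[of 0] AE_lborel_singleton[of T]
    proof eventually_elim
      case (elim t)
      show ?case
      proof (intro impI allI)
        fix f :: "pt \<Rightarrow> real"
        assume "t \<in> {0..T}" and f: "continuous_on sg_K f"
        then have t: "t \<in> {0<..<T}"
          using elim by auto
        let ?u = "sg_green f" and ?f = "\<lambda>x. - 2/3 * f x"
        have u: "continuous_on sg_K ?u"
          by (intro sg_F_continuous sg_F0_in_F sg_green f)
        have f': "continuous_on sg_K ?f"
          by (intro continuous_intros f)
        note intA = A.moment_set_integral(1)[OF id f' t] A.moment_set_integral(1)[OF \<Phi> u t]
        note intB = B.moment_set_integral(1)[OF id f' t] B.moment_set_integral(1)[OF \<Phi> u t]
        note int = set_integrable_continuous_sg_K
        have rA: "(\<integral>x\<in>sg_K. A.r t x * ?u x \<partial>sg_m) = (\<integral>x\<in>sg_K. \<rho>1 t x * ?u x \<partial>sg_m)"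
          and rB: "(\<integral>x\<in>sg_K. B.r t x * ?u x \<partial>sg_m) = (\<integral>x\<in>sg_K. \<rho>2 t x * ?u x \<partial>sg_m)"
          using t by (auto intro!: set_lebesgue_integral_cong simp: sg_cut_def)
        have "(\<integral>x\<in>sg_K. d t x * ?u x \<partial>sg_m) = (\<integral>x\<in>sg_K. \<rho>1 t x * ?u x \<partial>sg_m) - (\<integral>x\<in>sg_K. \<rho>2 t x * ?u x \<partial>sg_m)"
          unfolding d_def left_diff_distrib rA[symmetric] rB[symmetric] using elim
          by (intro set_integral_diff(2) int continuous_on_mult u sg_F_continuous) auto
        also have "\<dots> = ((\<integral>s. indicator {0..t} s * A.moment (\<lambda>x. x) ?f s \<partial>lborel) + (\<integral>s. indicator {0..t} s * A.moment \<Phi> ?u s \<partial>lborel))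
            - ((\<integral>s. indicator {0..t} s * B.moment (\<lambda>x. x) ?f s \<partial>lborel) + (\<integral>s. indicator {0..t} s * B.moment \<Phi> ?u s \<partial>lborel))"
          using A.stationary_test[OF \<Phi> f t] B.stationary_test[OF \<Phi> f t] by linarith
        also have "\<dots> = (\<integral>s. (indicator {0..t} s * A.moment (\<lambda>x. x) ?f s + indicator {0..t} s * A.moment \<Phi> ?u s)
            - (indicator {0..t} s * B.moment (\<lambda>x. x) ?f s + indicator {0..t} s * B.moment \<Phi> ?u s) \<partial>lborel)"
          by (simp only: Bochner_Integration.integral_add[OF intA] Bochner_Integration.integral_add[OF intB]
              Bochner_Integration.integral_diff[OF Bochner_Integration.integrable_add[OF intA] Bochner_Integration.integrable_add[OF intB]])
        also have "\<dots> = (\<integral>s. indicator {0..t} s *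
            ((\<integral>x\<in>sg_K. p s x * ?u x \<partial>sg_m) - 2/3 * (\<integral>x\<in>sg_K. d s x * f x \<partial>sg_m)) \<partial>lborel)"
        proof (rule integral_cong_AE)
          show "(\<lambda>s. (indicator {0..t} s * A.moment (\<lambda>x. x) ?f s + indicator {0..t} s * A.moment \<Phi> ?u s)
            - (indicator {0..t} s * B.moment (\<lambda>x. x) ?f s + indicator {0..t} s * B.moment \<Phi> ?u s)) \<in> borel_measurable lborel"
            by (intro borel_measurable_diff borel_measurable_add borel_measurable_integrable intA intB)
          have "(\<lambda>s. \<integral>x\<in>sg_K. p s x * ?u x \<partial>sg_m) \<in> borel_measurable borel" "(\<lambda>s. \<integral>x\<in>sg_K. d s x * f x \<partial>sg_m) \<in> borel_measurable borel"
            by (intro sg_pair_integral_measurable p_meas d_meas u f)+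
          then show "(\<lambda>s. indicator {0..t} s *
            ((\<integral>x\<in>sg_K. p s x * ?u x \<partial>sg_m) - 2/3 * (\<integral>x\<in>sg_K. d s x * f x \<partial>sg_m))) \<in> borel_measurable lborel"
            by measurable
          show "AE s in lborel. (indicator {0..t} s * A.moment (\<lambda>x. x) ?f s + indicator {0..t} s * A.moment \<Phi> ?u s)
              - (indicator {0..t} s * B.moment (\<lambda>x. x) ?f s + indicator {0..t} s * B.moment \<Phi> ?u s)
            = indicator {0..t} s * ((\<integral>x\<in>sg_K. p s x * ?u x \<partial>sg_m) - 2/3 * (\<integral>x\<in>sg_K. d s x * f x \<partial>sg_m))"
            using AE_F AE_lborel_singleton[of 0]
          proof eventually_elim
            case (elim s)
            have r_cont: "continuous_on sg_K (A.r s)" "continuous_on sg_K (B.r s)"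
              using elim by (auto intro: sg_F_continuous)
            have \<Phi>r_cont: "continuous_on sg_K (\<lambda>x. \<Phi> (A.r s x))" "continuous_on sg_K (\<lambda>x. \<Phi> (B.r s x))"
              by (intro continuous_on_compose2[OF \<Phi>_cont] r_cont; simp)+
            show ?case
            proof (cases "s \<in> {0..t}")
              case True
              then have s: "s \<in> {0<..<T}"
                using elim t by auto
              have "(\<integral>x\<in>sg_K. d s x * f x \<partial>sg_m) = (\<integral>x\<in>sg_K. A.r s x * f x \<partial>sg_m) - (\<integral>x\<in>sg_K. B.r s x * f x \<partial>sg_m)"
                unfolding d_def left_diff_distrib
                by (intro set_integral_diff(2) int continuous_on_mult f r_cont)
              moreover have "(\<integral>x\<in>sg_K. p s x * ?u x \<partial>sg_m) = (\<integral>x\<in>sg_K. \<Phi> (A.r s x) * ?u x \<partial>sg_m) - (\<integral>x\<in>sg_K. \<Phi> (B.r s x) * ?u x \<partial>sg_m)"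
                unfolding p_def left_diff_distrib
                by (intro set_integral_diff(2) int continuous_on_mult u \<Phi>r_cont)
              moreover have scale: "(\<integral>x\<in>sg_K. h x * (- 2/3 * f x) \<partial>sg_m) = - 2/3 * (\<integral>x\<in>sg_K. h x * f x \<partial>sg_m)" for h
                by (simp only: mult.left_commute[of _ "- 2/3"] set_integral_mult_right)
              have "A.moment (\<lambda>x. x) ?f s = - 2/3 * (\<integral>x\<in>sg_K. A.r s x * f x \<partial>sg_m)"
                "B.moment (\<lambda>x. x) ?f s = - 2/3 * (\<integral>x\<in>sg_K. B.r s x * f x \<partial>sg_m)"
                unfolding A.moment_def B.moment_def scale using s by simp_all
              moreover have "A.moment \<Phi> ?u s = (\<integral>x\<in>sg_K. \<Phi> (A.r s x) * ?u x \<partial>sg_m)"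
                "B.moment \<Phi> ?u s = (\<integral>x\<in>sg_K. \<Phi> (B.r s x) * ?u x \<partial>sg_m)"
                using s by (simp_all add: A.moment_def B.moment_def)
              ultimately show ?thesis
                using True by (simp add: algebra_simps)
            qed simp
          qed
        qed
        finally show "(\<integral>x\<in>sg_K. d t x * ?u x \<partial>sg_m) = (\<integral>s. indicator {0..t} s *
            ((\<integral>x\<in>sg_K. p s x * ?u x \<partial>sg_m) - 2/3 * (\<integral>x\<in>sg_K. d s x * f x \<partial>sg_m)) \<partial>lborel)" .
      qed
    qed
  qed (use L d_meas p_meas in auto)
  then show ?thesis
    by (rule exI[of _ q])
qed

theorem theorem2p1:
  fixes T :: real and \<rho>B \<rho>0 :: "real \<times> real \<Rightarrow> real" and \<Phi> :: "real \<Rightarrow> real"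
    and \<rho>1 \<rho>2 :: "real \<Rightarrow> real \<times> real \<Rightarrow> real"
  assumes "T > 0"
    and "set_borel_measurable sg_m sg_K \<rho>0"
    and "set_integrable sg_m sg_K (\<lambda>x. (\<rho>0 x)^2)"
    and "\<exists>L. L-lipschitz_on UNIV \<Phi>"
    and "sg_weak_solution T \<rho>B \<rho>0 \<Phi> \<rho>1"
    and "sg_weak_solution T \<rho>B \<rho>0 \<Phi> \<rho>2"
  shows "AE t in lborel. t \<in> {0<..<T} \<longrightarrow> (\<forall>x\<in>sg_K. \<rho>1 t x = \<rho>2 t x)"
proof -
  obtain L where "L-lipschitz_on UNIV \<Phi>"
    using assms(4) by blast
  from sg_linear_solution_difference[OF this assms(5,6)]
  obtain q where "sg_linear_solution T L (\<lambda>s x. sg_cut T \<rho>1 s x - sg_cut T \<rho>2 s x)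
      (\<lambda>s x. \<Phi> (sg_cut T \<rho>1 s x) - \<Phi> (sg_cut T \<rho>2 s x)) q"
    by blast
  from sg_linear_solution.AE_zero[OF this] show ?thesis
    by eventually_elim (auto simp: sg_cut_def)
qed

end
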